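(* Let $A$ be a commutative ring, $U$ and $V$ two standard $A$-algebras, $F$ a standard $U$-module and $G$ a standard $V$-module. Then $U\otimes_A V$ is a standard $A$-algebra, $F\otimes_A G$ is a standard $U\otimes_A V$-module and $\mathrm{rt}(F\otimes G)\leq \max(\mathrm{rt}(F),\mathrm{rt}(G))$.
   Context: Let $A$ be a commutative ring. A graded (commutative) $A$-algebra $U=\bigoplus_{n\geq 0}U_n$ is a standard $A$-algebra if $U_0=A$ and $U$ is generated as an $A$-algebra by $U_1$. A graded $U$-module $F=\bigoplus_{n\geq 0}F_n$ is a standard $U$-module if it is generated as a $U$-module by $F_0$, i.e. $F_n=U_nF_0$ for all $n\ge 0$. Tensor products are over $A$; $U\otimes V$ and $F\otimes G$ are graded by $(U\otimes V)_n=\bigoplus_{p+q=n}U_p\otimes V_q$ and $(F\otimes G)_n=\bigoplus_{p+q=n}F_p\otimes G_q$. Relation type: for a graded module $E=\bigoplus_{n\ge 0} E_n$ put $s(E)=\min\{r\geq 1\mid E_n=0\text{ for all }n\geq r+1\}$ (possibly $\infty$). For a standard $U$-module $F$, let $\mathbf{S}(U_1)$ be the symmetric algebra of the $A$-module $U_1$, let $\alpha:\mathbf{S}(U_1)\to U$ be the surjective graded $A$-algebra morphism induced by the identity on $U_1$, and let $\gamma:\mathbf{S}(U_1)\otimes F_0\xrightarrow{\alpha\otimes 1}U\otimes F_0\to F$ be its composition with the structural morphism; $\gamma$ is a surjective graded morphism of $\mathbf{S}(U_1)$-modules. The module of effective $n$-relations of $F$ is $E(F)_n=\ker\gamma_n/U_1\ker\gamma_{n-1}$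 for $n\geq 1$ (and $E(F)_0=0$), $E(F)=\bigoplus_{n\ge 1}E(F)_n$, and the relation type of $F$ is $\mathrm{rt}(F)=s(E(F))$, i.e. the least $r\geq 1$ with $E(F)_n=0$ for all $n\geq r+1$ (possibly $\infty$). The relation type of $F\otimes G$ is taken as a standard $U\otimes V$-module. *)

theory Defs
  imports "HOL-Algebra.Algebra" "HOL-Library.Extended_Nat"
begin

section \<open>Standard graded algebras and modules\<close>

definition internal_direct_sum :: "('m, 's) ring_scheme \<Rightarrow> (nat \<Rightarrow> 'm set) \<Rightarrow> bool" where
  "internal_direct_sum M Mg \<longleftrightarrow>
     (\<forall>n. additive_subgroup (Mg n) M) \<and>
     (\<forall>x \<in> carrier M. \<exists>!c :: nat \<Rightarrow> 'm.
        (\<forall>n. c n \<in> Mg n) \<and> finite {n. c n \<noteq> \<zero>\<^bsub>M\<^esub>} \<and>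
        x = finsum M c {n. c n \<noteq> \<zero>\<^bsub>M\<^esub>})"

locale graded_algebra = algebra A U
  for A :: "('a, 'r) ring_scheme" and U :: "('a, 'u, 's) module_scheme" and Ug :: "nat \<Rightarrow> 'u set" +
  assumes grading: "internal_direct_sum U Ug"
    and submodule_grade: "submodule (Ug n) A U"
    and one_grade: "\<one>\<^bsub>U\<^esub> \<in> Ug 0"
    and mult_grade: "\<lbrakk>x \<in> Ug p; y \<in> Ug q\<rbrakk> \<Longrightarrow> x \<otimes>\<^bsub>U\<^esub> y \<in> Ug (p + q)"

text \<open>The condition \<open>U\<^sub>0 = A\<close> says that the structural morphism identifies \<open>A\<close> with \<open>U\<^sub>0\<close>.
  The \<open>A\<close>-subalgebra generated by a set is the subring generated by it and the scalars.\<close>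

locale standard_algebra = graded_algebra A U Ug
  for A :: "('a, 'r) ring_scheme" and U :: "('a, 'u, 's) module_scheme" and Ug :: "nat \<Rightarrow> 'u set" +
  assumes grade_zero: "bij_betw (\<lambda>a. a \<odot>\<^bsub>U\<^esub> \<one>\<^bsub>U\<^esub>) (carrier A) (Ug 0)"
    and generated: "carrier U =
      generate_ring U ((\<lambda>a. a \<odot>\<^bsub>U\<^esub> \<one>\<^bsub>U\<^esub>) ` carrier A \<union> Ug 1)"

text \<open>The additive subgroup generated by the products \<open>u \<odot> x\<close>.\<close>

definition smult_span :: "('u, 'f, 's) module_scheme \<Rightarrow> 'u set \<Rightarrow> 'f set \<Rightarrow> 'f set" where
  "smult_span F I Y = generate (add_monoid F) {u \<odot>\<^bsub>F\<^esub> x | u x. u \<in> I \<and> x \<in> Y}"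

locale graded_module = module U F
  for U :: "('u, 'r) ring_scheme" and Ug :: "nat \<Rightarrow> 'u set"
    and F :: "('u, 'f, 's) module_scheme" and Fg :: "nat \<Rightarrow> 'f set" +
  assumes grading: "internal_direct_sum F Fg"
    and smult_grade: "\<lbrakk>u \<in> Ug p; x \<in> Fg q\<rbrakk> \<Longrightarrow> u \<odot>\<^bsub>F\<^esub> x \<in> Fg (p + q)"

locale standard_module = graded_module U Ug F Fg
  for U :: "('u, 'r) ring_scheme" and Ug :: "nat \<Rightarrow> 'u set"
    and F :: "('u, 'f, 's) module_scheme" and Fg :: "nat \<Rightarrow> 'f set" +
  assumes generated: "Fg n = smult_span F (Ug n) (Fg 0)"

text \<open>A \<open>U\<close>-module as a module over \<open>A\<close>, along \<open>A \<rightarrow> U\<close>, \<open>a \<mapsto> a \<odot> \<one>\<close>.\<close>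

definition restrict_scalars ::
    "('a, 'u, 's) module_scheme \<Rightarrow> ('u, 'f, 't) module_scheme \<Rightarrow> ('a, 'f) module" where
  "restrict_scalars U F =
     \<lparr>carrier = carrier F, monoid.mult = monoid.mult F, one = \<one>\<^bsub>F\<^esub>,
      ring.zero = \<zero>\<^bsub>F\<^esub>, ring.add = ring.add F,
      smult = (\<lambda>a x. (a \<odot>\<^bsub>U\<^esub> \<one>\<^bsub>U\<^esub>) \<odot>\<^bsub>F\<^esub> x)\<rparr>"


section \<open>Tensor products\<close>

text \<open>\<open>M \<otimes>\<^sub>A N\<close> is the free abelian group on \<open>M \<times> N\<close> modulo the subgroup generated by the
  biadditivity and balancing relations; its elements are cosets.\<close>

type_synonym ('m, 'n) tensor = "('m \<times> 'n \<Rightarrow>\<^sub>0 int) set"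

definition tensor_relations ::
    "('a, 'r) ring_scheme \<Rightarrow> ('a, 'm, 's) module_scheme \<Rightarrow> ('a, 'n, 't) module_scheme
      \<Rightarrow> ('m \<times> 'n \<Rightarrow>\<^sub>0 int) set" where
  "tensor_relations A M N =
     {frag_of (x \<oplus>\<^bsub>M\<^esub> x', y) - frag_of (x, y) - frag_of (x', y) | x x' y.
        x \<in> carrier M \<and> x' \<in> carrier M \<and> y \<in> carrier N} \<union>
     {frag_of (x, y \<oplus>\<^bsub>N\<^esub> y') - frag_of (x, y) - frag_of (x, y') | x y y'.
        x \<in> carrier M \<and> y \<in> carrier N \<and> y' \<in> carrier N} \<union>
     {frag_of (a \<odot>\<^bsub>M\<^esub> x, y) - frag_of (x, a \<odot>\<^bsub>N\<^esub> y) | a x y.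
        a \<in> carrier A \<and> x \<in> carrier M \<and> y \<in> carrier N}"

definition tensor_null ::
    "('a, 'r) ring_scheme \<Rightarrow> ('a, 'm, 's) module_scheme \<Rightarrow> ('a, 'n, 't) module_scheme
      \<Rightarrow> ('m \<times> 'n \<Rightarrow>\<^sub>0 int) set" where
  "tensor_null A M N =
     generate (free_Abelian_group (carrier M \<times> carrier N)) (tensor_relations A M N)"

definition tensor_group ::
    "('a, 'r) ring_scheme \<Rightarrow> ('a, 'm, 's) module_scheme \<Rightarrow> ('a, 'n, 't) module_scheme
      \<Rightarrow> ('m, 'n) tensor monoid" where
  "tensor_group A M N = free_Abelian_group (carrier M \<times> carrier N) Mod tensor_null A M N"

definition pure_tensor ::
    "('a, 'r) ring_scheme \<Rightarrow> ('a, 'm, 's) module_scheme \<Rightarrow> ('a, 'n, 't) module_scheme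
      \<Rightarrow> 'm \<Rightarrow> 'n \<Rightarrow> ('m, 'n) tensor" where
  "pure_tensor A M N x y =
     tensor_null A M N #>\<^bsub>free_Abelian_group (carrier M \<times> carrier N)\<^esub> frag_of (x, y)"

text \<open>For a biadditive balanced map \<open>\<phi>\<close> into the commutative group \<open>H\<close> this is the induced
  homomorphism \<open>x \<otimes> y \<mapsto> \<phi> x y\<close>: the extension of \<open>\<phi>\<close> to the free abelian group is constant on
  each coset.  For other \<open>\<phi>\<close> the value is meaningless.\<close>

definition tensor_lift :: "('h, 's) monoid_scheme \<Rightarrow> ('m \<Rightarrow> 'n \<Rightarrow> 'h) \<Rightarrow> ('m, 'n) tensor \<Rightarrow> 'h" where
  "tensor_lift H \<phi> W =
     the_elem ((\<lambda>z. finprod H (\<lambda>(x, y). \<phi> x y [^]\<^bsub>H\<^esub> Poly_Mapping.lookup z (x, y))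
                      (Poly_Mapping.keys z)) ` W)"

text \<open>Modules are records extending rings; the multiplicative fields of a mere module are
  irrelevant.\<close>

definition tensor_module ::
    "('a, 'r) ring_scheme \<Rightarrow> ('a, 'm, 's) module_scheme \<Rightarrow> ('a, 'n, 't) module_scheme
      \<Rightarrow> ('a, ('m, 'n) tensor) module" where
  "tensor_module A M N =
     \<lparr>carrier = carrier (tensor_group A M N), monoid.mult = undefined, one = undefined,
      ring.zero = \<one>\<^bsub>tensor_group A M N\<^esub>, ring.add = monoid.mult (tensor_group A M N),
      smult = (\<lambda>a. tensor_lift (tensor_group A M N) (\<lambda>x y. pure_tensor A M N (a \<odot>\<^bsub>M\<^esub> x) y))\<rparr>"

definition tensor_map ::
    "('a, 'r) ring_scheme \<Rightarrow> ('a, 'm, 's) module_scheme \<Rightarrow> ('a, 'n, 't) module_scheme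
      \<Rightarrow> ('k \<Rightarrow> 'm) \<Rightarrow> ('l \<Rightarrow> 'n) \<Rightarrow> ('k, 'l) tensor \<Rightarrow> ('m, 'n) tensor" where
  "tensor_map A M N f g = tensor_lift (tensor_group A M N) (\<lambda>x y. pure_tensor A M N (f x) (g y))"

definition tensor_algebra ::
    "('a, 'r) ring_scheme \<Rightarrow> ('a, 'u, 's) module_scheme \<Rightarrow> ('a, 'v, 't) module_scheme
      \<Rightarrow> ('a, ('u, 'v) tensor) module" where
  "tensor_algebra A U V = (tensor_module A U V)
     \<lparr>monoid.mult := (\<lambda>W Y. tensor_lift (tensor_group A U V)
        (\<lambda>u v. tensor_map A U V (\<lambda>u'. u \<otimes>\<^bsub>U\<^esub> u') (\<lambda>v'. v \<otimes>\<^bsub>V\<^esub> v') Y) W),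
      one := pure_tensor A U V \<one>\<^bsub>U\<^esub> \<one>\<^bsub>V\<^esub>\<rparr>"

text \<open>\<open>F \<otimes>\<^sub>A G\<close> as a module over \<open>U \<otimes>\<^sub>A V\<close>: \<open>(u \<otimes> v) (x \<otimes> y) = u x \<otimes> v y\<close>.\<close>

definition tensor_module_over ::
    "('a, 'r) ring_scheme \<Rightarrow> ('a, 'u, 's) module_scheme \<Rightarrow> ('a, 'v, 't) module_scheme
      \<Rightarrow> ('u, 'f, 'p) module_scheme \<Rightarrow> ('v, 'g, 'q) module_scheme
      \<Rightarrow> (('u, 'v) tensor, ('f, 'g) tensor) module" where
  "tensor_module_over A U V F G =
     (let F' = restrict_scalars U F; G' = restrict_scalars V G; T = tensor_module A F' G' in
      \<lparr>carrier = carrier T, monoid.mult = undefined, one = undefined,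
       ring.zero = \<zero>\<^bsub>T\<^esub>, ring.add = ring.add T,
       smult = (\<lambda>W Y. tensor_lift (tensor_group A F' G')
         (\<lambda>u v. tensor_map A F' G' (\<lambda>x. u \<odot>\<^bsub>F\<^esub> x) (\<lambda>y. v \<odot>\<^bsub>G\<^esub> y) Y) W)\<rparr>)"

text \<open>For \<open>M = \<Oplus> M\<^sub>p\<close> and \<open>N = \<Oplus> N\<^sub>q\<close> the module \<open>\<Oplus>\<^bsub>p+q=n\<^esub> M\<^sub>p \<otimes> N\<^sub>q\<close> is a direct summand of
  \<open>M \<otimes> N\<close>; as a subset, it is generated by the tensors \<open>x \<otimes> y\<close> with \<open>x \<in> M\<^sub>p\<close>, \<open>y \<in> N\<^sub>q\<close>.\<close>

definition tensor_grading ::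
    "('a, 'r) ring_scheme \<Rightarrow> ('a, 'm, 's) module_scheme \<Rightarrow> ('a, 'n, 't) module_scheme
      \<Rightarrow> (nat \<Rightarrow> 'm set) \<Rightarrow> (nat \<Rightarrow> 'n set) \<Rightarrow> nat \<Rightarrow> ('m, 'n) tensor set" where
  "tensor_grading A M N Mg Ng n =
     generate (tensor_group A M N)
       {pure_tensor A M N x y | x y p q. p + q = n \<and> x \<in> Mg p \<and> y \<in> Ng q}"


section \<open>The symmetric algebra\<close>

text \<open>Polynomials with coefficients in \<open>A\<close> and indeterminates indexed by \<open>I\<close>; the library
  provides the additive structure, and multiplication is convolution over multisets.\<close>

definition indexed_poly_ring :: "('a, 'r) ring_scheme \<Rightarrow> 'i set \<Rightarrow> ('i multiset \<Rightarrow> 'a) ring" where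
  "indexed_poly_ring A I =
     \<lparr>carrier = ring.indexed_pset A I (carrier A),
      monoid.mult = (\<lambda>P Q k. finsum A (\<lambda>i. P i \<otimes>\<^bsub>A\<^esub> Q (k - i)) {i. i \<subseteq># k}),
      one = ring.indexed_const A \<one>\<^bsub>A\<^esub>, ring.zero = ring.indexed_const A \<zero>\<^bsub>A\<^esub>,
      ring.add = ring.indexed_padd A\<rparr>"

text \<open>\<open>S(M)\<close> is the polynomial ring with one indeterminate \<open>X\<^sub>m\<close> for each \<open>m \<in> M\<close>, modulo the
  ideal making \<open>m \<mapsto> X\<^sub>m\<close> an \<open>A\<close>-linear map.\<close>

definition sym_ideal ::
    "('a, 'r) ring_scheme \<Rightarrow> ('a, 'm, 's) module_scheme \<Rightarrow> ('m multiset \<Rightarrow> 'a) set" where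
  "sym_ideal A M =
     (let P = indexed_poly_ring A (carrier M); V = ring.indexed_var A; C = ring.indexed_const A in
      Idl\<^bsub>P\<^esub>
       ({V (x \<oplus>\<^bsub>M\<^esub> y) \<ominus>\<^bsub>P\<^esub> (V x \<oplus>\<^bsub>P\<^esub> V y) | x y. x \<in> carrier M \<and> y \<in> carrier M} \<union>
        {V (a \<odot>\<^bsub>M\<^esub> x) \<ominus>\<^bsub>P\<^esub> (C a \<otimes>\<^bsub>P\<^esub> V x) | a x. a \<in> carrier A \<and> x \<in> carrier M}))"

definition sym_class ::
    "('a, 'r) ring_scheme \<Rightarrow> ('a, 'm, 's) module_scheme
      \<Rightarrow> ('m multiset \<Rightarrow> 'a) \<Rightarrow> ('m multiset \<Rightarrow> 'a) set" where
  "sym_class A M P = sym_ideal A M +>\<^bsub>indexed_poly_ring A (carrier M)\<^esub> P"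

definition sym_algebra ::
    "('a, 'r) ring_scheme \<Rightarrow> ('a, 'm, 's) module_scheme
      \<Rightarrow> ('a, ('m multiset \<Rightarrow> 'a) set) module" where
  "sym_algebra A M =
     (let Q = indexed_poly_ring A (carrier M) Quot sym_ideal A M in
      \<lparr>carrier = carrier Q, monoid.mult = monoid.mult Q, one = \<one>\<^bsub>Q\<^esub>,
       ring.zero = \<zero>\<^bsub>Q\<^esub>, ring.add = ring.add Q,
       smult = (\<lambda>a W. sym_class A M (ring.indexed_const A a) \<otimes>\<^bsub>Q\<^esub> W)\<rparr>)"

definition sym_grading ::
    "('a, 'r) ring_scheme \<Rightarrow> ('a, 'm, 's) module_scheme \<Rightarrow> nat \<Rightarrow> ('m multiset \<Rightarrow> 'a) set set" where
  "sym_grading A M n =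
     sym_class A M ` {P \<in> carrier (indexed_poly_ring A (carrier M)).
                        \<forall>k. P k \<noteq> \<zero>\<^bsub>A\<^esub> \<longrightarrow> size k = n}"

definition sym_var ::
    "('a, 'r) ring_scheme \<Rightarrow> ('a, 'm, 's) module_scheme \<Rightarrow> 'm \<Rightarrow> ('m multiset \<Rightarrow> 'a) set" where
  "sym_var A M x = sym_class A M (ring.indexed_var A x)"

text \<open>For \<open>M\<close> a submodule of the commutative \<open>A\<close>-algebra \<open>U\<close>, the \<open>A\<close>-algebra morphism
  \<open>S(M) \<rightarrow> U\<close> induced by the inclusion: evaluation at \<open>X\<^sub>m \<mapsto> m\<close> is constant on each class.\<close>

definition sym_eval ::
    "('a, 'r) ring_scheme \<Rightarrow> ('a, 'u, 's) module_scheme \<Rightarrow> ('u multiset \<Rightarrow> 'a) set \<Rightarrow> 'u" where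
  "sym_eval A U W =
     the_elem ((\<lambda>P. finsum U (\<lambda>k. P k \<odot>\<^bsub>U\<^esub> finprod U (\<lambda>x. x [^]\<^bsub>U\<^esub> count k x) (set_mset k))
                      {k. P k \<noteq> \<zero>\<^bsub>A\<^esub>}) ` W)"


section \<open>Effective relations and relation type\<close>

text \<open>The \<open>S\<close>-module \<open>S \<otimes>\<^sub>A M\<close> for an \<open>A\<close>-algebra \<open>S\<close>.\<close>

definition extend_scalars ::
    "('a, 'r) ring_scheme \<Rightarrow> ('a, 's, 'p) module_scheme \<Rightarrow> ('a, 'm, 'q) module_scheme
      \<Rightarrow> ('s, ('s, 'm) tensor) module" where
  "extend_scalars A S M =
     (let T = tensor_module A S M in
      \<lparr>carrier = carrier T, monoid.mult = undefined, one = undefined,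
       ring.zero = \<zero>\<^bsub>T\<^esub>, ring.add = ring.add T,
       smult = (\<lambda>s. tensor_map A S M (\<lambda>t. s \<otimes>\<^bsub>S\<^esub> t) (\<lambda>x. x))\<rparr>)"

definition quotient_module ::
    "('a, 'm, 's) module_scheme \<Rightarrow> 'm set \<Rightarrow> ('a, 'm set) module" where
  "quotient_module M N =
     \<lparr>carrier = a_rcosets\<^bsub>M\<^esub> N, monoid.mult = undefined, one = undefined, ring.zero = N,
      ring.add = set_add M, smult = (\<lambda>a W. \<Union>x\<in>W. N +>\<^bsub>M\<^esub> (a \<odot>\<^bsub>M\<^esub> x))\<rparr>"

text \<open>The infimum of the empty set is \<open>\<infinity>\<close>.\<close>

definition top_degree :: "(nat \<Rightarrow> ('a, 'm, 's) module_scheme) \<Rightarrow> enat" where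
  "top_degree E = Inf {enat r | r. r \<ge> 1 \<and> (\<forall>n \<ge> r + 1. carrier (E n) = {\<zero>\<^bsub>E n\<^esub>})}"

definition grade_module ::
    "('a, 'm) module \<Rightarrow> (nat \<Rightarrow> 'm set) \<Rightarrow> nat \<Rightarrow> ('a, 'm) module" where
  "grade_module M Mg n = M\<lparr>carrier := Mg n\<rparr>"

type_synonym ('a, 'u, 'f) presentation = "(('u multiset \<Rightarrow> 'a) set, 'f) tensor"

context
  fixes A :: "('a, 'r) ring_scheme"
    and U :: "('a, 'u) module" and Ug :: "nat \<Rightarrow> 'u set"
    and F :: "('u, 'f) module" and Fg :: "nat \<Rightarrow> 'f set"
begin

definition sym_degree_one :: "('a, ('u multiset \<Rightarrow> 'a) set) module" where
  "sym_degree_one = sym_algebra A (grade_module U Ug 1)"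

definition degree_zero :: "('a, 'f) module" where
  "degree_zero = grade_module (restrict_scalars U F) Fg 0"

text \<open>\<open>\<gamma>\<close> is the composition of \<open>\<alpha> \<otimes> 1 : S(U\<^sub>1) \<otimes> F\<^sub>0 \<rightarrow> U \<otimes> F\<^sub>0\<close> and \<open>U \<otimes> F\<^sub>0 \<rightarrow> F\<close>.\<close>

definition presentation_map :: "('a, 'u, 'f) presentation \<Rightarrow> 'f" where
  "presentation_map =
     tensor_lift (add_monoid F) (\<lambda>u x. u \<odot>\<^bsub>F\<^esub> x) \<circ>
     tensor_map A U degree_zero (sym_eval A U) (\<lambda>x. x)"

definition presentation_grading :: "nat \<Rightarrow> ('a, 'u, 'f) presentation set" where
  "presentation_grading =
     tensor_grading A sym_degree_one degree_zero
       (sym_grading A (grade_module U Ug 1)) (\<lambda>q. if q = 0 then Fg 0 else {\<zero>\<^bsub>F\<^esub>})"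

definition presentation_kernel :: "nat \<Rightarrow> ('a, 'u, 'f) presentation set" where
  "presentation_kernel n = {z \<in> presentation_grading n. presentation_map z = \<zero>\<^bsub>F\<^esub>}"

definition effective_relations :: "nat \<Rightarrow> ('a, ('a, 'u, 'f) presentation set) module" where
  "effective_relations n =
     (let T = tensor_module A sym_degree_one degree_zero in
      if n = 0 then quotient_module (T\<lparr>carrier := {\<zero>\<^bsub>T\<^esub>}\<rparr>) {\<zero>\<^bsub>T\<^esub>}
      else quotient_module (T\<lparr>carrier := presentation_kernel n\<rparr>)
        (smult_span (extend_scalars A sym_degree_one degree_zero)
          (sym_var A (grade_module U Ug 1) ` Ug 1) (presentation_kernel (n - 1))))"

definition relation_type :: enat where
  "relation_type = top_degree effective_relations"

end

end

theory Submission
  imports Defs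
begin

text \<open>Write \<open>S(U\<^sub>1) \<otimes> F\<^sub>0 \<rightarrow> F\<close> for the presentation of a standard module and \<open>K(F)\<close> for its kernel, so that
  \<open>E(F)\<^sub>n = 0\<close> says \<open>K(F)\<^sub>n = U\<^sub>1 K(F)\<^sub>n\<^sub>-\<^sub>1\<close>.  Since \<open>(U \<otimes> V)\<^sub>1 = U\<^sub>1 \<otimes> 1 + 1 \<otimes> V\<^sub>1\<close>, the presentation of
  \<open>F \<otimes> G\<close> is the product \<open>\<Phi>\<close> of those of \<open>F\<close> and \<open>G\<close>, and \<open>\<Phi>\<close> maps \<open>K(F)\<^sub>p \<times> (S(V\<^sub>1) \<otimes> G\<^sub>0)\<^sub>q\<close> with \<open>p + q = n\<close>
  into \<open>(U \<otimes> V)\<^sub>1 K(F \<otimes> G)\<^sub>n\<^sub>-\<^sub>1\<close>: for \<open>q > 0\<close> split a variable off the second factor, and for \<open>q = 0\<close> use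
  \<open>E(F)\<^sub>n = 0\<close>; symmetrically for \<open>G\<close>.  Hence \<open>\<Phi>\<close> induces a map from \<open>(F \<otimes> G)\<^sub>n\<close> to the presentation of
  \<open>F \<otimes> G\<close> modulo \<open>(U \<otimes> V)\<^sub>1 K(F \<otimes> G)\<^sub>n\<^sub>-\<^sub>1\<close> that inverts the presentation map, and \<open>E(F \<otimes> G)\<^sub>n = 0\<close> whenever
  \<open>E(F)\<^sub>n = E(G)\<^sub>n = 0\<close>.\<close>

section \<open>Additive, linear and bilinear maps\<close>

text \<open>The kernel of a tensor product of surjections is approached backwards: instead of
  describing it, one builds a map out of F \<otimes> G and reads the kernel off from it. Such a map
  exists because two homogeneous lifts of the same element differ by a relation of one factor, and
  \<open>\<Phi>\<close> turns that relation into a decomposable one; so the class of a product of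
  lifts depends only on the elements lifted. The universal property of the tensor product asks for a
  map on all of F x G, whereas lifts exist degree by degree. Hence the map is assembled from
  homogeneous components, and directness of the gradings of F and G enters there. The presentations
  themselves are handled as families of submodules. What is asked of \<open>\<Phi>\<close> is that
  its values span each degree of the presentation of F \<otimes> G. Everything happens in a single
  degree n + 1, with hypotheses on F and G in that degree alone; this is why the relation types
  combine to their maximum.\<close>

definition additive_map :: "('m, 'p) ring_scheme \<Rightarrow> ('n, 'q) ring_scheme \<Rightarrow> ('m \<Rightarrow> 'n) \<Rightarrow> bool" where
  "additive_map M N h \<longleftrightarrow> h \<in> carrier M \<rightarrow> carrier N \<and>
     (\<forall>x \<in> carrier M. \<forall>y \<in> carrier M. h (x \<oplus>\<^bsub>M\<^esub> y) = h x \<oplus>\<^bsub>N\<^esub> h y)"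

definition linear_map ::
    "('a, 'r) ring_scheme \<Rightarrow> ('a, 'm, 'p) module_scheme \<Rightarrow> ('a, 'n, 'q) module_scheme \<Rightarrow> ('m \<Rightarrow> 'n) \<Rightarrow> bool" where
  "linear_map A M N h \<longleftrightarrow> additive_map M N h \<and>
     (\<forall>a \<in> carrier A. \<forall>x \<in> carrier M. h (a \<odot>\<^bsub>M\<^esub> x) = a \<odot>\<^bsub>N\<^esub> h x)"

definition bilinear_map ::
    "('a, 'r) ring_scheme \<Rightarrow> ('a, 'm, 'p) module_scheme \<Rightarrow> ('a, 'n, 'q) module_scheme
      \<Rightarrow> ('a, 'k, 's) module_scheme \<Rightarrow> ('m \<Rightarrow> 'n \<Rightarrow> 'k) \<Rightarrow> bool" where
  "bilinear_map A M N P f \<longleftrightarrow> (\<forall>x \<in> carrier M. linear_map A N P (f x)) \<and>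
     (\<forall>y \<in> carrier N. linear_map A M P (\<lambda>x. f x y))"

text \<open>The target is written multiplicatively, as in \<open>tensor_lift\<close>.\<close>

definition balanced ::
    "('a, 'r) ring_scheme \<Rightarrow> ('a, 'm, 'p) module_scheme \<Rightarrow> ('a, 'n, 'q) module_scheme
      \<Rightarrow> ('h, 's) monoid_scheme \<Rightarrow> ('m \<Rightarrow> 'n \<Rightarrow> 'h) \<Rightarrow> bool" where
  "balanced A M N H \<phi> \<longleftrightarrow>
     (\<forall>x \<in> carrier M. \<forall>y \<in> carrier N. \<phi> x y \<in> carrier H) \<and>
     (\<forall>x \<in> carrier M. \<forall>x' \<in> carrier M. \<forall>y \<in> carrier N. \<phi> (x \<oplus>\<^bsub>M\<^esub> x') y = \<phi> x y \<otimes>\<^bsub>H\<^esub> \<phi> x' y) \<and>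
     (\<forall>x \<in> carrier M. \<forall>y \<in> carrier N. \<forall>y' \<in> carrier N. \<phi> x (y \<oplus>\<^bsub>N\<^esub> y') = \<phi> x y \<otimes>\<^bsub>H\<^esub> \<phi> x y') \<and>
     (\<forall>a \<in> carrier A. \<forall>x \<in> carrier M. \<forall>y \<in> carrier N. \<phi> (a \<odot>\<^bsub>M\<^esub> x) y = \<phi> x (a \<odot>\<^bsub>N\<^esub> y))"

lemma additive_map_closed: "additive_map M N h \<Longrightarrow> x \<in> carrier M \<Longrightarrow> h x \<in> carrier N"
  by (auto simp: additive_map_def)

lemma additive_map_add:
  "additive_map M N h \<Longrightarrow> x \<in> carrier M \<Longrightarrow> y \<in> carrier M \<Longrightarrow> h (x \<oplus>\<^bsub>M\<^esub> y) = h x \<oplus>\<^bsub>N\<^esub> h y"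
  by (auto simp: additive_map_def)

lemma additive_mapI:
  assumes "\<And>x. x \<in> carrier M \<Longrightarrow> h x \<in> carrier N"
    and "\<And>x y. x \<in> carrier M \<Longrightarrow> y \<in> carrier M \<Longrightarrow> h (x \<oplus>\<^bsub>M\<^esub> y) = h x \<oplus>\<^bsub>N\<^esub> h y"
  shows "additive_map M N h"
  using assms by (auto simp: additive_map_def)

lemma additive_zero:
  assumes "abelian_group M" "abelian_group N" "additive_map M N h"
  shows "h \<zero>\<^bsub>M\<^esub> = \<zero>\<^bsub>N\<^esub>"
proof -
  interpret M: abelian_group M by fact
  interpret N: abelian_group N by fact
  have c: "h \<zero>\<^bsub>M\<^esub> \<in> carrier N" using assms(3) by (auto intro: additive_map_closed)
  have "h \<zero>\<^bsub>M\<^esub> = h (\<zero>\<^bsub>M\<^esub> \<oplus>\<^bsub>M\<^esub> \<zero>\<^bsub>M\<^esub>)" by simp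
  also have "\<dots> = h \<zero>\<^bsub>M\<^esub> \<oplus>\<^bsub>N\<^esub> h \<zero>\<^bsub>M\<^esub>" using assms(3) by (rule additive_map_add) auto
  finally show ?thesis using c by (metis N.add.r_cancel_one')
qed

lemma additive_minus:
  assumes "abelian_group M" "abelian_group N" "additive_map M N h" "x \<in> carrier M"
  shows "h (\<ominus>\<^bsub>M\<^esub> x) = \<ominus>\<^bsub>N\<^esub> h x"
proof -
  interpret M: abelian_group M by fact
  interpret N: abelian_group N by fact
  have "h (\<ominus>\<^bsub>M\<^esub> x) \<oplus>\<^bsub>N\<^esub> h x = h (\<ominus>\<^bsub>M\<^esub> x \<oplus>\<^bsub>M\<^esub> x)"
    using assms additive_map_add by (metis M.a_inv_closed)
  also have "\<dots> = \<zero>\<^bsub>N\<^esub>" using assms by (simp add: M.l_neg additive_zero)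
  finally show ?thesis
    using assms additive_map_closed by (metis M.a_inv_closed N.minus_equality)
qed

lemma additive_finsum:
  assumes "abelian_group M" "abelian_group N" "additive_map M N h" "finite I" "f \<in> I \<rightarrow> carrier M"
  shows "h (finsum M f I) = finsum N (\<lambda>i. h (f i)) I"
  using assms(4,5)
proof (induction I rule: finite_induct)
  interpret M: abelian_group M by fact
  interpret N: abelian_group N by fact
  case empty
  then show ?case using assms by (simp add: additive_zero)
next
  interpret M: abelian_group M by fact
  interpret N: abelian_group N by fact
  case (insert i I)
  have "h (finsum M f (insert i I)) = h (f i) \<oplus>\<^bsub>N\<^esub> h (finsum M f I)"
    using insert assms(3) by (simp add: additive_map_add Pi_def)
  also have "h (finsum M f I) = finsum N (\<lambda>i. h (f i)) I" using insert by simp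
  finally show ?case using insert assms(3)
    by (subst N.finsum_insert) (auto intro!: additive_map_closed[OF assms(3)] simp: Pi_iff)
qed

lemma additive_finsum_maps:
  assumes "abelian_group N" "finite I" "\<And>i. i \<in> I \<Longrightarrow> additive_map M N (f i)"
  shows "additive_map M N (\<lambda>x. finsum N (\<lambda>i. f i x) I)"
proof -
  interpret N: abelian_group N by fact
  have c: "(\<lambda>i. f i x) \<in> I \<rightarrow> carrier N" if "x \<in> carrier M" for x
    using that assms(3) by (auto simp: additive_map_def)
  show ?thesis
  proof (rule additive_mapI)
    fix x assume "x \<in> carrier M" then show "finsum N (\<lambda>i. f i x) I \<in> carrier N"
      using c by simp
  next
    fix x y assume x: "x \<in> carrier M" and y: "y \<in> carrier M"
    have "finsum N (\<lambda>i. f i (x \<oplus>\<^bsub>M\<^esub> y)) I = finsum N (\<lambda>i. f i x \<oplus>\<^bsub>N\<^esub> f i y) I"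
      using assms(3) x y c[OF x] c[OF y]
      by (intro N.finsum_cong') (auto simp: additive_map_add Pi_iff)
    also have "\<dots> = finsum N (\<lambda>i. f i x) I \<oplus>\<^bsub>N\<^esub> finsum N (\<lambda>i. f i y) I"
      using c[OF x] c[OF y] by (rule N.finsum_addf)
    finally show "finsum N (\<lambda>i. f i (x \<oplus>\<^bsub>M\<^esub> y)) I =
      finsum N (\<lambda>i. f i x) I \<oplus>\<^bsub>N\<^esub> finsum N (\<lambda>i. f i y) I" .
  qed
qed

lemma linear_map_additive: "linear_map A M N h \<Longrightarrow> additive_map M N h"
  by (simp add: linear_map_def)

lemma linear_map_smult:
  "linear_map A M N h \<Longrightarrow> a \<in> carrier A \<Longrightarrow> x \<in> carrier M \<Longrightarrow> h (a \<odot>\<^bsub>M\<^esub> x) = a \<odot>\<^bsub>N\<^esub> h x"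
  by (simp add: linear_map_def)

lemmas linear_map_closed = additive_map_closed[OF linear_map_additive]
lemmas linear_map_add = additive_map_add[OF linear_map_additive]

lemma linear_mapI:
  assumes "additive_map M N h"
    and "\<And>a x. a \<in> carrier A \<Longrightarrow> x \<in> carrier M \<Longrightarrow> h (a \<odot>\<^bsub>M\<^esub> x) = a \<odot>\<^bsub>N\<^esub> h x"
  shows "linear_map A M N h"
  using assms by (auto simp: linear_map_def)

lemma linear_map_comp: "linear_map A M N g \<Longrightarrow> linear_map A N P f \<Longrightarrow> linear_map A M P (\<lambda>x. f (g x))"
  by (auto simp: linear_map_def additive_map_def Pi_iff)

lemma linear_map_id: "linear_map A M M (\<lambda>x. x)"
  by (auto simp: linear_map_def additive_map_def)

lemma bilinear_map_left: "bilinear_map A M N P f \<Longrightarrow> y \<in> carrier N \<Longrightarrow> linear_map A M P (\<lambda>x. f x y)"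
  by (simp add: bilinear_map_def)

lemma bilinear_map_right: "bilinear_map A M N P f \<Longrightarrow> x \<in> carrier M \<Longrightarrow> linear_map A N P (f x)"
  by (simp add: bilinear_map_def)

lemmas bilinear_map_closed = linear_map_closed[OF bilinear_map_right]
lemmas bilinear_map_add_left = linear_map_add[OF bilinear_map_left]
lemmas bilinear_map_add_right = linear_map_add[OF bilinear_map_right]
lemmas bilinear_map_smult_left = linear_map_smult[OF bilinear_map_left]
lemmas bilinear_map_smult_right = linear_map_smult[OF bilinear_map_right]

lemma bilinear_mapI:
  assumes "\<And>x y. x \<in> carrier M \<Longrightarrow> y \<in> carrier N \<Longrightarrow> f x y \<in> carrier P"
    and "\<And>x x' y. x \<in> carrier M \<Longrightarrow> x' \<in> carrier M \<Longrightarrow> y \<in> carrier N \<Longrightarrow>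
           f (x \<oplus>\<^bsub>M\<^esub> x') y = f x y \<oplus>\<^bsub>P\<^esub> f x' y"
    and "\<And>x y y'. x \<in> carrier M \<Longrightarrow> y \<in> carrier N \<Longrightarrow> y' \<in> carrier N \<Longrightarrow>
           f x (y \<oplus>\<^bsub>N\<^esub> y') = f x y \<oplus>\<^bsub>P\<^esub> f x y'"
    and "\<And>a x y. a \<in> carrier A \<Longrightarrow> x \<in> carrier M \<Longrightarrow> y \<in> carrier N \<Longrightarrow> f (a \<odot>\<^bsub>M\<^esub> x) y = a \<odot>\<^bsub>P\<^esub> f x y"
    and "\<And>a x y. a \<in> carrier A \<Longrightarrow> x \<in> carrier M \<Longrightarrow> y \<in> carrier N \<Longrightarrow> f x (a \<odot>\<^bsub>N\<^esub> y) = a \<odot>\<^bsub>P\<^esub> f x y"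
  shows "bilinear_map A M N P f"
  using assms by (simp add: bilinear_map_def linear_map_def additive_map_def)

lemma bilinear_map_comp:
  assumes "bilinear_map A M N P f" "linear_map A M' M g" "linear_map A N' N h"
  shows "bilinear_map A M' N' P (\<lambda>x y. f (g x) (h y))"
  using assms by (auto simp: bilinear_map_def linear_map_def additive_map_def Pi_iff)

lemma bilinear_map_balanced:
  assumes "bilinear_map A M N P f"
  shows "balanced A M N (add_monoid P) f"
  using assms by (auto simp: bilinear_map_def linear_map_def additive_map_def balanced_def Pi_iff)


section \<open>Generated subgroups\<close>

text \<open>\<open>generate\<close> sees a group only through its carrier, product and unit, since
  \<open>m_inv\<close> is defined from these. The case in view is \<open>tensor_group\<close>
  against the additive monoid of \<open>tensor_module\<close>: two records for the same
  group.\<close>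

lemma generate_cong_structure:
  assumes "carrier G = carrier H" "monoid.mult G = monoid.mult H" "one G = one H"
  shows "generate G S = generate H S"
proof -
  have i: "inv\<^bsub>G\<^esub> x = inv\<^bsub>H\<^esub> x" for x using assms by (simp add: m_inv_def)
  show ?thesis
  proof (intro equalityI subsetI)
    fix x assume "x \<in> generate G S" then show "x \<in> generate H S"
      by induction (auto simp: assms i intro: generate.intros)
  next
    fix x assume "x \<in> generate H S" then show "x \<in> generate G S"
      by induction (auto simp: assms(2,3)[symmetric] i[symmetric] intro: generate.intros)
  qed
qed

lemma (in abelian_group) span_subgroup:
  assumes "S \<subseteq> carrier G"
  shows "subgroup (generate (add_monoid G) S) (add_monoid G)"
  using assms by (intro add.generate_is_subgroup) auto

text \<open>Closure of S under negation replaces the inverse case of \<open>generate\<close>. The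
  generating sets to which this is applied consist of products, where the sign moves into one
  factor, or are unions of subgroups.\<close>

lemma (in abelian_group) span_induct [consumes 2, case_names neg zero incl add]:
  assumes z: "z \<in> generate (add_monoid G) S" and S: "S \<subseteq> carrier G"
    and neg: "\<And>s. s \<in> S \<Longrightarrow> \<ominus> s \<in> S"
    and zero: "Q \<zero>" and incl: "\<And>s. s \<in> S \<Longrightarrow> Q s"
    and add: "\<And>x y. x \<in> carrier G \<Longrightarrow> y \<in> carrier G \<Longrightarrow> Q x \<Longrightarrow> Q y \<Longrightarrow> Q (x \<oplus> y)"
  shows "Q z"
proof -
  have "z \<in> carrier G \<and> Q z" using z
  proof induction
    case (inv h)
    then show ?case using neg[of h] S incl by (auto simp: a_inv_def)
  qed (use S zero incl add in auto)
  then show ?thesis ..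
qed

lemma (in abelian_group) span_subset:
  assumes "S \<subseteq> H" "subgroup H (add_monoid G)"
  shows "generate (add_monoid G) S \<subseteq> H"
  using assms by (rule add.generate_subgroup_incl)

lemma (in abelian_group) span_incl: "s \<in> S \<Longrightarrow> s \<in> generate (add_monoid G) S"
  by (rule generate.incl)

lemma (in abelian_group) subgroup_add:
  "subgroup H (add_monoid G) \<Longrightarrow> x \<in> H \<Longrightarrow> y \<in> H \<Longrightarrow> x \<oplus> y \<in> H"
  using subgroup.m_closed by force

lemma (in abelian_group) subgroup_zero: "subgroup H (add_monoid G) \<Longrightarrow> \<zero> \<in> H"
  using subgroup.one_closed by force

lemma (in abelian_group) subgroup_neg: "subgroup H (add_monoid G) \<Longrightarrow> x \<in> H \<Longrightarrow> \<ominus> x \<in> H"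
  using subgroup.m_inv_closed by (force simp: a_inv_def)

section \<open>The universal property of the tensor product\<close>

locale module_pair = M: module A M + N: module A N
  for A :: "('a, 'r) ring_scheme" (structure) and M :: "('a, 'm, 's) module_scheme"
    and N :: "('a, 'n, 't) module_scheme"
begin

abbreviation "T \<equiv> tensor_module A M N"
abbreviation "pt \<equiv> pure_tensor A M N"
abbreviation "FA \<equiv> free_Abelian_group (carrier M \<times> carrier N)"
abbreviation "K \<equiv> tensor_null A M N"

lemma tensor_relations_subset: "tensor_relations A M N \<subseteq> carrier FA"
  unfolding tensor_relations_def by (auto dest!: subsetD[OF keys_diff])

lemma tensor_null_normal: "K \<lhd> FA"
  unfolding tensor_null_def
  by (intro comm_group.subgroup_imp_normal[OF abelian_free_Abelian_group]
      group.generate_is_subgroup[OF group_free_Abelian_group] tensor_relations_subset)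

lemma tensor_comm_group: "comm_group (tensor_group A M N)"
  unfolding tensor_group_def
  by (intro comm_group.abelian_FactGroup abelian_free_Abelian_group normal_imp_subgroup tensor_null_normal)

lemma tensor_carrier: "carrier T = carrier (tensor_group A M N)"
  and tensor_add: "ring.add T = monoid.mult (tensor_group A M N)"
  and tensor_zero: "ring.zero T = one (tensor_group A M N)"
  by (simp_all add: tensor_module_def)

lemma tensor_abelian_group: "abelian_group T"
proof -
  interpret comm_group "tensor_group A M N" by (rule tensor_comm_group)
  show ?thesis
    by (rule abelian_groupI) (auto simp: tensor_carrier tensor_add tensor_zero m_ac intro: l_inv_ex)
qed

sublocale T: abelian_group T by (rule tensor_abelian_group)

lemma coset_closed: "z \<in> carrier FA \<Longrightarrow> K #>\<^bsub>FA\<^esub> z \<in> carrier T"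
  by (simp add: tensor_carrier tensor_group_def carrier_FactGroup)

lemma coset_add:
  "z \<in> carrier FA \<Longrightarrow> z' \<in> carrier FA \<Longrightarrow> (K #>\<^bsub>FA\<^esub> z) \<oplus>\<^bsub>T\<^esub> (K #>\<^bsub>FA\<^esub> z') = K #>\<^bsub>FA\<^esub> (z + z')"
  using normal.rcos_sum[OF tensor_null_normal] by (simp add: tensor_add tensor_group_def)

lemma coset_eq:
  assumes "z \<in> carrier FA" "z' \<in> carrier FA" "z - z' \<in> K"
  shows "K #>\<^bsub>FA\<^esub> z = K #>\<^bsub>FA\<^esub> z'"
proof -
  have "z = (z - z') + z'" by simp
  then have "z \<in> K #>\<^bsub>FA\<^esub> z'" using assms(3) by (force simp: r_coset_def)
  then show ?thesis
    using group.repr_independence[OF group_free_Abelian_group _ _ normal_imp_subgroup[OF tensor_null_normal]]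
      assms by metis
qed

lemma coset_relation:
  assumes "z \<in> carrier FA" "z' \<in> carrier FA" "z - z' \<in> tensor_relations A M N"
  shows "K #>\<^bsub>FA\<^esub> z = K #>\<^bsub>FA\<^esub> z'"
  by (rule coset_eq[OF assms(1,2)]) (use assms(3) in \<open>simp add: tensor_null_def generate.incl\<close>)

lemma pure_closed [simp, intro]: "x \<in> carrier M \<Longrightarrow> y \<in> carrier N \<Longrightarrow> pt x y \<in> carrier T"
  unfolding pure_tensor_def by (rule coset_closed) simp

lemma pure_add_left:
  assumes "x \<in> carrier M" "x' \<in> carrier M" "y \<in> carrier N"
  shows "pt (x \<oplus>\<^bsub>M\<^esub> x') y = pt x y \<oplus>\<^bsub>T\<^esub> pt x' y"
  unfolding pure_tensor_def
proof (subst coset_add)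
  show "K #>\<^bsub>FA\<^esub> frag_of (x \<oplus>\<^bsub>M\<^esub> x', y) = K #>\<^bsub>FA\<^esub> (frag_of (x, y) + frag_of (x', y))"
    by (rule coset_relation)
      (use assms in \<open>auto simp: tensor_relations_def diff_diff_eq dest!: subsetD[OF keys_add]\<close>)
qed (use assms in auto)

lemma pure_add_right:
  assumes "x \<in> carrier M" "y \<in> carrier N" "y' \<in> carrier N"
  shows "pt x (y \<oplus>\<^bsub>N\<^esub> y') = pt x y \<oplus>\<^bsub>T\<^esub> pt x y'"
  unfolding pure_tensor_def
proof (subst coset_add)
  show "K #>\<^bsub>FA\<^esub> frag_of (x, y \<oplus>\<^bsub>N\<^esub> y') = K #>\<^bsub>FA\<^esub> (frag_of (x, y) + frag_of (x, y'))"
    by (rule coset_relation)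
      (use assms in \<open>auto simp: tensor_relations_def diff_diff_eq dest!: subsetD[OF keys_add]\<close>)
qed (use assms in auto)

lemma pure_smult:
  assumes "a \<in> carrier A" "x \<in> carrier M" "y \<in> carrier N"
  shows "pt (a \<odot>\<^bsub>M\<^esub> x) y = pt x (a \<odot>\<^bsub>N\<^esub> y)"
  unfolding pure_tensor_def
  by (rule coset_relation) (use assms in \<open>auto simp: tensor_relations_def\<close>)

lemma additive_pure_left: "y \<in> carrier N \<Longrightarrow> additive_map M T (\<lambda>x. pt x y)"
  by (simp add: additive_mapI pure_add_left)

lemma additive_pure_right: "x \<in> carrier M \<Longrightarrow> additive_map N T (pt x)"
  by (simp add: additive_mapI pure_add_right)

lemma pure_zero_left [simp]: "y \<in> carrier N \<Longrightarrow> pt \<zero>\<^bsub>M\<^esub> y = \<zero>\<^bsub>T\<^esub>"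
  using additive_zero[OF M.abelian_group_axioms T.abelian_group_axioms additive_pure_left] .

lemma pure_zero_right [simp]: "x \<in> carrier M \<Longrightarrow> pt x \<zero>\<^bsub>N\<^esub> = \<zero>\<^bsub>T\<^esub>"
  using additive_zero[OF N.abelian_group_axioms T.abelian_group_axioms additive_pure_right] .

lemma pure_minus: "x \<in> carrier M \<Longrightarrow> y \<in> carrier N \<Longrightarrow> pt (\<ominus>\<^bsub>M\<^esub> x) y = \<ominus>\<^bsub>T\<^esub> pt x y"
  using additive_minus[OF M.abelian_group_axioms T.abelian_group_axioms additive_pure_left] .

text \<open>Zero is 0 \<otimes> 0 and -(x \<otimes> y) is (-x) \<otimes> y, so pure tensors span
  already under addition alone.\<close>

lemma tensor_induct [consumes 1, case_names pure add]:
  assumes z: "z \<in> carrier T"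
    and pure: "\<And>x y. x \<in> carrier M \<Longrightarrow> y \<in> carrier N \<Longrightarrow> Q (pt x y)"
    and add: "\<And>z z'. z \<in> carrier T \<Longrightarrow> z' \<in> carrier T \<Longrightarrow> Q z \<Longrightarrow> Q z' \<Longrightarrow> Q (z \<oplus>\<^bsub>T\<^esub> z')"
  shows "Q z"
proof -
  obtain w where w: "w \<in> carrier FA" "z = K #>\<^bsub>FA\<^esub> w"
    using z by (auto simp: tensor_carrier tensor_group_def carrier_FactGroup)
  \<comment> \<open>\<open>free_Abelian_group_induct\<close> closes under differences, whereas
    \<open>Q\<close> is closed under sums only; the sign is therefore carried in the
    predicate.\<close>
  let ?P = "\<lambda>w. Q (K #>\<^bsub>FA\<^esub> w) \<and> Q (K #>\<^bsub>FA\<^esub> (- w))"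
  have zero: "K #>\<^bsub>FA\<^esub> 0 = \<zero>\<^bsub>T\<^esub>"
    using group.coset_mult_one[OF group_free_Abelian_group subgroup.subset[OF normal_imp_subgroup[OF tensor_null_normal]]]
    by (simp add: tensor_zero tensor_group_def)
  have "?P w" using w(1)[simplified]
  proof (rule free_Abelian_group_induct)
    show "?P 0" using pure[of "\<zero>\<^bsub>M\<^esub>" "\<zero>\<^bsub>N\<^esub>"] zero by simp
  next
    fix x y assume *: "Poly_Mapping.keys x \<subseteq> carrier M \<times> carrier N"
      "Poly_Mapping.keys y \<subseteq> carrier M \<times> carrier N" "?P x" "?P y"
    have "Q ((K #>\<^bsub>FA\<^esub> x) \<oplus>\<^bsub>T\<^esub> (K #>\<^bsub>FA\<^esub> (- y)))" "Q ((K #>\<^bsub>FA\<^esub> (- x)) \<oplus>\<^bsub>T\<^esub> (K #>\<^bsub>FA\<^esub> y))"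
      using * by (auto intro!: add coset_closed)
    then show "?P (x - y)" using * by (simp add: coset_add)
  next
    fix a assume "a \<in> carrier M \<times> carrier N"
    then obtain x y where xy: "a = (x, y)" "x \<in> carrier M" "y \<in> carrier N" by auto
    have "pt (\<ominus>\<^bsub>M\<^esub> x) y = K #>\<^bsub>FA\<^esub> (- frag_of (x, y))"
    proof -
      have "(K #>\<^bsub>FA\<^esub> (- frag_of (x, y))) \<oplus>\<^bsub>T\<^esub> pt x y = \<zero>\<^bsub>T\<^esub>"
        unfolding pure_tensor_def using xy by (simp add: coset_add zero)
      then have "\<ominus>\<^bsub>T\<^esub> pt x y = K #>\<^bsub>FA\<^esub> (- frag_of (x, y))"
        using xy coset_closed[of "- frag_of (x, y)"] by (intro T.minus_equality) auto
      then show ?thesis using xy pure_minus by simp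
    qed
    then show "?P (frag_of a)" using xy pure[of x y] pure[of "\<ominus>\<^bsub>M\<^esub> x" y]
      by (simp add: pure_tensor_def)
  qed
  then show ?thesis using w(2) by simp
qed

text \<open>The last three clauses of \<open>balanced\<close> say that the extension
  \<open>e\<close> of \<phi> to the free abelian group kills the three families in
  \<open>tensor_relations\<close>. So \<open>e\<close> is constant on each coset of
  \<open>K\<close>, the image of a coset is a singleton, and \<open>the_elem\<close> in
  \<open>tensor_lift\<close> picks its element.\<close>

lemma
  assumes H: "comm_group H" and b: "balanced A M N H \<phi>"
  shows tensor_lift_closed: "z \<in> carrier T \<Longrightarrow> tensor_lift H \<phi> z \<in> carrier H"
    and tensor_lift_add: "z \<in> carrier T \<Longrightarrow> z' \<in> carrier T \<Longrightarrow>
      tensor_lift H \<phi> (z \<oplus>\<^bsub>T\<^esub> z') = tensor_lift H \<phi> z \<otimes>\<^bsub>H\<^esub> tensor_lift H \<phi> z'"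
    and tensor_lift_pure: "x \<in> carrier M \<Longrightarrow> y \<in> carrier N \<Longrightarrow> tensor_lift H \<phi> (pt x y) = \<phi> x y"
proof -
  interpret H: comm_group H by fact
  define e where "e = (\<lambda>z :: 'm \<times> 'n \<Rightarrow>\<^sub>0 int. finprod H (\<lambda>(x, y). \<phi> x y [^]\<^bsub>H\<^esub> Poly_Mapping.lookup z (x, y))
                      (Poly_Mapping.keys z))"
  have cl: "\<phi> x y \<in> carrier H" if "x \<in> carrier M" "y \<in> carrier N" for x y
    using that b by (simp add: balanced_def)
  have pw: "\<phi> x y [^]\<^bsub>H\<^esub> (k::int) \<in> carrier H" if "(x, y) \<in> Y" "Y \<subseteq> carrier M \<times> carrier N" for x y k Y
    using cl that by (auto intro!: H.int_pow_closed)
  \<comment> \<open>The product over \<open>keys\<close> may be taken over any larger finite set;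
    additivity of \<open>e\<close> compares three products over the union of two supports.\<close>
  have e_eq: "e z = finprod H (\<lambda>(x, y). \<phi> x y [^]\<^bsub>H\<^esub> Poly_Mapping.lookup z (x, y)) Y"
    if "finite Y" "Poly_Mapping.keys z \<subseteq> Y" "Y \<subseteq> carrier M \<times> carrier N" for z Y
    unfolding e_def using that
    by (intro H.finprod_mono_neutral_cong_left)
      (auto simp: in_keys_iff int_pow_0 pw)
  have e_hom: "e \<in> hom FA H"
  proof (rule homI)
    fix z assume "z \<in> carrier FA"
    then show "e z \<in> carrier H"
      by (auto simp: e_def pw intro!: H.finprod_closed)
  next
    fix z z' assume z: "z \<in> carrier FA" "z' \<in> carrier FA"
    let ?Y = "Poly_Mapping.keys z \<union> Poly_Mapping.keys z'"
    have Y: "finite ?Y" "?Y \<subseteq> carrier M \<times> carrier N" using z by auto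
    have "e (z + z') = finprod H (\<lambda>(x, y). \<phi> x y [^]\<^bsub>H\<^esub> Poly_Mapping.lookup (z + z') (x, y)) ?Y"
      by (rule e_eq[OF Y(1) keys_add Y(2)])
    also have "\<dots> = finprod H (\<lambda>p. (\<lambda>(x, y). \<phi> x y [^]\<^bsub>H\<^esub> Poly_Mapping.lookup z (x, y)) p \<otimes>\<^bsub>H\<^esub>
        (\<lambda>(x, y). \<phi> x y [^]\<^bsub>H\<^esub> Poly_Mapping.lookup z' (x, y)) p) ?Y"
      using Y cl by (intro H.finprod_cong')
        (auto simp: lookup_add pw intro!: H.int_pow_mult)
    also have "\<dots> = e z \<otimes>\<^bsub>H\<^esub> e z'"
      using Y by (subst H.finprod_multf) (auto simp: e_eq[OF Y(1) _ Y(2)] pw)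
    finally show "e (z \<otimes>\<^bsub>FA\<^esub> z') = e z \<otimes>\<^bsub>H\<^esub> e z'" by simp
  qed
  interpret e: group_hom FA H e
    using e_hom by (auto simp: group_hom_def group_hom_axioms_def H.is_group)
  have e_of: "e (frag_of (x, y)) = \<phi> x y" if "x \<in> carrier M" "y \<in> carrier N" for x y
    using cl[OF that] by (simp add: e_def)
  have e_diff: "e (u - v) = e u \<otimes>\<^bsub>H\<^esub> inv\<^bsub>H\<^esub> e v" if "u \<in> carrier FA" "v \<in> carrier FA" for u v
    using e.hom_mult[of u "- v"] e.hom_inv[of v] that by simp
  have e_rel: "e r = \<one>\<^bsub>H\<^esub>" if "r \<in> tensor_relations A M N" for r
  proof -
    have kd: "Poly_Mapping.keys (u - v) \<subseteq> carrier M \<times> carrier N"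
      if "Poly_Mapping.keys u \<subseteq> carrier M \<times> carrier N" "Poly_Mapping.keys v \<subseteq> carrier M \<times> carrier N"
      for u v :: "('m \<times> 'n) \<Rightarrow>\<^sub>0 int"
      using that keys_diff[of u v] by blast
    have cancel: "(p \<otimes>\<^bsub>H\<^esub> q) \<otimes>\<^bsub>H\<^esub> inv\<^bsub>H\<^esub> p \<otimes>\<^bsub>H\<^esub> inv\<^bsub>H\<^esub> q = \<one>\<^bsub>H\<^esub>" if "p \<in> carrier H" "q \<in> carrier H" for p q
      using that H.m_comm[of p q] by (simp add: H.m_assoc)
    from that show ?thesis
      unfolding tensor_relations_def
    proof (elim UnE CollectE exE conjE)
      fix x x' y assume l: "r = frag_of (x \<oplus>\<^bsub>M\<^esub> x', y) - frag_of (x, y) - frag_of (x', y)"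
        "x \<in> carrier M" "x' \<in> carrier M" "y \<in> carrier N"
      then have "e r = (\<phi> x y \<otimes>\<^bsub>H\<^esub> \<phi> x' y) \<otimes>\<^bsub>H\<^esub> inv\<^bsub>H\<^esub> \<phi> x y \<otimes>\<^bsub>H\<^esub> inv\<^bsub>H\<^esub> \<phi> x' y"
        using b by (simp add: e_diff e_of kd balanced_def)
      then show ?thesis using l cl cancel by simp
    next
      fix x y y' assume r: "r = frag_of (x, y \<oplus>\<^bsub>N\<^esub> y') - frag_of (x, y) - frag_of (x, y')"
        "x \<in> carrier M" "y \<in> carrier N" "y' \<in> carrier N"
      then have "e r = (\<phi> x y \<otimes>\<^bsub>H\<^esub> \<phi> x y') \<otimes>\<^bsub>H\<^esub> inv\<^bsub>H\<^esub> \<phi> x y \<otimes>\<^bsub>H\<^esub> inv\<^bsub>H\<^esub> \<phi> x y'"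
        using b by (simp add: e_diff e_of kd balanced_def)
      then show ?thesis using r cl cancel by simp
    next
      fix a x y assume s: "r = frag_of (a \<odot>\<^bsub>M\<^esub> x, y) - frag_of (x, a \<odot>\<^bsub>N\<^esub> y)"
        "a \<in> carrier A" "x \<in> carrier M" "y \<in> carrier N"
      then have "e r = \<phi> x (a \<odot>\<^bsub>N\<^esub> y) \<otimes>\<^bsub>H\<^esub> inv\<^bsub>H\<^esub> \<phi> x (a \<odot>\<^bsub>N\<^esub> y)"
        using b by (simp add: e_diff e_of kd balanced_def)
      then show ?thesis using s cl by simp
    qed
  qed
  have e_null: "e r = \<one>\<^bsub>H\<^esub>" if "r \<in> K" for r
  proof -
    have "K \<subseteq> kernel FA H e" unfolding tensor_null_def
      using tensor_relations_subset e_rel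
      by (intro e.generate_subgroup_incl e.subgroup_kernel) (unfold kernel_def, blast)
    then show ?thesis using that by (auto simp: kernel_def)
  qed
  have K0: "0 \<in> K" using subgroup.one_closed[OF normal_imp_subgroup[OF tensor_null_normal]] by simp
  have KF: "K \<subseteq> carrier FA" by (rule subgroup.subset[OF normal_imp_subgroup[OF tensor_null_normal]])
  have lift: "tensor_lift H \<phi> (K #>\<^bsub>FA\<^esub> w) = e w" if "w \<in> carrier FA" for w
  proof -
    have "e ` (K #>\<^bsub>FA\<^esub> w) = {e w}"
    proof -
      have "e (k + w) = e w" if "k \<in> K" for k
        using e.hom_mult[of k w] e_null[OF that] KF that \<open>w \<in> carrier FA\<close> e.hom_closed[of w] by auto
      moreover have "w \<in> K #>\<^bsub>FA\<^esub> w" using K0 by (force simp: r_coset_def)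
      ultimately show ?thesis by (auto simp: r_coset_def)
    qed
    then show ?thesis by (simp add: tensor_lift_def e_def)
  qed
  have rep: "\<exists>w \<in> carrier FA. z = K #>\<^bsub>FA\<^esub> w" if "z \<in> carrier T" for z
    using that by (auto simp: tensor_carrier tensor_group_def carrier_FactGroup)
  show "tensor_lift H \<phi> z \<in> carrier H" if "z \<in> carrier T"
    using rep[OF that] lift by auto
  show "tensor_lift H \<phi> (z \<oplus>\<^bsub>T\<^esub> z') = tensor_lift H \<phi> z \<otimes>\<^bsub>H\<^esub> tensor_lift H \<phi> z'"
    if zT: "z \<in> carrier T" "z' \<in> carrier T"
  proof -
    obtain w w' where w: "w \<in> carrier FA" "w' \<in> carrier FA" "z = K #>\<^bsub>FA\<^esub> w" "z' = K #>\<^bsub>FA\<^esub> w'"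
      using rep zT by blast
    have "w + w' \<in> carrier FA" using w(1,2) keys_add[of w w'] by auto
    then show ?thesis using w e.hom_mult[OF w(1,2)] by (simp add: coset_add lift)
  qed
  show "tensor_lift H \<phi> (pt x y) = \<phi> x y" if "x \<in> carrier M" "y \<in> carrier N"
    using that lift[of "frag_of (x, y)"] by (simp add: pure_tensor_def e_of)
qed

lemma tensor_lift_additive:
  assumes "abelian_group B" "balanced A M N (add_monoid B) \<phi>"
  shows "additive_map T B (tensor_lift (add_monoid B) \<phi>)"
  using tensor_lift_closed[OF abelian_group.a_comm_group[OF assms(1)] assms(2)]
    tensor_lift_add[OF abelian_group.a_comm_group[OF assms(1)] assms(2)]
  by (simp add: additive_map_def)

lemma tensor_lift_pure_add:
  assumes "abelian_group B" "balanced A M N (add_monoid B) \<phi>" "x \<in> carrier M" "y \<in> carrier N"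
  shows "tensor_lift (add_monoid B) \<phi> (pt x y) = \<phi> x y"
  by (rule tensor_lift_pure[OF abelian_group.a_comm_group[OF assms(1)] assms(2-4)])

end

text \<open>\<open>tensor_map\<close> and the products are defined by lifts into
  \<open>tensor_group\<close>, while linearity is stated for the additive monoid of
  \<open>tensor_module\<close>. The underlying group is the same, hence so are powers, products and
  lifts.\<close>

lemma tensor_lift_cong_structure:
  fixes G :: "('h, 's) monoid_scheme" and H :: "('h, 't) monoid_scheme" and \<phi> :: "'m \<Rightarrow> 'n \<Rightarrow> 'h"
  assumes "carrier G = carrier H" "monoid.mult G = monoid.mult H" "one G = one H"
  shows "tensor_lift G \<phi> = tensor_lift H \<phi>"
proof -
  have i: "m_inv G x = m_inv H x" for x using assms by (simp add: m_inv_def)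
  have p: "x [^]\<^bsub>G\<^esub> (k::int) = x [^]\<^bsub>H\<^esub> k" for x k
    using assms by (simp add: int_pow_def nat_pow_def i Let_def)
  have "finprod G f S = finprod H f S" for f :: "'m \<times> 'n \<Rightarrow> 'h" and S
    using assms by (simp add: finprod_def)
  then show ?thesis by (simp add: tensor_lift_def fun_eq_iff p)
qed

lemma tensor_lift_tensor_group:
  "tensor_lift (tensor_group A M N) \<phi> = tensor_lift (add_monoid (tensor_module A M N)) \<phi>"
  by (rule tensor_lift_cong_structure) (simp_all add: tensor_module_def)

section \<open>The A-module structure of a tensor product\<close>

context module_pair
begin

lemma smult_tensor: "(\<odot>\<^bsub>T\<^esub>) a = tensor_lift (add_monoid T) (\<lambda>x y. pt (a \<odot>\<^bsub>M\<^esub> x) y)"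
  by (simp add: tensor_lift_tensor_group[symmetric]) (simp add: tensor_module_def)

text \<open>Commutativity of A makes multiplication by a balanced: a (b x) = b (a x).\<close>

lemma balanced_smult:
  assumes "a \<in> carrier A"
  shows "balanced A M N (add_monoid T) (\<lambda>x y. pt (a \<odot>\<^bsub>M\<^esub> x) y)"
  using assms
  by (auto simp: balanced_def M.smult_r_distr pure_add_left pure_add_right
      M.smult_assoc1[symmetric] M.m_comm simp flip: pure_smult)

lemma additive_smult: "a \<in> carrier A \<Longrightarrow> additive_map T T ((\<odot>\<^bsub>T\<^esub>) a)"
  unfolding smult_tensor
  by (rule tensor_lift_additive[OF tensor_abelian_group balanced_smult])

lemma smult_pure:
  "a \<in> carrier A \<Longrightarrow> x \<in> carrier M \<Longrightarrow> y \<in> carrier N \<Longrightarrow> a \<odot>\<^bsub>T\<^esub> pt x y = pt (a \<odot>\<^bsub>M\<^esub> x) y"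
  unfolding smult_tensor
  by (rule tensor_lift_pure_add[OF tensor_abelian_group balanced_smult])

lemma tensor_is_module: "module A T"
proof (rule moduleI)
  show "cring A" ..
  show "abelian_group T" ..
  show cl: "a \<odot>\<^bsub>T\<^esub> z \<in> carrier T" if "a \<in> carrier A" "z \<in> carrier T" for a z
    using additive_map_closed[OF additive_smult] that .
  show ad: "a \<odot>\<^bsub>T\<^esub> (z \<oplus>\<^bsub>T\<^esub> z') = a \<odot>\<^bsub>T\<^esub> z \<oplus>\<^bsub>T\<^esub> a \<odot>\<^bsub>T\<^esub> z'"
    if "a \<in> carrier A" "z \<in> carrier T" "z' \<in> carrier T" for a z z'
    using additive_map_add[OF additive_smult] that .
  show "(a \<oplus> b) \<odot>\<^bsub>T\<^esub> z = a \<odot>\<^bsub>T\<^esub> z \<oplus>\<^bsub>T\<^esub> b \<odot>\<^bsub>T\<^esub> z"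
    if "a \<in> carrier A" "b \<in> carrier A" "z \<in> carrier T" for a b z
    using that(3)
    by (induction rule: tensor_induct)
      (use that(1,2) in \<open>simp_all add: smult_pure M.smult_l_distr pure_add_left ad cl T.a_ac\<close>)
  show "(a \<otimes> b) \<odot>\<^bsub>T\<^esub> z = a \<odot>\<^bsub>T\<^esub> (b \<odot>\<^bsub>T\<^esub> z)"
    if "a \<in> carrier A" "b \<in> carrier A" "z \<in> carrier T" for a b z
    using that(3)
    by (induction rule: tensor_induct)
      (use that(1,2) in \<open>simp_all add: smult_pure M.smult_assoc1 ad cl\<close>)
  show "\<one> \<odot>\<^bsub>T\<^esub> z = z" if "z \<in> carrier T" for z
    using that by (induction rule: tensor_induct) (simp_all add: smult_pure ad)
qed

sublocale T: module A T by (rule tensor_is_module)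

lemma smult_pure_right:
  "a \<in> carrier A \<Longrightarrow> x \<in> carrier M \<Longrightarrow> y \<in> carrier N \<Longrightarrow> a \<odot>\<^bsub>T\<^esub> pt x y = pt x (a \<odot>\<^bsub>N\<^esub> y)"
  by (simp add: smult_pure pure_smult)

lemma pure_bilinear: "bilinear_map A M N T pt"
  by (rule bilinear_mapI)
    (simp_all add: pure_add_left pure_add_right smult_pure smult_pure_right flip: pure_smult)

lemma tensor_lift_linear:
  assumes "module A B" "bilinear_map A M N B f"
  shows "linear_map A T B (tensor_lift (add_monoid B) f)"
proof -
  interpret B: module A B by fact
  note b = bilinear_map_balanced[OF assms(2)]
  let ?l = "tensor_lift (add_monoid B) f"
  have ad: "additive_map T B ?l" by (rule tensor_lift_additive[OF B.abelian_group_axioms b])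
  show ?thesis
  proof (rule linear_mapI[OF ad])
    fix a z assume a: "a \<in> carrier A" and "z \<in> carrier T"
    from this(2) show "?l (a \<odot>\<^bsub>T\<^esub> z) = a \<odot>\<^bsub>B\<^esub> ?l z"
    proof (induction rule: tensor_induct)
      case (pure x y)
      then show ?case using a assms(2)
        by (simp add: smult_pure tensor_lift_pure_add[OF B.abelian_group_axioms b] bilinear_map_smult_left)
    next
      case (add z z')
      then show ?case using a
        by (simp add: T.smult_r_distr B.smult_r_distr additive_map_add[OF ad] additive_map_closed[OF ad])
    qed
  qed
qed

lemma tensor_lift_bilinear_pure:
  assumes "module A B" "bilinear_map A M N B f" "x \<in> carrier M" "y \<in> carrier N"
  shows "tensor_lift (add_monoid B) f (pt x y) = f x y"
  by (rule tensor_lift_pure_add[OF module.axioms(2)[OF assms(1)] bilinear_map_balanced[OF assms(2)] assms(3,4)])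

end

section \<open>Functoriality of the tensor product in linear and bilinear maps\<close>

locale module_pair_map = P: module_pair A M N + Q: module_pair A M' N'
  for A :: "('a, 'r) ring_scheme" (structure) and M :: "('a, 'm, 's) module_scheme"
    and N :: "('a, 'n, 't) module_scheme" and M' :: "('a, 'k, 'u) module_scheme"
    and N' :: "('a, 'l, 'v) module_scheme"
begin

lemma tensor_map_bilinear:
  assumes f: "linear_map A M M' f" and g: "linear_map A N N' g"
  shows "bilinear_map A M N Q.T (\<lambda>x y. Q.pt (f x) (g y))"
  by (rule bilinear_map_comp[OF Q.pure_bilinear f g])

lemma tensor_map_linear:
  assumes "linear_map A M M' f" "linear_map A N N' g"
  shows "linear_map A P.T Q.T (tensor_map A M' N' f g)"
  unfolding tensor_map_def tensor_lift_tensor_group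
  by (rule P.tensor_lift_linear[OF Q.tensor_is_module tensor_map_bilinear[OF assms]])

lemma tensor_map_pure:
  assumes "linear_map A M M' f" "linear_map A N N' g" "x \<in> carrier M" "y \<in> carrier N"
  shows "tensor_map A M' N' f g (P.pt x y) = Q.pt (f x) (g y)"
  unfolding tensor_map_def tensor_lift_tensor_group
  by (rule P.tensor_lift_bilinear_pure[OF Q.tensor_is_module tensor_map_bilinear[OF assms(1,2)] assms(3,4)])

end

text \<open>Two bilinear maps \<open>\<mu> : M \<times> M' \<rightarrow> M''\<close> and \<open>\<nu> : N \<times> N' \<rightarrow> N''\<close> induce a bilinear map
  \<open>(M \<otimes> N) \<times> (M' \<otimes> N') \<rightarrow> M'' \<otimes> N''\<close>.  Multiplication in \<open>U \<otimes> V\<close>, its action on \<open>F \<otimes> G\<close> and the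
  product of two presentations are all of this form.\<close>

definition tensor_bimap ::
    "('a, 'r) ring_scheme \<Rightarrow> ('a, 'm, 's) module_scheme \<Rightarrow> ('a, 'n, 't) module_scheme
      \<Rightarrow> ('k \<Rightarrow> 'i \<Rightarrow> 'm) \<Rightarrow> ('l \<Rightarrow> 'j \<Rightarrow> 'n) \<Rightarrow> ('k, 'l) tensor \<Rightarrow> ('i, 'j) tensor \<Rightarrow> ('m, 'n) tensor" where
  "tensor_bimap A M N \<mu> \<nu> W Y =
     tensor_lift (tensor_group A M N) (\<lambda>u v. tensor_map A M N (\<mu> u) (\<nu> v) Y) W"

locale module_pair_bimap = P: module_pair A M N + P': module_pair A M' N' + P'': module_pair A M'' N''
  for A :: "('a, 'r) ring_scheme" (structure) and M :: "('a, 'm, 's) module_scheme"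
    and N :: "('a, 'n, 't) module_scheme" and M' :: "('a, 'm1, 's1) module_scheme"
    and N' :: "('a, 'n1, 't1) module_scheme" and M'' :: "('a, 'm2, 's2) module_scheme"
    and N'' :: "('a, 'n2, 't2) module_scheme" +
  fixes \<mu> \<nu>
  assumes \<mu>: "bilinear_map A M M' M'' \<mu>" and \<nu>: "bilinear_map A N N' N'' \<nu>"
begin

sublocale Q: module_pair_map A M' N' M'' N'' ..

abbreviation "bm \<equiv> tensor_bimap A M'' N'' \<mu> \<nu>"

lemma inner_linear: "u \<in> carrier M \<Longrightarrow> v \<in> carrier N \<Longrightarrow> linear_map A P'.T P''.T (tensor_map A M'' N'' (\<mu> u) (\<nu> v))"
  by (intro Q.tensor_map_linear bilinear_map_right[OF \<mu>] bilinear_map_right[OF \<nu>])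

lemma inner_pure:
  "u \<in> carrier M \<Longrightarrow> v \<in> carrier N \<Longrightarrow> x \<in> carrier M' \<Longrightarrow> y \<in> carrier N' \<Longrightarrow>
    tensor_map A M'' N'' (\<mu> u) (\<nu> v) (P'.pt x y) = P''.pt (\<mu> u x) (\<nu> v y)"
  by (intro Q.tensor_map_pure bilinear_map_right[OF \<mu>] bilinear_map_right[OF \<nu>])

text \<open>This licenses the second lift in \<open>tensor_bimap\<close>: with Y fixed, both sides
  of each identity in u and v are additive in Y, so pure tensors Y suffice.\<close>

lemma inner_bilinear:
  assumes Y: "Y \<in> carrier P'.T"
  shows "bilinear_map A M N P''.T (\<lambda>u v. tensor_map A M'' N'' (\<mu> u) (\<nu> v) Y)"
proof (rule bilinear_mapI)
  note cl = bilinear_map_closed[OF \<mu>] bilinear_map_closed[OF \<nu>]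
  note ln = linear_map_add[OF inner_linear] linear_map_closed[OF inner_linear]
  fix u v assume uv: "u \<in> carrier M" "v \<in> carrier N"
  show "tensor_map A M'' N'' (\<mu> u) (\<nu> v) Y \<in> carrier P''.T"
    using linear_map_closed[OF inner_linear] uv Y by blast
  show "tensor_map A M'' N'' (\<mu> (u \<oplus>\<^bsub>M\<^esub> u')) (\<nu> v) Y =
      tensor_map A M'' N'' (\<mu> u) (\<nu> v) Y \<oplus>\<^bsub>P''.T\<^esub> tensor_map A M'' N'' (\<mu> u') (\<nu> v) Y"
    if "u' \<in> carrier M" for u'
    using Y by (induction rule: P'.tensor_induct)
      (use uv that in \<open>simp_all add: inner_pure cl bilinear_map_add_left[OF \<mu>] P''.pure_add_left ln P''.T.a_ac\<close>)
  show "tensor_map A M'' N'' (\<mu> u) (\<nu> (v \<oplus>\<^bsub>N\<^esub> v')) Y =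
      tensor_map A M'' N'' (\<mu> u) (\<nu> v) Y \<oplus>\<^bsub>P''.T\<^esub> tensor_map A M'' N'' (\<mu> u) (\<nu> v') Y"
    if "v' \<in> carrier N" for v'
    using Y by (induction rule: P'.tensor_induct)
      (use uv that in \<open>simp_all add: inner_pure cl bilinear_map_add_left[OF \<nu>] P''.pure_add_right ln P''.T.a_ac\<close>)
  fix a assume a: "a \<in> carrier A"
  show "tensor_map A M'' N'' (\<mu> (a \<odot>\<^bsub>M\<^esub> u)) (\<nu> v) Y = a \<odot>\<^bsub>P''.T\<^esub> tensor_map A M'' N'' (\<mu> u) (\<nu> v) Y"
    using Y by (induction rule: P'.tensor_induct)
      (use uv a in \<open>simp_all add: inner_pure cl bilinear_map_smult_left[OF \<mu>] P''.smult_pure ln P''.T.smult_r_distr\<close>)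
  show "tensor_map A M'' N'' (\<mu> u) (\<nu> (a \<odot>\<^bsub>N\<^esub> v)) Y = a \<odot>\<^bsub>P''.T\<^esub> tensor_map A M'' N'' (\<mu> u) (\<nu> v) Y"
    using Y by (induction rule: P'.tensor_induct)
      (use uv a in \<open>simp_all add: inner_pure cl bilinear_map_smult_left[OF \<nu>] P''.smult_pure_right ln P''.T.smult_r_distr\<close>)
qed

lemma bimap_eq: "bm W Y = tensor_lift (add_monoid P''.T) (\<lambda>u v. tensor_map A M'' N'' (\<mu> u) (\<nu> v) Y) W"
  by (simp add: tensor_bimap_def tensor_lift_tensor_group)

lemma bimap_linear_left: "Y \<in> carrier P'.T \<Longrightarrow> linear_map A P.T P''.T (\<lambda>W. bm W Y)"
  unfolding bimap_eq by (rule P.tensor_lift_linear[OF P''.tensor_is_module inner_bilinear])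

lemma bimap_pure_left:
  "u \<in> carrier M \<Longrightarrow> v \<in> carrier N \<Longrightarrow> Y \<in> carrier P'.T \<Longrightarrow>
    bm (P.pt u v) Y = tensor_map A M'' N'' (\<mu> u) (\<nu> v) Y"
  unfolding bimap_eq by (rule P.tensor_lift_bilinear_pure[OF P''.tensor_is_module inner_bilinear])

lemma bimap_pure:
  "u \<in> carrier M \<Longrightarrow> v \<in> carrier N \<Longrightarrow> x \<in> carrier M' \<Longrightarrow> y \<in> carrier N' \<Longrightarrow>
    bm (P.pt u v) (P'.pt x y) = P''.pt (\<mu> u x) (\<nu> v y)"
  by (simp add: bimap_pure_left inner_pure)

lemma bimap_bilinear: "bilinear_map A P.T P'.T P''.T bm"
proof (rule bilinear_mapI)
  note ll = linear_map_add[OF bimap_linear_left] linear_map_closed[OF bimap_linear_left]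
    linear_map_smult[OF bimap_linear_left]
  note il = linear_map_add[OF inner_linear] linear_map_closed[OF inner_linear]
    linear_map_smult[OF inner_linear]
  fix W Y assume W: "W \<in> carrier P.T" and Y: "Y \<in> carrier P'.T"
  show "bm W Y \<in> carrier P''.T" using ll W Y by simp
  show "bm (W \<oplus>\<^bsub>P.T\<^esub> W') Y = bm W Y \<oplus>\<^bsub>P''.T\<^esub> bm W' Y" if "W' \<in> carrier P.T" for W'
    using ll W Y that by simp
  show "bm W (Y \<oplus>\<^bsub>P'.T\<^esub> Y') = bm W Y \<oplus>\<^bsub>P''.T\<^esub> bm W Y'" if "Y' \<in> carrier P'.T" for Y'
    using W by (induction rule: P.tensor_induct)
      (use Y that in \<open>simp_all add: bimap_pure_left il ll P''.T.a_ac\<close>)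
  fix a assume a: "a \<in> carrier A"
  show "bm (a \<odot>\<^bsub>P.T\<^esub> W) Y = a \<odot>\<^bsub>P''.T\<^esub> bm W Y" using ll W Y a by simp
  show "bm W (a \<odot>\<^bsub>P'.T\<^esub> Y) = a \<odot>\<^bsub>P''.T\<^esub> bm W Y"
    using W by (induction rule: P.tensor_induct)
      (use Y a in \<open>simp_all add: bimap_pure_left il ll P''.T.smult_r_distr\<close>)
qed

end

section \<open>Direct sum decompositions\<close>

text \<open>The whole family is selected at once, because \<open>internal_direct_sum\<close> asserts
  uniqueness of families. Outside the carrier the value is meaningless.\<close>

definition component :: "('m, 's) ring_scheme \<Rightarrow> (nat \<Rightarrow> 'm set) \<Rightarrow> nat \<Rightarrow> 'm \<Rightarrow> 'm" where
  "component M Mg n x = (THE c. (\<forall>n. c n \<in> Mg n) \<and> finite {n. c n \<noteq> \<zero>\<^bsub>M\<^esub>} \<and>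
     x = finsum M c {n. c n \<noteq> \<zero>\<^bsub>M\<^esub>}) n"

locale direct_sum = abelian_group M
  for M :: "('m, 's) ring_scheme" (structure) and Mg :: "nat \<Rightarrow> 'm set" +
  assumes direct: "internal_direct_sum M Mg"
begin

abbreviation "cmp \<equiv> component M Mg"

lemma grade_subgroup: "subgroup (Mg n) (add_monoid M)"
  using direct by (simp add: internal_direct_sum_def additive_subgroup_def)

lemma grade_subset: "Mg n \<subseteq> carrier M"
  using subgroup.subset[OF grade_subgroup] by simp

lemma grade_carrier: "x \<in> Mg n \<Longrightarrow> x \<in> carrier M"
  using grade_subset by blast

lemma component_spec:
  assumes "x \<in> carrier M"
  shows "(\<forall>n. cmp n x \<in> Mg n) \<and> finite {n. cmp n x \<noteq> \<zero>} \<and>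
    x = finsum M (\<lambda>n. cmp n x) {n. cmp n x \<noteq> \<zero>}"
proof -
  let ?P = "\<lambda>c. (\<forall>n. c n \<in> Mg n) \<and> finite {n. c n \<noteq> \<zero>} \<and> x = finsum M c {n. c n \<noteq> \<zero>}"
  have "\<exists>!c. ?P c" using direct assms by (simp add: internal_direct_sum_def)
  from theI'[OF this] show ?thesis unfolding component_def[abs_def] .
qed

lemma component_grade: "x \<in> carrier M \<Longrightarrow> cmp n x \<in> Mg n"
  using component_spec by blast

lemma component_closed [simp, intro]: "x \<in> carrier M \<Longrightarrow> cmp n x \<in> carrier M"
  using component_grade grade_carrier by blast

lemma component_finite: "x \<in> carrier M \<Longrightarrow> finite {n. cmp n x \<noteq> \<zero>}"
  using component_spec by blast

lemma component_sum:
  assumes "x \<in> carrier M" "finite I" "{n. cmp n x \<noteq> \<zero>} \<subseteq> I"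
  shows "x = finsum M (\<lambda>n. cmp n x) I"
proof -
  have "finsum M (\<lambda>n. cmp n x) {n. cmp n x \<noteq> \<zero>} = finsum M (\<lambda>n. cmp n x) I"
    using assms by (intro add.finprod_mono_neutral_cong_left) auto
  then show ?thesis using component_spec[OF assms(1)] by simp
qed

text \<open>Allowing any finite index set that contains the support spares the computation of exact
  supports, which cancellation in a sum would spoil.\<close>

lemma component_unique:
  assumes c: "\<And>n. c n \<in> Mg n" "finite I" "{n. c n \<noteq> \<zero>} \<subseteq> I" and x: "x = finsum M c I"
  shows "cmp n x = c n"
proof -
  have cc: "c \<in> I \<rightarrow> carrier M" using c(1) grade_carrier by auto
  have xc: "x \<in> carrier M" using cc x by simp
  have "finsum M c {n. c n \<noteq> \<zero>} = finsum M c I"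
    using c cc by (intro add.finprod_mono_neutral_cong_left) auto
  then have "(\<forall>n. c n \<in> Mg n) \<and> finite {n. c n \<noteq> \<zero>} \<and> x = finsum M c {n. c n \<noteq> \<zero>}"
    using c x by (auto intro: finite_subset)
  moreover have "\<exists>!c. (\<forall>n. c n \<in> Mg n) \<and> finite {n. c n \<noteq> \<zero>} \<and> x = finsum M c {n. c n \<noteq> \<zero>}"
    using direct xc by (simp add: internal_direct_sum_def)
  ultimately have "(THE c. (\<forall>n. c n \<in> Mg n) \<and> finite {n. c n \<noteq> \<zero>} \<and> x = finsum M c {n. c n \<noteq> \<zero>}) = c"
    by (intro the1_equality)
  then show ?thesis by (simp add: component_def)
qed

lemma component_additive: "additive_map M M (cmp n)"
proof (rule additive_mapI)
  fix x y assume x: "x \<in> carrier M" and y: "y \<in> carrier M"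
  let ?I = "{n. cmp n x \<noteq> \<zero>} \<union> {n. cmp n y \<noteq> \<zero>}"
  have I: "finite ?I" using x y component_finite by simp
  show "cmp n (x \<oplus> y) = cmp n x \<oplus> cmp n y"
  proof (rule component_unique[OF _ I])
    show "cmp n x \<oplus> cmp n y \<in> Mg n" for n
      by (intro subgroup_add[OF grade_subgroup] component_grade x y)
    show "{n. cmp n x \<oplus> cmp n y \<noteq> \<zero>} \<subseteq> ?I" by auto
    have "x \<oplus> y = finsum M (\<lambda>n. cmp n x) ?I \<oplus> finsum M (\<lambda>n. cmp n y) ?I"
      using component_sum[OF x I] component_sum[OF y I] by simp
    also have "\<dots> = finsum M (\<lambda>n. cmp n x \<oplus> cmp n y) ?I"
      using x y by (intro finsum_addf[symmetric]) auto
    finally show "x \<oplus> y = finsum M (\<lambda>n. cmp n x \<oplus> cmp n y) ?I" .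
  qed
qed auto

lemma component_homogeneous:
  assumes "x \<in> Mg m"
  shows "cmp n x = (if n = m then x else \<zero>)"
proof (rule component_unique[of _ "{m}"])
  show "(if n = m then x else \<zero>) \<in> Mg n" for n
    using assms subgroup_zero[OF grade_subgroup] by simp
  show "x = finsum M (\<lambda>n. if n = m then x else \<zero>) {m}" using assms grade_carrier by simp
qed auto

lemma grade_induct [consumes 1, case_names homogeneous add]:
  assumes "x \<in> carrier M" and hom: "\<And>n x. x \<in> Mg n \<Longrightarrow> Q x"
    and add: "\<And>x y. x \<in> carrier M \<Longrightarrow> y \<in> carrier M \<Longrightarrow> Q x \<Longrightarrow> Q y \<Longrightarrow> Q (x \<oplus> y)"
  shows "Q x"
proof -
  have "Q (finsum M (\<lambda>n. cmp n x) I)" if "finite I" for I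
    using that
  proof (induction I rule: finite_induct)
    case empty
    then show ?case using hom[OF subgroup_zero[OF grade_subgroup]] by simp
  next
    case (insert i I)
    then show ?case using assms(1) hom[OF component_grade] by (simp add: Pi_iff add)
  qed
  from this[OF component_finite[OF assms(1)]] show ?thesis
    using component_spec[OF assms(1)] by simp
qed

end

text \<open>The projections give both halves of directness. Applied to a decomposition, \<pi> n
  returns its n-th coefficient, whence uniqueness; and each element of the span of the grades is the
  sum of its projections, whence existence.\<close>

lemma internal_direct_sumI:
  assumes M: "abelian_group M" and sub: "\<And>n. subgroup (Mg n) (add_monoid M)"
    and \<pi>: "\<And>n. additive_map M M (\<pi> n)"
    and \<pi>_id: "\<And>n x. x \<in> Mg n \<Longrightarrow> \<pi> n x = x"
    and \<pi>_zero: "\<And>m n x. x \<in> Mg n \<Longrightarrow> m \<noteq> n \<Longrightarrow> \<pi> m x = \<zero>\<^bsub>M\<^esub>"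
    and span: "carrier M \<subseteq> generate (add_monoid M) (\<Union>n. Mg n)"
  shows "internal_direct_sum M Mg"
proof -
  interpret abelian_group M by fact
  have subc: "x \<in> carrier M" if "x \<in> Mg n" for n x
    using subgroup.subset[OF sub] that by auto
  have induct: "Q x" if "x \<in> carrier M" "\<And>n x. x \<in> Mg n \<Longrightarrow> Q x"
    "\<And>x y. x \<in> carrier M \<Longrightarrow> y \<in> carrier M \<Longrightarrow> Q x \<Longrightarrow> Q y \<Longrightarrow> Q (x \<oplus>\<^bsub>M\<^esub> y)" for Q x
  proof -
    have "x \<in> generate (add_monoid M) (\<Union>n. Mg n)" "(\<Union>n. Mg n) \<subseteq> carrier M"
      using that(1) span subc by auto
    then show ?thesis
    proof (induction rule: span_induct)
      case (neg s)
      then show ?case using subgroup_neg[OF sub] by blast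
    next
      case zero
      show ?case by (rule that(2)[OF subgroup_zero[OF sub]])
    next
      case (incl s)
      then show ?case using that(2) by blast
    qed (rule that(3))
  qed
  have \<pi>g: "\<pi> n x \<in> Mg n" if "x \<in> carrier M" for n x
    using that
  proof (rule induct)
    fix m x assume "x \<in> Mg m"
    then show "\<pi> n x \<in> Mg n"
      using \<pi>_id[of x n] \<pi>_zero[of x m n] subgroup_zero[OF sub] by (cases "m = n") auto
  qed (simp add: additive_map_add[OF \<pi>] subgroup_add[OF sub])
  have \<pi>c: "\<pi> n x \<in> carrier M" if "x \<in> carrier M" for n x
    using additive_map_closed[OF \<pi> that] .
  have ex: "finite {n. \<pi> n x \<noteq> \<zero>\<^bsub>M\<^esub>} \<and> x = finsum M (\<lambda>n. \<pi> n x) {n. \<pi> n x \<noteq> \<zero>\<^bsub>M\<^esub>}"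
    if "x \<in> carrier M" for x
    using that
  proof (rule induct)
    fix m x assume x: "x \<in> Mg m"
    show "finite {n. \<pi> n x \<noteq> \<zero>\<^bsub>M\<^esub>} \<and> x = finsum M (\<lambda>n. \<pi> n x) {n. \<pi> n x \<noteq> \<zero>\<^bsub>M\<^esub>}"
    proof (cases "x = \<zero>\<^bsub>M\<^esub>")
      case True
      then have "\<pi> n x = \<zero>\<^bsub>M\<^esub>" for n using x \<pi>_id \<pi>_zero by (cases "n = m") auto
      then show ?thesis using True by simp
    next
      case False
      then have "{n. \<pi> n x \<noteq> \<zero>\<^bsub>M\<^esub>} = {m}" using x \<pi>_id[OF x] \<pi>_zero[OF x] by auto
      then show ?thesis using x \<pi>_id[OF x] subc[OF x] by simp
    qed
  next
    fix x y assume x: "x \<in> carrier M" and y: "y \<in> carrier M"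
      and hx: "finite {n. \<pi> n x \<noteq> \<zero>\<^bsub>M\<^esub>} \<and> x = finsum M (\<lambda>n. \<pi> n x) {n. \<pi> n x \<noteq> \<zero>\<^bsub>M\<^esub>}"
      and hy: "finite {n. \<pi> n y \<noteq> \<zero>\<^bsub>M\<^esub>} \<and> y = finsum M (\<lambda>n. \<pi> n y) {n. \<pi> n y \<noteq> \<zero>\<^bsub>M\<^esub>}"
    \<comment> \<open>Supports can shrink under addition, so all sums are compared over the union of
      the two supports.\<close>
    let ?I = "{n. \<pi> n x \<noteq> \<zero>\<^bsub>M\<^esub>} \<union> {n. \<pi> n y \<noteq> \<zero>\<^bsub>M\<^esub>}"
    have I: "finite ?I" using hx hy by simp
    have s: "z = finsum M (\<lambda>n. \<pi> n z) ?I"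
      if "z = finsum M (\<lambda>n. \<pi> n z) {n. \<pi> n z \<noteq> \<zero>\<^bsub>M\<^esub>}" "z \<in> carrier M" "{n. \<pi> n z \<noteq> \<zero>\<^bsub>M\<^esub>} \<subseteq> ?I" for z
    proof -
      have "finsum M (\<lambda>n. \<pi> n z) {n. \<pi> n z \<noteq> \<zero>\<^bsub>M\<^esub>} = finsum M (\<lambda>n. \<pi> n z) ?I"
        using that \<pi>c by (intro add.finprod_mono_neutral_cong_left[OF I]) auto
      then show ?thesis using that(1) by simp
    qed
    have e: "\<pi> n (x \<oplus>\<^bsub>M\<^esub> y) = \<pi> n x \<oplus>\<^bsub>M\<^esub> \<pi> n y" for n using additive_map_add[OF \<pi> x y] .
    have sub': "{n. \<pi> n (x \<oplus>\<^bsub>M\<^esub> y) \<noteq> \<zero>\<^bsub>M\<^esub>} \<subseteq> ?I" by (auto simp: e)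
    have "x \<oplus>\<^bsub>M\<^esub> y = finsum M (\<lambda>n. \<pi> n x) ?I \<oplus>\<^bsub>M\<^esub> finsum M (\<lambda>n. \<pi> n y) ?I"
      using s[of x] s[of y] hx hy x y by simp
    also have "\<dots> = finsum M (\<lambda>n. \<pi> n (x \<oplus>\<^bsub>M\<^esub> y)) ?I"
      using x y by (simp add: e \<pi>c finsum_addf)
    also have "\<dots> = finsum M (\<lambda>n. \<pi> n (x \<oplus>\<^bsub>M\<^esub> y)) {n. \<pi> n (x \<oplus>\<^bsub>M\<^esub> y) \<noteq> \<zero>\<^bsub>M\<^esub>}"
      using I sub' x y by (intro add.finprod_mono_neutral_cong_right) (auto simp: \<pi>c)
    finally show "finite {n. \<pi> n (x \<oplus>\<^bsub>M\<^esub> y) \<noteq> \<zero>\<^bsub>M\<^esub>} \<and>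
        x \<oplus>\<^bsub>M\<^esub> y = finsum M (\<lambda>n. \<pi> n (x \<oplus>\<^bsub>M\<^esub> y)) {n. \<pi> n (x \<oplus>\<^bsub>M\<^esub> y) \<noteq> \<zero>\<^bsub>M\<^esub>}"
      using finite_subset[OF sub' I] by blast
  qed
  have uniq: "c = (\<lambda>n. \<pi> n x)"
    if c: "\<forall>n. c n \<in> Mg n" "finite {n. c n \<noteq> \<zero>\<^bsub>M\<^esub>}" "x = finsum M c {n. c n \<noteq> \<zero>\<^bsub>M\<^esub>}" for c x
  proof
    fix n
    let ?I = "{n. c n \<noteq> \<zero>\<^bsub>M\<^esub>}"
    have cc: "c m \<in> carrier M" for m using c(1) subc by blast
    have \<pi>c: "\<pi> n (c m) = (if n = m then c m else \<zero>\<^bsub>M\<^esub>)" for m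
      using c(1) \<pi>_id[of "c m" m] \<pi>_zero[of "c m" m n] by auto
    have "\<pi> n x = finsum M (\<lambda>m. \<pi> n (c m)) ?I"
      using c cc additive_finsum[OF M M \<pi>, of ?I c n] by auto
    also have "\<dots> = finsum M (\<lambda>m. if n = m then c m else \<zero>\<^bsub>M\<^esub>) (insert n ?I)"
      using c(2) cc by (intro add.finprod_mono_neutral_cong_left) (auto simp: \<pi>c)
    also have "\<dots> = c n"
      using c(2) cc by (intro add.finprod_singleton) auto
    finally show "c n = \<pi> n x" ..
  qed
  show ?thesis
    unfolding internal_direct_sum_def
  proof (intro conjI allI ballI)
    show "additive_subgroup (Mg n) M" for n by (rule additive_subgroup.intro[OF sub])
    fix x assume "x \<in> carrier M"
    then show "\<exists>!c. (\<forall>n. c n \<in> Mg n) \<and> finite {n. c n \<noteq> \<zero>\<^bsub>M\<^esub>} \<and> x = finsum M c {n. c n \<noteq> \<zero>\<^bsub>M\<^esub>}"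
      using \<pi>g ex uniq by (intro ex1I[of _ "\<lambda>n. \<pi> n x"]) blast+
  qed
qed


section \<open>The grading of a tensor product\<close>

lemma submodule_subgroup: "submodule H A M \<Longrightarrow> subgroup H (add_monoid M)"
  by (rule submodule.axioms)

text \<open>Families of submodules without directness. The presentations S(U_1) \<otimes> F_0 are
  treated at this level; \<open>graded_pair\<close> adds direct sums for U \<otimes> V and F
  \<otimes> G.\<close>

locale submodule_family_pair = module_pair A M N
  for A :: "('a, 'r) ring_scheme" (structure) and M :: "('a, 'm, 's) module_scheme"
    and N :: "('a, 'n, 't) module_scheme" +
  fixes Mg :: "nat \<Rightarrow> 'm set" and Ng :: "nat \<Rightarrow> 'n set"
  assumes sub_M: "submodule (Mg n) A M" and sub_N: "submodule (Ng n) A N"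
begin

abbreviation "Tg \<equiv> tensor_grading A M N Mg Ng"
abbreviation "pure_of_degree n \<equiv> {pt x y | x y p q. p + q = n \<and> x \<in> Mg p \<and> y \<in> Ng q}"

lemma grade_carrier_M: "x \<in> Mg n \<Longrightarrow> x \<in> carrier M"
  using subgroup.subset[OF submodule_subgroup[OF sub_M]] by auto

lemma grade_carrier_N: "x \<in> Ng n \<Longrightarrow> x \<in> carrier N"
  using subgroup.subset[OF submodule_subgroup[OF sub_N]] by auto

lemma tensor_grading_eq: "Tg n = generate (add_monoid T) (pure_of_degree n)"
  unfolding tensor_grading_def by (rule generate_cong_structure) (simp_all add: tensor_module_def)

lemma pure_of_degree_subset: "pure_of_degree n \<subseteq> carrier T"
  by (auto intro!: pure_closed grade_carrier_M grade_carrier_N)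

lemma tensor_grading_subgroup: "subgroup (Tg n) (add_monoid T)"
  unfolding tensor_grading_eq by (rule T.span_subgroup[OF pure_of_degree_subset])

lemma tensor_grading_carrier: "z \<in> Tg n \<Longrightarrow> z \<in> carrier T"
  using subgroup.subset[OF tensor_grading_subgroup] by auto

lemma pure_grade: "x \<in> Mg p \<Longrightarrow> y \<in> Ng q \<Longrightarrow> pt x y \<in> Tg (p + q)"
  unfolding tensor_grading_eq by (rule T.span_incl) auto

lemma tensor_grading_induct [consumes 1, case_names pure add]:
  assumes z: "z \<in> Tg n" and pure: "\<And>x y p q. x \<in> Mg p \<Longrightarrow> y \<in> Ng q \<Longrightarrow> p + q = n \<Longrightarrow> Q (pt x y)"
    and add: "\<And>z z'. z \<in> carrier T \<Longrightarrow> z' \<in> carrier T \<Longrightarrow> Q z \<Longrightarrow> Q z' \<Longrightarrow> Q (z \<oplus>\<^bsub>T\<^esub> z')"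
  shows "Q z"
  using z[unfolded tensor_grading_eq] pure_of_degree_subset
proof (induction rule: T.span_induct)
  fix s assume "s \<in> pure_of_degree n"
  then obtain x y p q where s: "s = pt x y" "p + q = n" "x \<in> Mg p" "y \<in> Ng q" by blast
  then have "\<ominus>\<^bsub>T\<^esub> s = pt (\<ominus>\<^bsub>M\<^esub> x) y" by (simp add: pure_minus grade_carrier_M grade_carrier_N)
  then show "\<ominus>\<^bsub>T\<^esub> s \<in> pure_of_degree n" using s M.subgroup_neg[OF submodule_subgroup[OF sub_M]] by blast
next
  \<comment> \<open>Zero is 0 \<otimes> 0 with degrees 0 and n, which meets the degree condition of
    \<open>pure\<close>.\<close>
  have "pt \<zero>\<^bsub>M\<^esub> \<zero>\<^bsub>N\<^esub> = \<zero>\<^bsub>T\<^esub>" by simp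
  moreover have "Q (pt \<zero>\<^bsub>M\<^esub> \<zero>\<^bsub>N\<^esub>)"
    using pure[OF M.subgroup_zero[OF submodule_subgroup[OF sub_M]] N.subgroup_zero[OF submodule_subgroup[OF sub_N]]]
    by (metis add_0)
  ultimately show "Q \<zero>\<^bsub>T\<^esub>" by simp
next
  show "Q s" if "s \<in> pure_of_degree n" for s using that pure by blast
qed (rule add)

lemma tensor_grading_submodule: "submodule (Tg n) A T"
proof (intro submodule.intro submodule_axioms.intro tensor_grading_subgroup)
  fix a z assume a: "a \<in> carrier A" and "z \<in> Tg n"
  from this(2) show "a \<odot>\<^bsub>T\<^esub> z \<in> Tg n"
  proof (induction rule: tensor_grading_induct)
    case (pure x y p q)
    have "a \<odot>\<^bsub>T\<^esub> pt x y = pt (a \<odot>\<^bsub>M\<^esub> x) y"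
      using pure a by (simp add: smult_pure grade_carrier_M grade_carrier_N)
    then show ?case using pure pure_grade submodule.smult_closed[OF sub_M] a by metis
  qed (use a in \<open>simp add: T.smult_r_distr T.subgroup_add[OF tensor_grading_subgroup]\<close>)
qed

end

section \<open>Directness of the tensor grading\<close>

locale graded_pair = submodule_family_pair A M N Mg Ng + MD: direct_sum M Mg + ND: direct_sum N Ng
  for A :: "('a, 'r) ring_scheme" (structure) and M :: "('a, 'm, 's) module_scheme"
    and N :: "('a, 'n, 't) module_scheme" and Mg Ng
begin

lemma component_linear_M: "linear_map A M M (component M Mg n)"
proof (rule linear_mapI[OF MD.component_additive])
  fix a x assume a: "a \<in> carrier A" and "x \<in> carrier M"
  from this(2) show "component M Mg n (a \<odot>\<^bsub>M\<^esub> x) = a \<odot>\<^bsub>M\<^esub> component M Mg n x"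
  proof (induction rule: MD.grade_induct)
    case (homogeneous m x)
    then have "a \<odot>\<^bsub>M\<^esub> x \<in> Mg m" using a submodule.smult_closed[OF sub_M] by blast
    then show ?case using homogeneous a by (simp add: MD.component_homogeneous)
  qed (use a in \<open>simp add: M.smult_r_distr additive_map_add[OF MD.component_additive]\<close>)
qed

lemma component_linear_N: "linear_map A N N (component N Ng n)"
proof (rule linear_mapI[OF ND.component_additive])
  fix a x assume a: "a \<in> carrier A" and "x \<in> carrier N"
  from this(2) show "component N Ng n (a \<odot>\<^bsub>N\<^esub> x) = a \<odot>\<^bsub>N\<^esub> component N Ng n x"
  proof (induction rule: ND.grade_induct)
    case (homogeneous m x)
    then have "a \<odot>\<^bsub>N\<^esub> x \<in> Ng m" using a submodule.smult_closed[OF sub_N] by blast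
    then show ?case using homogeneous a by (simp add: ND.component_homogeneous)
  qed (use a in \<open>simp add: N.smult_r_distr additive_map_add[OF ND.component_additive]\<close>)
qed

lemma tensor_homogeneous_induct [consumes 1, case_names pure add]:
  assumes z: "z \<in> carrier T" and pure: "\<And>x y p q. x \<in> Mg p \<Longrightarrow> y \<in> Ng q \<Longrightarrow> Q (pt x y)"
    and add: "\<And>z z'. z \<in> carrier T \<Longrightarrow> z' \<in> carrier T \<Longrightarrow> Q z \<Longrightarrow> Q z' \<Longrightarrow> Q (z \<oplus>\<^bsub>T\<^esub> z')"
  shows "Q z"
  using z
proof (induction rule: tensor_induct)
  case (pure x y)
  from pure(1) show ?case
  proof (induction rule: MD.grade_induct)
    case (homogeneous p x)
    from pure(2) show ?case
      by (induction rule: ND.grade_induct)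
        (use homogeneous in \<open>auto simp: MD.grade_carrier pure_add_right intro: assms(2) add\<close>)
  qed (use pure(2) in \<open>simp add: pure_add_left add\<close>)
qed (rule add)

text \<open>The degree n part of x \<otimes> y is the sum of the x_p \<otimes> y_(n-p). Letting p
  run over \<open>{..n}\<close> keeps the natural-number difference exact and the index set the same
  for all x and y, so that additivity is checked summand by summand.\<close>

definition tensor_projection where
  "tensor_projection n = tensor_lift (add_monoid T)
     (\<lambda>x y. finsum T (\<lambda>p. pt (component M Mg p x) (component N Ng (n - p) y)) {..n})"

lemma tensor_projection_balanced:
  "balanced A M N (add_monoid T) (\<lambda>x y. finsum T (\<lambda>p. pt (component M Mg p x) (component N Ng (n - p) y)) {..n})"
  (is "balanced _ _ _ _ ?f")
proof -
  have b: "bilinear_map A M N T (\<lambda>x y. pt (component M Mg p x) (component N Ng q y))" for p q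
    by (rule bilinear_map_comp[OF pure_bilinear component_linear_M component_linear_N])
  have r: "additive_map N T (?f x)" if "x \<in> carrier M" for x
    using that by (intro additive_finsum_maps linear_map_additive[of A] bilinear_map_right[OF b] tensor_abelian_group) auto
  have l: "additive_map M T (\<lambda>x. ?f x y)" if "y \<in> carrier N" for y
    using that by (intro additive_finsum_maps linear_map_additive[of A] bilinear_map_left[OF b] tensor_abelian_group) auto
  have s: "?f (a \<odot>\<^bsub>M\<^esub> x) y = ?f x (a \<odot>\<^bsub>N\<^esub> y)" if "a \<in> carrier A" "x \<in> carrier M" "y \<in> carrier N" for a x y
    using that
    by (intro T.finsum_cong')
      (auto simp: linear_map_smult[OF component_linear_M] linear_map_smult[OF component_linear_N] pure_smult)
  show ?thesis
    unfolding balanced_def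
    using s additive_map_closed[OF r] additive_map_add[OF r] additive_map_add[OF l] by auto
qed

lemma tensor_projection_additive: "additive_map T T (tensor_projection n)"
  unfolding tensor_projection_def
  by (rule tensor_lift_additive[OF tensor_abelian_group tensor_projection_balanced])

lemma tensor_projection_pure:
  assumes "x \<in> Mg p" "y \<in> Ng q"
  shows "tensor_projection n (pt x y) = (if p + q = n then pt x y else \<zero>\<^bsub>T\<^esub>)"
proof -
  have xy: "x \<in> carrier M" "y \<in> carrier N" using assms MD.grade_carrier ND.grade_carrier by auto
  have "tensor_projection n (pt x y) =
      finsum T (\<lambda>p. pt (component M Mg p x) (component N Ng (n - p) y)) {..n}"
    unfolding tensor_projection_def
    by (rule tensor_lift_pure_add[OF tensor_abelian_group tensor_projection_balanced xy])
  \<comment> \<open>Only the index i = p can contribute; as then p \<le> n, the component of y in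
    degree n - p is y exactly when p + q = n.\<close>
  also have "\<dots> = finsum T (\<lambda>i. if p = i then (if p + q = n then pt x y else \<zero>\<^bsub>T\<^esub>) else \<zero>\<^bsub>T\<^esub>) {..n}"
    using xy assms by (intro T.finsum_cong') (auto simp: MD.component_homogeneous ND.component_homogeneous)
  also have "\<dots> = (if p + q = n then pt x y else \<zero>\<^bsub>T\<^esub>)"
  proof (cases "p \<le> n")
    case True
    then show ?thesis using xy by (subst T.add.finprod_singleton) auto
  next
    case False
    then have "finsum T (\<lambda>i. if p = i then (if p + q = n then pt x y else \<zero>\<^bsub>T\<^esub>) else \<zero>\<^bsub>T\<^esub>) {..n} =
      finsum T (\<lambda>i. \<zero>\<^bsub>T\<^esub>) {..n}"
      by (intro T.finsum_cong') auto
    then show ?thesis using False by (auto simp: T.finsum_zero)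
  qed
  finally show ?thesis .
qed

lemma tensor_projection_grade:
  assumes "z \<in> Tg n"
  shows "tensor_projection m z = (if m = n then z else \<zero>\<^bsub>T\<^esub>)"
  using assms
proof (induction rule: tensor_grading_induct)
  case (pure x y p q)
  then show ?case using tensor_projection_pure[OF pure(1,2), of m] by auto
next
  case (add z z')
  then show ?case using additive_map_add[OF tensor_projection_additive add(1,2), of m] by auto
qed

lemma tensor_grading_span: "carrier T \<subseteq> generate (add_monoid T) (\<Union>n. Tg n)"
proof (rule subsetI)
  have G: "(\<Union>n. Tg n) \<subseteq> carrier T" by (intro UN_least subsetI tensor_grading_carrier)
  fix z assume "z \<in> carrier T"
  then show "z \<in> generate (add_monoid T) (\<Union>n. Tg n)"
  proof (induction rule: tensor_homogeneous_induct)
    case (pure x y p q)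
    then show ?case by (intro T.span_incl UN_I[OF UNIV_I]) (rule pure_grade)
  next
    case (add z z')
    then show ?case by (intro T.subgroup_add[OF T.span_subgroup[OF G]])
  qed
qed

lemma tensor_direct_sum: "internal_direct_sum T Tg"
  by (rule internal_direct_sumI[where \<pi> = tensor_projection, OF tensor_abelian_group tensor_grading_subgroup tensor_projection_additive _ _ tensor_grading_span])
    (simp_all add: tensor_projection_grade)

end

text \<open>\<open>tensor_algebra\<close>, \<open>tensor_module_over\<close> and
  \<open>restrict_scalars\<close> keep the additive part of an existing record, possibly under
  another record type; these transfers move additive facts across.\<close>

lemma
  fixes M :: "('m, 's) ring_scheme" and N :: "('m, 't) ring_scheme"
  assumes "carrier M = carrier N" "ring.add M = ring.add N" "ring.zero M = ring.zero N"
  shows abelian_group_cong_structure: "abelian_group M \<Longrightarrow> abelian_group N"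
    and subgroup_cong_structure: "subgroup H (add_monoid M) \<longleftrightarrow> subgroup H (add_monoid N)"
    and a_inv_cong_structure: "a_inv M = a_inv N"
    and span_cong_structure: "generate (add_monoid M) S = generate (add_monoid N) S"
    and internal_direct_sum_cong_structure: "internal_direct_sum M Mg \<longleftrightarrow> internal_direct_sum N Mg"
proof -
  show sg: "subgroup H (add_monoid M) \<longleftrightarrow> subgroup H (add_monoid N)" for H
    using assms by (simp add: subgroup_def m_inv_def)
  show "a_inv M = a_inv N" using assms by (simp add: a_inv_def m_inv_def fun_eq_iff)
  show "generate (add_monoid M) S = generate (add_monoid N) S"
    by (rule generate_cong_structure) (use assms in auto)
  show "internal_direct_sum M Mg \<longleftrightarrow> internal_direct_sum N Mg"
    using assms sg by (simp add: internal_direct_sum_def additive_subgroup_def finsum_def finprod_def)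
  assume "abelian_group M"
  then interpret M: abelian_group M .
  show "abelian_group N"
    by (rule abelian_groupI)
      (auto simp: assms[symmetric] M.a_ac intro: M.l_neg)
qed


section \<open>Modules by restriction of scalars\<close>

lemma restrict_scalars_simps [simp]:
  "carrier (restrict_scalars U F) = carrier F"
  "ring.add (restrict_scalars U F) = ring.add F"
  "ring.zero (restrict_scalars U F) = ring.zero F"
  "a \<odot>\<^bsub>restrict_scalars U F\<^esub> x = (a \<odot>\<^bsub>U\<^esub> \<one>\<^bsub>U\<^esub>) \<odot>\<^bsub>F\<^esub> x"
  by (simp_all add: restrict_scalars_def)

lemma (in algebra) smult_one_mult:
  assumes "a \<in> carrier R" "x \<in> carrier M"
  shows "(a \<odot>\<^bsub>M\<^esub> \<one>\<^bsub>M\<^esub>) \<otimes>\<^bsub>M\<^esub> x = a \<odot>\<^bsub>M\<^esub> x"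
  using assms by (simp add: smult_assoc2)

lemma (in algebra) smult_assoc2_right:
  assumes "a \<in> carrier R" "x \<in> carrier M" "y \<in> carrier M"
  shows "x \<otimes>\<^bsub>M\<^esub> (a \<odot>\<^bsub>M\<^esub> y) = a \<odot>\<^bsub>M\<^esub> (x \<otimes>\<^bsub>M\<^esub> y)"
  using assms smult_assoc2[of a y x] by (simp add: m_comm)

lemma (in algebra) smult_one_smult_one:
  assumes "a \<in> carrier R" "b \<in> carrier R"
  shows "((a \<otimes>\<^bsub>R\<^esub> b) \<odot>\<^bsub>M\<^esub> \<one>\<^bsub>M\<^esub>) = (a \<odot>\<^bsub>M\<^esub> \<one>\<^bsub>M\<^esub>) \<otimes>\<^bsub>M\<^esub> (b \<odot>\<^bsub>M\<^esub> \<one>\<^bsub>M\<^esub>)"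
  using assms by (simp add: smult_assoc2 smult_assoc1)

lemma algebra_mult_bilinear:
  assumes "algebra A U"
  shows "bilinear_map A U U U (\<otimes>\<^bsub>U\<^esub>)"
proof -
  interpret algebra A U by fact
  show ?thesis
    by (rule bilinear_mapI) (simp_all add: l_distr r_distr smult_assoc2 smult_assoc2_right)
qed

lemma restrict_scalars_module:
  assumes "algebra A U" "module U F"
  shows "module A (restrict_scalars U F)"
proof -
  interpret U: algebra A U by fact
  interpret F: module U F by fact
  show ?thesis
  proof (rule moduleI)
    show "abelian_group (restrict_scalars U F)"
      by (rule abelian_group_cong_structure[of F]) (simp_all add: F.abelian_group_axioms)
  qed (auto simp: F.smult_l_distr F.smult_r_distr U.smult_l_distr U.smult_one_smult_one F.smult_assoc1 U.R_cring)
qed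

lemma restrict_scalars_bilinear:
  assumes "algebra A U" "module U F"
  shows "bilinear_map A U (restrict_scalars U F) (restrict_scalars U F) (\<odot>\<^bsub>F\<^esub>)"
proof -
  interpret U: algebra A U by fact
  interpret F: module U F by fact
  show ?thesis
  proof (rule bilinear_mapI)
    fix a u x assume a: "a \<in> carrier A" "u \<in> carrier U" "x \<in> carrier (restrict_scalars U F)"
    then have "(a \<odot>\<^bsub>U\<^esub> u) \<odot>\<^bsub>F\<^esub> x = ((a \<odot>\<^bsub>U\<^esub> \<one>\<^bsub>U\<^esub>) \<otimes>\<^bsub>U\<^esub> u) \<odot>\<^bsub>F\<^esub> x" by (simp add: U.smult_one_mult)
    with a show 1: "(a \<odot>\<^bsub>U\<^esub> u) \<odot>\<^bsub>F\<^esub> x = a \<odot>\<^bsub>restrict_scalars U F\<^esub> (u \<odot>\<^bsub>F\<^esub> x)"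
      by (simp add: F.smult_assoc1)
    have "u \<odot>\<^bsub>F\<^esub> (a \<odot>\<^bsub>restrict_scalars U F\<^esub> x) = (u \<otimes>\<^bsub>U\<^esub> (a \<odot>\<^bsub>U\<^esub> \<one>\<^bsub>U\<^esub>)) \<odot>\<^bsub>F\<^esub> x"
      using a by (simp add: F.smult_assoc1)
    also have "u \<otimes>\<^bsub>U\<^esub> (a \<odot>\<^bsub>U\<^esub> \<one>\<^bsub>U\<^esub>) = a \<odot>\<^bsub>U\<^esub> u" using a by (simp add: U.smult_assoc2_right)
    finally show "u \<odot>\<^bsub>F\<^esub> (a \<odot>\<^bsub>restrict_scalars U F\<^esub> x) = a \<odot>\<^bsub>restrict_scalars U F\<^esub> (u \<odot>\<^bsub>F\<^esub> x)"
      using 1 by simp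
  qed (simp_all add: F.smult_l_distr F.smult_r_distr)
qed

text \<open>One computation for three products: multiplication in U \<otimes> V, the action on F
  \<otimes> G, and later \<open>\<Phi>\<close>. On pure tensors the degrees p + p' and q + q' of the
  two factors add up to i + j.\<close>

lemma (in module_pair_bimap) bimap_grade:
  assumes "submodule_family_pair A M N Mg Ng" "submodule_family_pair A M' N' Mg' Ng'" "submodule_family_pair A M'' N'' Mg'' Ng''"
    and "\<And>p q u x. u \<in> Mg p \<Longrightarrow> x \<in> Mg' q \<Longrightarrow> \<mu> u x \<in> Mg'' (p + q)"
    and "\<And>p q v y. v \<in> Ng p \<Longrightarrow> y \<in> Ng' q \<Longrightarrow> \<nu> v y \<in> Ng'' (p + q)"
    and W: "W \<in> tensor_grading A M N Mg Ng i" and Y: "Y \<in> tensor_grading A M' N' Mg' Ng' j"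
  shows "bm W Y \<in> tensor_grading A M'' N'' Mg'' Ng'' (i + j)"
proof -
  interpret G: submodule_family_pair A M N Mg Ng by fact
  interpret G': submodule_family_pair A M' N' Mg' Ng' by fact
  interpret G'': submodule_family_pair A M'' N'' Mg'' Ng'' by fact
  note sg = P''.T.subgroup_add[OF G''.tensor_grading_subgroup]
  note bl = bimap_bilinear
  have YT: "Y \<in> carrier P'.T" using Y by (rule G'.tensor_grading_carrier)
  show ?thesis using W
  proof (induction rule: G.tensor_grading_induct)
    case (add z z')
    then show ?case using YT by (simp add: bilinear_map_add_left[OF bl] sg)
  next
    case (pure u v p q)
    then have uv: "u \<in> carrier M" "v \<in> carrier N" using G.grade_carrier_M G.grade_carrier_N by auto
    from Y show ?case
    proof (induction rule: G'.tensor_grading_induct)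
      case (add z z')
      then show ?case using uv by (simp add: bilinear_map_add_right[OF bl] sg)
    next
      case (pure x y p' q')
      then have "x \<in> carrier M'" "y \<in> carrier N'" using G'.grade_carrier_M G'.grade_carrier_N by auto
      then have "bm (P.pt u v) (P'.pt x y) = P''.pt (\<mu> u x) (\<nu> v y)" using uv by (simp add: bimap_pure)
      moreover have "P''.pt (\<mu> u x) (\<nu> v y) \<in> G''.Tg ((p + p') + (q + q'))"
        using pure \<open>u \<in> Mg p\<close> \<open>v \<in> Ng q\<close> by (intro G''.pure_grade assms)
      moreover have "(p + p') + (q + q') = i + j" using pure \<open>p + q = i\<close> by simp
      ultimately show ?case by simp
    qed
  qed
qed


section \<open>The tensor product of two standard algebras\<close>

context standard_algebra
begin

lemma graded_direct_sum: "direct_sum U Ug"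
  by (intro direct_sum.intro direct_sum_axioms.intro grading) (rule is_abelian_group)

lemma smult_one_grade: "a \<in> carrier A \<Longrightarrow> a \<odot>\<^bsub>U\<^esub> \<one>\<^bsub>U\<^esub> \<in> Ug 0"
  using grade_zero by (auto simp: bij_betw_def)

end

locale standard_algebra_pair = UA: standard_algebra A U Ug + VA: standard_algebra A V Vg
  for A :: "('a, 'r) ring_scheme" (structure)
    and U :: "('a, 'u, 's) module_scheme" and Ug :: "nat \<Rightarrow> 'u set"
    and V :: "('a, 'v, 't) module_scheme" and Vg :: "nat \<Rightarrow> 'v set"
begin

sublocale UD: direct_sum U Ug by (rule UA.graded_direct_sum)
sublocale VD: direct_sum V Vg by (rule VA.graded_direct_sum)

sublocale graded_pair A U V Ug Vg
  by (intro graded_pair.intro submodule_family_pair.intro module_pair.intro submodule_family_pair_axioms.intro UA.module_axioms VA.module_axioms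
      UD.direct_sum_axioms VD.direct_sum_axioms UA.submodule_grade VA.submodule_grade)

abbreviation "UV \<equiv> tensor_algebra A U V"

lemma tensor_algebra_simps [simp]:
  "carrier UV = carrier T" "ring.add UV = ring.add T" "ring.zero UV = ring.zero T"
  "smult UV = smult T" "monoid.mult UV = tensor_bimap A U V (\<otimes>\<^bsub>U\<^esub>) (\<otimes>\<^bsub>V\<^esub>)" "\<one>\<^bsub>UV\<^esub> = pt \<one>\<^bsub>U\<^esub> \<one>\<^bsub>V\<^esub>"
  by (auto simp: tensor_algebra_def tensor_bimap_def fun_eq_iff)

sublocale B: module_pair_bimap A U V U V U V "(\<otimes>\<^bsub>U\<^esub>)" "(\<otimes>\<^bsub>V\<^esub>)"
  by (intro module_pair_bimap.intro module_pair_bimap_axioms.intro module_pair_axioms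
      algebra_mult_bilinear UA.algebra_axioms VA.algebra_axioms)

lemma mult_closed: "z \<in> carrier T \<Longrightarrow> w \<in> carrier T \<Longrightarrow> z \<otimes>\<^bsub>UV\<^esub> w \<in> carrier T"
  using bilinear_map_closed[OF B.bimap_bilinear] by simp

lemma mult_add_left:
  "z \<in> carrier T \<Longrightarrow> z' \<in> carrier T \<Longrightarrow> w \<in> carrier T \<Longrightarrow>
    (z \<oplus>\<^bsub>T\<^esub> z') \<otimes>\<^bsub>UV\<^esub> w = z \<otimes>\<^bsub>UV\<^esub> w \<oplus>\<^bsub>T\<^esub> z' \<otimes>\<^bsub>UV\<^esub> w"
  using bilinear_map_add_left[OF B.bimap_bilinear] by simp

lemma mult_add_right:
  "z \<in> carrier T \<Longrightarrow> w \<in> carrier T \<Longrightarrow> w' \<in> carrier T \<Longrightarrow>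
    z \<otimes>\<^bsub>UV\<^esub> (w \<oplus>\<^bsub>T\<^esub> w') = z \<otimes>\<^bsub>UV\<^esub> w \<oplus>\<^bsub>T\<^esub> z \<otimes>\<^bsub>UV\<^esub> w'"
  using bilinear_map_add_right[OF B.bimap_bilinear] by simp

lemma mult_pure:
  "u \<in> carrier U \<Longrightarrow> v \<in> carrier V \<Longrightarrow> u' \<in> carrier U \<Longrightarrow> v' \<in> carrier V \<Longrightarrow>
    pt u v \<otimes>\<^bsub>UV\<^esub> pt u' v' = pt (u \<otimes>\<^bsub>U\<^esub> u') (v \<otimes>\<^bsub>V\<^esub> v')"
  by (simp add: B.bimap_pure)

lemma mult_comm:
  assumes "z \<in> carrier T" "w \<in> carrier T"
  shows "z \<otimes>\<^bsub>UV\<^esub> w = w \<otimes>\<^bsub>UV\<^esub> z"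
  using assms(1)
proof (induction rule: tensor_induct)
  case (pure u v)
  from assms(2) show ?case
    by (induction rule: tensor_induct)
      (use pure in \<open>simp_all add: mult_pure mult_add_left mult_add_right UA.m_comm VA.m_comm del: tensor_algebra_simps\<close>)
qed (use assms(2) in \<open>simp_all add: mult_add_left mult_add_right del: tensor_algebra_simps\<close>)

lemma mult_assoc:
  assumes "z \<in> carrier T" "w \<in> carrier T" "y \<in> carrier T"
  shows "(z \<otimes>\<^bsub>UV\<^esub> w) \<otimes>\<^bsub>UV\<^esub> y = z \<otimes>\<^bsub>UV\<^esub> (w \<otimes>\<^bsub>UV\<^esub> y)"
  using assms(1)
proof (induction rule: tensor_induct)
  case p1: (pure u v)
  from assms(2) show ?case
  proof (induction rule: tensor_induct)
    case p2: (pure u' v')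
    from assms(3) show ?case
      by (induction rule: tensor_induct)
        (use p1 p2 in \<open>simp_all add: mult_pure mult_closed mult_add_left mult_add_right UA.m_assoc VA.m_assoc del: tensor_algebra_simps\<close>)
  qed (use assms(3) p1 in \<open>simp_all add: mult_closed mult_add_left mult_add_right del: tensor_algebra_simps\<close>)
qed (use assms(2,3) in \<open>simp_all add: mult_closed mult_add_left mult_add_right del: tensor_algebra_simps\<close>)

lemma mult_one:
  assumes "z \<in> carrier T"
  shows "pt \<one>\<^bsub>U\<^esub> \<one>\<^bsub>V\<^esub> \<otimes>\<^bsub>UV\<^esub> z = z"
  using assms
  by (induction rule: tensor_induct) (simp_all add: mult_pure mult_add_right del: tensor_algebra_simps)

lemma tensor_algebra_cring: "cring UV"
proof (rule cringI)
  show "abelian_group UV"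
    by (rule abelian_group_cong_structure[of T]) (simp_all add: tensor_abelian_group)
  show "comm_monoid UV"
  proof (rule comm_monoidI)
    fix x y z assume xyz: "x \<in> carrier UV" "y \<in> carrier UV" "z \<in> carrier UV"
    show "x \<otimes>\<^bsub>UV\<^esub> y \<in> carrier UV" using mult_closed xyz by simp
    show "x \<otimes>\<^bsub>UV\<^esub> y \<otimes>\<^bsub>UV\<^esub> z = x \<otimes>\<^bsub>UV\<^esub> (y \<otimes>\<^bsub>UV\<^esub> z)" using mult_assoc xyz by simp
  next
    fix x y assume "x \<in> carrier UV" "y \<in> carrier UV"
    then show "x \<otimes>\<^bsub>UV\<^esub> y = y \<otimes>\<^bsub>UV\<^esub> x" using mult_comm[of x y] by simp
  next
    show "\<one>\<^bsub>UV\<^esub> \<in> carrier UV" by simp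
    show "\<one>\<^bsub>UV\<^esub> \<otimes>\<^bsub>UV\<^esub> x = x" if "x \<in> carrier UV" for x using mult_one that by simp
  qed
  show "(x \<oplus>\<^bsub>UV\<^esub> y) \<otimes>\<^bsub>UV\<^esub> z = x \<otimes>\<^bsub>UV\<^esub> z \<oplus>\<^bsub>UV\<^esub> y \<otimes>\<^bsub>UV\<^esub> z"
    if "x \<in> carrier UV" "y \<in> carrier UV" "z \<in> carrier UV" for x y z
    using mult_add_left that by simp
qed

lemma tensor_algebra_algebra: "algebra A UV"
proof (rule algebraI)
  show "cring A" ..
  show "cring UV" by (rule tensor_algebra_cring)
  show "(a \<odot>\<^bsub>UV\<^esub> x) \<otimes>\<^bsub>UV\<^esub> y = a \<odot>\<^bsub>UV\<^esub> (x \<otimes>\<^bsub>UV\<^esub> y)"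
    if "a \<in> carrier A" "x \<in> carrier UV" "y \<in> carrier UV" for a x y
    using that bilinear_map_smult_left[OF B.bimap_bilinear] by simp
qed (simp_all add: T.smult_l_distr T.smult_r_distr T.smult_assoc1)

lemma tensor_algebra_mult_grade:
  assumes "z \<in> Tg p" "w \<in> Tg q"
  shows "z \<otimes>\<^bsub>UV\<^esub> w \<in> Tg (p + q)"
  unfolding tensor_algebra_simps
  by (rule B.bimap_grade[OF submodule_family_pair_axioms submodule_family_pair_axioms submodule_family_pair_axioms
        UA.mult_grade VA.mult_grade assms])

text \<open>Degree p + q = 0 forces both factors into the image of A, and (a 1) \<otimes> (b 1) = (b
  a) (1 \<otimes> 1).\<close>

lemma tensor_grade_zero:
  assumes "z \<in> Tg 0"
  shows "\<exists>a \<in> carrier A. z = a \<odot>\<^bsub>T\<^esub> pt \<one>\<^bsub>U\<^esub> \<one>\<^bsub>V\<^esub>"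
  using assms
proof (induction rule: tensor_grading_induct)
  case (pure x y p q)
  then have "x \<in> (\<lambda>a. a \<odot>\<^bsub>U\<^esub> \<one>\<^bsub>U\<^esub>) ` carrier A" "y \<in> (\<lambda>a. a \<odot>\<^bsub>V\<^esub> \<one>\<^bsub>V\<^esub>) ` carrier A"
    using bij_betw_imp_surj_on[OF UA.grade_zero] bij_betw_imp_surj_on[OF VA.grade_zero] by auto
  then obtain a b where ab: "a \<in> carrier A" "b \<in> carrier A" "x = a \<odot>\<^bsub>U\<^esub> \<one>\<^bsub>U\<^esub>" "y = b \<odot>\<^bsub>V\<^esub> \<one>\<^bsub>V\<^esub>"
    by blast
  then have "pt x y = (b \<otimes> a) \<odot>\<^bsub>T\<^esub> pt \<one>\<^bsub>U\<^esub> \<one>\<^bsub>V\<^esub>"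
    by (simp add: smult_pure UA.smult_assoc1 flip: pure_smult)
  then show ?case using ab by blast
next
  case (add z z')
  then obtain a b where "a \<in> carrier A" "b \<in> carrier A"
    "z = a \<odot>\<^bsub>T\<^esub> pt \<one>\<^bsub>U\<^esub> \<one>\<^bsub>V\<^esub>" "z' = b \<odot>\<^bsub>T\<^esub> pt \<one>\<^bsub>U\<^esub> \<one>\<^bsub>V\<^esub>" by blast
  then have "z \<oplus>\<^bsub>T\<^esub> z' = (a \<oplus> b) \<odot>\<^bsub>T\<^esub> pt \<one>\<^bsub>U\<^esub> \<one>\<^bsub>V\<^esub>" by (simp add: T.smult_l_distr)
  then show ?case using \<open>a \<in> carrier A\<close> \<open>b \<in> carrier A\<close> by blast
qed

text \<open>Projecting \<open>V\<close> onto \<open>V\<^sub>0 = A\<close> gives a map \<open>U \<otimes> V \<rightarrow> U\<close> that maps \<open>a (1 \<otimes> 1)\<close> to \<open>a 1\<close>.\<close>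

lemma smult_one_inj:
  assumes "a \<in> carrier A" "b \<in> carrier A" "a \<odot>\<^bsub>T\<^esub> pt \<one>\<^bsub>U\<^esub> \<one>\<^bsub>V\<^esub> = b \<odot>\<^bsub>T\<^esub> pt \<one>\<^bsub>U\<^esub> \<one>\<^bsub>V\<^esub>"
  shows "a = b"
proof -
  define s where "s = (\<lambda>a. a \<odot>\<^bsub>V\<^esub> \<one>\<^bsub>V\<^esub>)"
  \<comment> \<open>\<open>r v\<close> is the scalar of the degree zero part of v, read off through
    the bijection A \<rightarrow> V_0. The announced map is u \<otimes> v \<mapsto> r(v) u.\<close>
  define r where "r = (\<lambda>v. the_inv_into (carrier A) s (component V Vg 0 v))"
  have bij: "bij_betw s (carrier A) (Vg 0)" using VA.grade_zero by (simp add: s_def)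
  have r_eq: "r v = a" if "a \<in> carrier A" "component V Vg 0 v = s a" for a v
    using that bij by (simp add: r_def the_inv_into_f_f bij_betw_def)
  have rs: "r v \<in> carrier A" "component V Vg 0 v = s (r v)" if v: "v \<in> carrier V" for v
  proof -
    have "component V Vg 0 v \<in> s ` carrier A"
      using bij VD.component_grade[OF v] by (auto simp: bij_betw_def)
    then obtain a where "a \<in> carrier A" "component V Vg 0 v = s a" by blast
    then show "r v \<in> carrier A" "component V Vg 0 v = s (r v)" using r_eq by auto
  qed
  have r_add: "r (v \<oplus>\<^bsub>V\<^esub> v') = r v \<oplus> r v'" if "v \<in> carrier V" "v' \<in> carrier V" for v v'
    using that rs[of v] rs[of v'] additive_map_add[OF VD.component_additive]
    by (intro r_eq) (simp_all add: s_def VA.smult_l_distr)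
  have r_smult: "r (a \<odot>\<^bsub>V\<^esub> v) = a \<otimes> r v" if "a \<in> carrier A" "v \<in> carrier V" for a v
    using that rs[of v] linear_map_smult[OF component_linear_N]
    by (intro r_eq) (simp_all add: s_def VA.smult_assoc1)
  have b: "bilinear_map A U V U (\<lambda>u v. r v \<odot>\<^bsub>U\<^esub> u)"
    by (rule bilinear_mapI)
      (simp_all add: rs r_add r_smult UA.smult_l_distr UA.smult_r_distr UA.R.m_comm flip: UA.smult_assoc1)
  let ?l = "tensor_lift (add_monoid U) (\<lambda>u v. r v \<odot>\<^bsub>U\<^esub> u)"
  have "?l (a \<odot>\<^bsub>T\<^esub> pt \<one>\<^bsub>U\<^esub> \<one>\<^bsub>V\<^esub>) = a \<odot>\<^bsub>U\<^esub> \<one>\<^bsub>U\<^esub>" if a: "a \<in> carrier A" for a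
  proof -
    have "component V Vg 0 \<one>\<^bsub>V\<^esub> = s \<one>"
      using VA.one_grade by (simp add: VD.component_homogeneous s_def)
    then have r1: "r \<one>\<^bsub>V\<^esub> = \<one>" by (intro r_eq) auto
    have "?l (a \<odot>\<^bsub>T\<^esub> pt \<one>\<^bsub>U\<^esub> \<one>\<^bsub>V\<^esub>) = ?l (pt (a \<odot>\<^bsub>U\<^esub> \<one>\<^bsub>U\<^esub>) \<one>\<^bsub>V\<^esub>)" using a by (simp add: smult_pure)
    also have "\<dots> = a \<odot>\<^bsub>U\<^esub> \<one>\<^bsub>U\<^esub>"
      using tensor_lift_bilinear_pure[OF UA.module_axioms b] a by (simp add: r1)
    finally show ?thesis .
  qed
  then have "a \<odot>\<^bsub>U\<^esub> \<one>\<^bsub>U\<^esub> = b \<odot>\<^bsub>U\<^esub> \<one>\<^bsub>U\<^esub>" using assms by metis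
  then show ?thesis using assms UA.grade_zero by (auto simp: bij_betw_def dest: inj_onD)
qed

text \<open>Here u \<otimes> v = (u \<otimes> 1)(1 \<otimes> v), and u \<mapsto> u \<otimes> 1 and v
  \<mapsto> 1 \<otimes> v respect sums, negatives and products and send scalars to scalars and
  degree one to degree one. So generation passes from U and V to the tensor product.\<close>

lemma tensor_algebra_generated:
  "carrier UV = generate_ring UV ((\<lambda>a. a \<odot>\<^bsub>UV\<^esub> \<one>\<^bsub>UV\<^esub>) ` carrier A \<union> Tg 1)"
  (is "_ = generate_ring UV ?H")
proof
  interpret W: cring UV by (rule tensor_algebra_cring)
  let ?G = "generate_ring UV ?H"
  \<comment> \<open>\<open>generate_ring\<close> negates in the record of the algebra, the tensor
    lemmas in that of the module; the additive group is the same.\<close>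
  have neg: "\<ominus>\<^bsub>UV\<^esub> z = \<ominus>\<^bsub>T\<^esub> z" for z
    using a_inv_cong_structure[of UV T] by simp
  show "?G \<subseteq> carrier UV"
    by (rule W.generate_ring_incl) (auto intro: tensor_grading_carrier)
  note mp = mult_pure[unfolded tensor_algebra_simps]
  note gen_add = generate_ring.eng_add[of _ UV, unfolded tensor_algebra_simps]
  note gen_mult = generate_ring.eng_mult[of _ UV, unfolded tensor_algebra_simps]
  note gen_neg = generate_ring.a_inv[of _ UV, unfolded neg]
  have scalar: "a \<odot>\<^bsub>T\<^esub> pt \<one>\<^bsub>U\<^esub> \<one>\<^bsub>V\<^esub> \<in> ?G" if "a \<in> carrier A" for a
    using that by (intro generate_ring.incl) simp
  have left: "pt u \<one>\<^bsub>V\<^esub> \<in> ?G" if "u \<in> carrier U" for u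
  proof -
    let ?HU = "(\<lambda>a. a \<odot>\<^bsub>U\<^esub> \<one>\<^bsub>U\<^esub>) ` carrier A \<union> Ug 1"
    have gU: "h \<in> carrier U" if "h \<in> generate_ring U ?HU" for h
      using that UA.generated by blast
    have "u \<in> generate_ring U ?HU" using that UA.generated by blast
    then show ?thesis
    proof induction
      case one
      show ?case using generate_ring.one[of UV ?H] by (simp only: tensor_algebra_simps)
    next
      case (incl h)
      then show ?case
      proof
        assume "h \<in> (\<lambda>a. a \<odot>\<^bsub>U\<^esub> \<one>\<^bsub>U\<^esub>) ` carrier A"
        then obtain a where "a \<in> carrier A" "h = a \<odot>\<^bsub>U\<^esub> \<one>\<^bsub>U\<^esub>" by blast
        then show ?thesis using scalar[of a] by (simp only: smult_pure UA.one_closed VA.one_closed)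
      next
        assume h: "h \<in> Ug 1"
        then have "pt h \<one>\<^bsub>V\<^esub> \<in> Tg (1 + 0)" by (intro pure_grade VA.one_grade)
        then show ?thesis by (intro generate_ring.incl UnI2) (simp only: add_0_right)
      qed
    next
      case (a_inv h)
      have "pt (\<ominus>\<^bsub>U\<^esub> h) \<one>\<^bsub>V\<^esub> = \<ominus>\<^bsub>T\<^esub> pt h \<one>\<^bsub>V\<^esub>" using gU[OF a_inv(1)] by (simp add: pure_minus)
      then show ?case using gen_neg[OF a_inv(2)] by (simp only:)
    next
      case (eng_add h k)
      have "pt (h \<oplus>\<^bsub>U\<^esub> k) \<one>\<^bsub>V\<^esub> = pt h \<one>\<^bsub>V\<^esub> \<oplus>\<^bsub>T\<^esub> pt k \<one>\<^bsub>V\<^esub>"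
        using gU eng_add(1,2) by (simp add: pure_add_left)
      then show ?case using gen_add[OF eng_add(3,4)] by (simp only:)
    next
      case (eng_mult h k)
      have "tensor_bimap A U V (\<otimes>\<^bsub>U\<^esub>) (\<otimes>\<^bsub>V\<^esub>) (pt h \<one>\<^bsub>V\<^esub>) (pt k \<one>\<^bsub>V\<^esub>) = pt (h \<otimes>\<^bsub>U\<^esub> k) \<one>\<^bsub>V\<^esub>"
        using gU eng_mult(1,2) by (simp add: mp)
      then show ?case using gen_mult[OF eng_mult(3,4)] by (simp only:)
    qed
  qed
  have right: "pt \<one>\<^bsub>U\<^esub> v \<in> ?G" if "v \<in> carrier V" for v
  proof -
    let ?HV = "(\<lambda>a. a \<odot>\<^bsub>V\<^esub> \<one>\<^bsub>V\<^esub>) ` carrier A \<union> Vg 1"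
    have gV: "h \<in> carrier V" if "h \<in> generate_ring V ?HV" for h
      using that VA.generated by blast
    have "v \<in> generate_ring V ?HV" using that VA.generated by blast
    then show ?thesis
    proof induction
      case one
      show ?case using generate_ring.one[of UV ?H] by (simp only: tensor_algebra_simps)
    next
      case (incl h)
      then show ?case
      proof
        assume "h \<in> (\<lambda>a. a \<odot>\<^bsub>V\<^esub> \<one>\<^bsub>V\<^esub>) ` carrier A"
        then obtain a where "a \<in> carrier A" "h = a \<odot>\<^bsub>V\<^esub> \<one>\<^bsub>V\<^esub>" by blast
        then show ?thesis using scalar[of a] by (simp only: smult_pure_right UA.one_closed VA.one_closed)
      next
        assume h: "h \<in> Vg 1"
        then have "pt \<one>\<^bsub>U\<^esub> h \<in> Tg (0 + 1)" by (intro pure_grade UA.one_grade)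
        then show ?thesis by (intro generate_ring.incl UnI2) (simp only: add_0)
      qed
    next
      case (a_inv h)
      have "pt \<one>\<^bsub>U\<^esub> (\<ominus>\<^bsub>V\<^esub> h) = \<ominus>\<^bsub>T\<^esub> pt \<one>\<^bsub>U\<^esub> h" 
        using additive_minus[OF VA.abelian_group_axioms tensor_abelian_group
            additive_pure_right[OF UA.one_closed] gV[OF a_inv(1)]] .
      then show ?case using gen_neg[OF a_inv(2)] by (simp only:)
    next
      case (eng_add h k)
      have "pt \<one>\<^bsub>U\<^esub> (h \<oplus>\<^bsub>V\<^esub> k) = pt \<one>\<^bsub>U\<^esub> h \<oplus>\<^bsub>T\<^esub> pt \<one>\<^bsub>U\<^esub> k"
        using gV eng_add(1,2) by (simp add: pure_add_right)
      then show ?case using gen_add[OF eng_add(3,4)] by (simp only:)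
    next
      case (eng_mult h k)
      have "tensor_bimap A U V (\<otimes>\<^bsub>U\<^esub>) (\<otimes>\<^bsub>V\<^esub>) (pt \<one>\<^bsub>U\<^esub> h) (pt \<one>\<^bsub>U\<^esub> k) = pt \<one>\<^bsub>U\<^esub> (h \<otimes>\<^bsub>V\<^esub> k)"
        using gV eng_mult(1,2) by (simp add: mp)
      then show ?case using gen_mult[OF eng_mult(3,4)] by (simp only:)
    qed
  qed
  show "carrier UV \<subseteq> ?G"
  proof
    fix z assume "z \<in> carrier UV"
    then have "z \<in> carrier T" by simp
    then show "z \<in> ?G"
    proof (induction rule: tensor_induct)
      case (pure u v)
      then have "tensor_bimap A U V (\<otimes>\<^bsub>U\<^esub>) (\<otimes>\<^bsub>V\<^esub>) (pt u \<one>\<^bsub>V\<^esub>) (pt \<one>\<^bsub>U\<^esub> v) = pt u v" by (simp add: mp)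
      then show ?case using gen_mult[OF left[OF pure(1)] right[OF pure(2)]] by (simp only:)
    next
      case (add z z')
      then show ?case by (intro gen_add)
    qed
  qed
qed

lemma tensor_algebra_standard: "standard_algebra A UV Tg"
proof (intro standard_algebra.intro graded_algebra.intro tensor_algebra_algebra
    graded_algebra_axioms.intro standard_algebra_axioms.intro tensor_algebra_generated)
  show "internal_direct_sum UV Tg"
    using tensor_direct_sum by (subst internal_direct_sum_cong_structure[of _ T]) simp_all
  show "submodule (Tg n) A UV" for n
    using tensor_grading_submodule[of n] by (simp add: submodule_def submodule_axioms_def)
  show "\<one>\<^bsub>UV\<^esub> \<in> Tg 0" using pure_grade[OF UA.one_grade VA.one_grade] by simp
  show "z \<otimes>\<^bsub>UV\<^esub> w \<in> Tg (p + q)" if "z \<in> Tg p" "w \<in> Tg q" for z w p q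
    using tensor_algebra_mult_grade that .
  show "bij_betw (\<lambda>a. a \<odot>\<^bsub>UV\<^esub> \<one>\<^bsub>UV\<^esub>) (carrier A) (Tg 0)"
    unfolding tensor_algebra_simps bij_betw_def
    using tensor_grade_zero smult_one_inj pure_grade[OF UA.one_grade VA.one_grade]
      submodule.smult_closed[OF tensor_grading_submodule]
    by (auto intro!: inj_onI)
qed

end

section \<open>The tensor product of two standard modules\<close>

locale standard_module_over_algebra = UA: standard_algebra A U Ug + FM: standard_module U Ug F Fg
  for A :: "('a, 'r) ring_scheme" (structure)
    and U :: "('a, 'u, 's) module_scheme" and Ug :: "nat \<Rightarrow> 'u set"
    and F :: "('u, 'f, 'p) module_scheme" and Fg :: "nat \<Rightarrow> 'f set"
begin

abbreviation "F' \<equiv> restrict_scalars U F"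

lemma restricted_module: "module A F'"
  by (intro restrict_scalars_module UA.algebra_axioms FM.module_axioms)

lemma action_bilinear: "bilinear_map A U F' F' (\<odot>\<^bsub>F\<^esub>)"
  by (intro restrict_scalars_bilinear UA.algebra_axioms FM.module_axioms)

sublocale FD: direct_sum F Fg
  by (intro direct_sum.intro direct_sum_axioms.intro FM.grading FM.M.abelian_group_axioms)

lemma restricted_direct_sum: "direct_sum F' Fg"
proof (intro direct_sum.intro direct_sum_axioms.intro)
  show "abelian_group F'" using restricted_module by (rule module.axioms)
  show "internal_direct_sum F' Fg"
    using FM.grading by (subst internal_direct_sum_cong_structure[of _ F]) simp_all
qed

lemma restricted_submodule: "submodule (Fg n) A F'"
proof (intro submodule.intro submodule_axioms.intro)
  show "subgroup (Fg n) (add_monoid F')"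
    using FD.grade_subgroup by (subst subgroup_cong_structure[of _ F]) simp_all
  show "a \<odot>\<^bsub>F'\<^esub> x \<in> Fg n" if "a \<in> carrier A" "x \<in> Fg n" for a x
    using FM.smult_grade[OF UA.smult_one_grade[OF that(1)] that(2)] by simp
qed

sublocale UD: direct_sum U Ug by (rule UA.graded_direct_sum)

lemma grade_smult_induct [consumes 1, case_names smult add]:
  assumes z: "z \<in> Fg n" and smult: "\<And>u x. u \<in> Ug n \<Longrightarrow> x \<in> Fg 0 \<Longrightarrow> Q (u \<odot>\<^bsub>F\<^esub> x)"
    and add: "\<And>z z'. z \<in> carrier F \<Longrightarrow> z' \<in> carrier F \<Longrightarrow> Q z \<Longrightarrow> Q z' \<Longrightarrow> Q (z \<oplus>\<^bsub>F\<^esub> z')"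
  shows "Q z"
proof -
  let ?S = "{u \<odot>\<^bsub>F\<^esub> x | u x. u \<in> Ug n \<and> x \<in> Fg 0}"
  have "z \<in> generate (add_monoid F) ?S"
    using z FM.generated[of n] by (simp add: smult_span_def)
  moreover have "?S \<subseteq> carrier F"
    using UD.grade_carrier FD.grade_carrier by (auto intro!: FM.smult_closed)
  ultimately show ?thesis
  proof (induction rule: FM.M.span_induct)
    case (neg s)
    then obtain u x where s: "s = u \<odot>\<^bsub>F\<^esub> x" "u \<in> Ug n" "x \<in> Fg 0" by blast
    then have "\<ominus>\<^bsub>F\<^esub> s = (\<ominus>\<^bsub>U\<^esub> u) \<odot>\<^bsub>F\<^esub> x"
      using UD.grade_carrier FD.grade_carrier by (simp add: FM.smult_l_minus)
    then show ?case using s UA.subgroup_neg[OF UD.grade_subgroup] by blast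
  next
    case zero
    have "\<zero>\<^bsub>U\<^esub> \<odot>\<^bsub>F\<^esub> \<zero>\<^bsub>F\<^esub> = \<zero>\<^bsub>F\<^esub>" by simp
    then show ?case
      using smult[OF UA.subgroup_zero[OF UD.grade_subgroup] FM.M.subgroup_zero[OF FD.grade_subgroup]] by metis
  next
    case (incl s)
    then show ?case using smult by blast
  qed (rule add)
qed

end

locale standard_module_pair =
  FU: standard_module_over_algebra A U Ug F Fg + GV: standard_module_over_algebra A V Vg G Gg
  for A :: "('a, 'r) ring_scheme" (structure)
    and U :: "('a, 'u, 's) module_scheme" and Ug :: "nat \<Rightarrow> 'u set"
    and F :: "('u, 'f, 'p) module_scheme" and Fg :: "nat \<Rightarrow> 'f set"
    and V :: "('a, 'v, 't) module_scheme" and Vg :: "nat \<Rightarrow> 'v set"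
    and G :: "('v, 'g, 'q) module_scheme" and Gg :: "nat \<Rightarrow> 'g set"
begin

sublocale W: standard_algebra_pair A U Ug V Vg ..

abbreviation "F' \<equiv> restrict_scalars U F"
abbreviation "G' \<equiv> restrict_scalars V G"

sublocale X: graded_pair A F' G' Fg Gg
  by (intro graded_pair.intro submodule_family_pair.intro module_pair.intro submodule_family_pair_axioms.intro
      FU.restricted_module GV.restricted_module FU.restricted_direct_sum GV.restricted_direct_sum
      FU.restricted_submodule GV.restricted_submodule)

sublocale C: module_pair_bimap A U V F' G' F' G' "(\<odot>\<^bsub>F\<^esub>)" "(\<odot>\<^bsub>G\<^esub>)"
  by (intro module_pair_bimap.intro module_pair_bimap_axioms.intro W.module_pair_axioms
      X.module_pair_axioms FU.action_bilinear GV.action_bilinear)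

abbreviation "FG \<equiv> tensor_module_over A U V F G"

lemma tensor_module_over_simps [simp]:
  "carrier FG = carrier X.T" "ring.add FG = ring.add X.T" "ring.zero FG = ring.zero X.T"
  "smult FG = tensor_bimap A F' G' (\<odot>\<^bsub>F\<^esub>) (\<odot>\<^bsub>G\<^esub>)"
  by (auto simp: tensor_module_over_def tensor_bimap_def Let_def fun_eq_iff)

lemma act_closed: "w \<in> carrier W.T \<Longrightarrow> z \<in> carrier X.T \<Longrightarrow> w \<odot>\<^bsub>FG\<^esub> z \<in> carrier X.T"
  using bilinear_map_closed[OF C.bimap_bilinear] by simp

lemma act_add_left:
  "w \<in> carrier W.T \<Longrightarrow> w' \<in> carrier W.T \<Longrightarrow> z \<in> carrier X.T \<Longrightarrow>
    (w \<oplus>\<^bsub>W.T\<^esub> w') \<odot>\<^bsub>FG\<^esub> z = w \<odot>\<^bsub>FG\<^esub> z \<oplus>\<^bsub>X.T\<^esub> w' \<odot>\<^bsub>FG\<^esub> z"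
  using bilinear_map_add_left[OF C.bimap_bilinear] by simp

lemma act_add_right:
  "w \<in> carrier W.T \<Longrightarrow> z \<in> carrier X.T \<Longrightarrow> z' \<in> carrier X.T \<Longrightarrow>
    w \<odot>\<^bsub>FG\<^esub> (z \<oplus>\<^bsub>X.T\<^esub> z') = w \<odot>\<^bsub>FG\<^esub> z \<oplus>\<^bsub>X.T\<^esub> w \<odot>\<^bsub>FG\<^esub> z'"
  using bilinear_map_add_right[OF C.bimap_bilinear] by simp

lemma act_pure:
  "u \<in> carrier U \<Longrightarrow> v \<in> carrier V \<Longrightarrow> x \<in> carrier F \<Longrightarrow> y \<in> carrier G \<Longrightarrow>
    W.pt u v \<odot>\<^bsub>FG\<^esub> X.pt x y = X.pt (u \<odot>\<^bsub>F\<^esub> x) (v \<odot>\<^bsub>G\<^esub> y)"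
  by (simp add: C.bimap_pure)

lemma act_assoc:
  assumes "w \<in> carrier W.T" "w' \<in> carrier W.T" "z \<in> carrier X.T"
  shows "(w \<otimes>\<^bsub>W.UV\<^esub> w') \<odot>\<^bsub>FG\<^esub> z = w \<odot>\<^bsub>FG\<^esub> (w' \<odot>\<^bsub>FG\<^esub> z)"
  using assms(1)
proof (induction rule: W.tensor_induct)
  case p1: (pure u v)
  from assms(2) show ?case
  proof (induction rule: W.tensor_induct)
    case p2: (pure u' v')
    from assms(3) show ?case
    proof (induction rule: X.tensor_induct)
      case (pure x y)
      then show ?case using p1 p2
        by (simp add: W.mult_pure act_pure FU.FM.smult_assoc1 GV.FM.smult_assoc1
            del: tensor_module_over_simps W.tensor_algebra_simps)
    qed (use p1 p2 in \<open>simp_all add: W.mult_pure act_closed act_add_right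
        del: tensor_module_over_simps W.tensor_algebra_simps\<close>)
  qed (use assms(3) p1 in \<open>simp_all add: W.mult_closed W.mult_add_right act_closed act_add_left act_add_right
        del: tensor_module_over_simps W.tensor_algebra_simps\<close>)
qed (use assms(2,3) in \<open>simp_all add: W.mult_closed W.mult_add_left act_closed act_add_left
        del: tensor_module_over_simps W.tensor_algebra_simps\<close>)

lemma act_one:
  assumes "z \<in> carrier X.T"
  shows "W.pt \<one>\<^bsub>U\<^esub> \<one>\<^bsub>V\<^esub> \<odot>\<^bsub>FG\<^esub> z = z"
  using assms
proof (induction rule: X.tensor_induct)
  case (pure x y)
  then show ?case by (simp add: act_pure del: tensor_module_over_simps)
qed (simp add: act_add_right del: tensor_module_over_simps)

lemma tensor_module_over_module: "module W.UV FG"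
proof (rule moduleI)
  show "cring W.UV" by (rule W.tensor_algebra_cring)
  show "abelian_group FG"
    by (rule abelian_group_cong_structure[of X.T]) (simp_all add: X.tensor_abelian_group)
  show "w \<odot>\<^bsub>FG\<^esub> z \<in> carrier FG" if "w \<in> carrier W.UV" "z \<in> carrier FG" for w z
    using act_closed that by simp
  show "(w \<oplus>\<^bsub>W.UV\<^esub> w') \<odot>\<^bsub>FG\<^esub> z = w \<odot>\<^bsub>FG\<^esub> z \<oplus>\<^bsub>FG\<^esub> w' \<odot>\<^bsub>FG\<^esub> z"
    if "w \<in> carrier W.UV" "w' \<in> carrier W.UV" "z \<in> carrier FG" for w w' z
    using act_add_left that by simp
  show "w \<odot>\<^bsub>FG\<^esub> (z \<oplus>\<^bsub>FG\<^esub> z') = w \<odot>\<^bsub>FG\<^esub> z \<oplus>\<^bsub>FG\<^esub> w \<odot>\<^bsub>FG\<^esub> z'"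
    if "w \<in> carrier W.UV" "z \<in> carrier FG" "z' \<in> carrier FG" for w z z'
    using act_add_right that by simp
  show "(w \<otimes>\<^bsub>W.UV\<^esub> w') \<odot>\<^bsub>FG\<^esub> z = w \<odot>\<^bsub>FG\<^esub> (w' \<odot>\<^bsub>FG\<^esub> z)"
    if "w \<in> carrier W.UV" "w' \<in> carrier W.UV" "z \<in> carrier FG" for w w' z
    using act_assoc that by simp
  show "\<one>\<^bsub>W.UV\<^esub> \<odot>\<^bsub>FG\<^esub> z = z" if "z \<in> carrier FG" for z
    using act_one that by simp
qed

lemma act_grade:
  assumes "w \<in> W.Tg p" "z \<in> X.Tg q"
  shows "w \<odot>\<^bsub>FG\<^esub> z \<in> X.Tg (p + q)"
  unfolding tensor_module_over_simps
  by (rule C.bimap_grade[OF W.submodule_family_pair_axioms X.submodule_family_pair_axioms X.submodule_family_pair_axioms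
        FU.FM.smult_grade GV.FM.smult_grade assms])

text \<open>With x = u x_0 in F_p and y = v y_0 in G_q one has x \<otimes> y = (u \<otimes> v)(x_0
  \<otimes> y_0), and u \<otimes> v has degree p + q. General x and y are sums of such
  products.\<close>

lemma tensor_module_generated: "X.Tg n = smult_span FG (W.Tg n) (X.Tg 0)"
proof
  interpret M: module W.UV FG by (rule tensor_module_over_module)
  let ?S = "{w \<odot>\<^bsub>FG\<^esub> z | w z. w \<in> W.Tg n \<and> z \<in> X.Tg 0}"
  have span: "smult_span FG (W.Tg n) (X.Tg 0) = generate (add_monoid X.T) ?S"
    unfolding smult_span_def by (rule span_cong_structure) simp_all
  have SG: "?S \<subseteq> X.Tg n" using act_grade[of _ n _ 0] by auto
  then show "smult_span FG (W.Tg n) (X.Tg 0) \<subseteq> X.Tg n"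
    unfolding span by (rule X.T.span_subset[OF _ X.tensor_grading_subgroup])
  have "?S \<subseteq> carrier X.T" using SG X.tensor_grading_carrier by blast
  then have sub: "subgroup (generate (add_monoid X.T) ?S) (add_monoid X.T)" (is "subgroup ?H _")
    by (rule X.T.span_subgroup)
  note Hadd = X.T.subgroup_add[OF sub]
  show "X.Tg n \<subseteq> smult_span FG (W.Tg n) (X.Tg 0)"
    unfolding span
  proof
    fix z assume "z \<in> X.Tg n"
    then show "z \<in> ?H"
    proof (induction rule: X.tensor_grading_induct)
      case (pure x y p q)
      have yc: "y \<in> carrier G" using pure GV.FD.grade_carrier by blast
      from \<open>x \<in> Fg p\<close> show ?case
      proof (induction rule: FU.grade_smult_induct)
        case (smult u x0)
        have uc: "u \<in> carrier U" "x0 \<in> carrier F"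
          using smult FU.UD.grade_carrier FU.FD.grade_carrier by auto
        from \<open>y \<in> Gg q\<close> show ?case
        proof (induction rule: GV.grade_smult_induct)
          case (smult v y0)
          have vc: "v \<in> carrier V" "y0 \<in> carrier G"
            using smult GV.UD.grade_carrier GV.FD.grade_carrier by auto
          have "X.pt (u \<odot>\<^bsub>F\<^esub> x0) (v \<odot>\<^bsub>G\<^esub> y0) = W.pt u v \<odot>\<^bsub>FG\<^esub> X.pt x0 y0"
            using uc vc by (simp add: act_pure del: tensor_module_over_simps)
          moreover have "W.pt u v \<in> W.Tg n"
            using W.pure_grade \<open>u \<in> Ug p\<close> \<open>v \<in> Vg q\<close> \<open>p + q = n\<close> by metis
          moreover have "X.pt x0 y0 \<in> X.Tg 0"
            using X.pure_grade[OF \<open>x0 \<in> Fg 0\<close> \<open>y0 \<in> Gg 0\<close>] by simp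
          ultimately show ?case by (intro X.T.span_incl) blast
        next
          case (add z z')
          then show ?case using X.pure_add_right[of "u \<odot>\<^bsub>F\<^esub> x0" z z'] uc Hadd by simp
        qed
      next
        case (add z z')
        then show ?case using X.pure_add_left[of z z' y] yc Hadd by simp
      qed
    qed (rule Hadd)
  qed
qed

lemma tensor_module_standard: "standard_module W.UV W.Tg FG X.Tg"
proof (intro standard_module.intro graded_module.intro tensor_module_over_module
    graded_module_axioms.intro standard_module_axioms.intro tensor_module_generated act_grade)
  show "internal_direct_sum FG X.Tg"
    using X.tensor_direct_sum by (subst internal_direct_sum_cong_structure[of _ X.T]) simp_all
qed

end

section \<open>The ring of indexed polynomials\<close>

text \<open>Makes the convolution in \<open>indexed_poly_ring\<close> a finite sum. A submultiset of
  \<open>add_mset x k\<close> either avoids x, and then lies in k, or is a submultiset of k with x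
  added.\<close>

lemma finite_submultisets: "finite {i. i \<subseteq># k}"
proof (induction k)
  case empty
  then show ?case by simp
next
  case (add x k)
  have "{i. i \<subseteq># add_mset x k} \<subseteq> {i. i \<subseteq># k} \<union> add_mset x ` {i. i \<subseteq># k}"
  proof
    fix i assume i: "i \<in> {i. i \<subseteq># add_mset x k}"
    show "i \<in> {i. i \<subseteq># k} \<union> add_mset x ` {i. i \<subseteq># k}"
    proof (cases "x \<in># i")
      case True
      then obtain j where "i = add_mset x j" by (meson mset_add)
      then show ?thesis using i by simp
    next
      case False
      have "count i a \<le> count k a" for a
        using i False mset_subset_eq_count[of i "add_mset x k" a] by (cases "a = x") (auto simp: not_in_iff)
      then have "i \<subseteq># k" by (simp add: subseteq_mset_def)
      then show ?thesis by simp
    qed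
  qed
  then show ?case using add finite_subset by blast
qed

context cring
begin

abbreviation "ip I \<equiv> indexed_pset I (carrier R)"

lemma ip_carrier: "P \<in> ip I \<Longrightarrow> P k \<in> carrier R"
  using indexed_pset_in_carrier[of "carrier R" P I] by (simp add: carrier_coeff_def)

lemma ip_finite_support: "P \<in> ip I \<Longrightarrow> finite {k. P k \<noteq> \<zero>}"
proof (induction rule: indexed_pset.induct)
  case (indexed_const a)
  have "{k. indexed_const a k \<noteq> \<zero>} \<subseteq> {{#}}" by (auto simp: indexed_const_def)
  then show ?case using finite_subset by blast
next
  case (indexed_padd P Q)
  have "{k. indexed_padd P Q k \<noteq> \<zero>} \<subseteq> {k. P k \<noteq> \<zero>} \<union> {k. Q k \<noteq> \<zero>}" by (auto simp: indexed_padd_def)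
  then show ?case using indexed_padd finite_subset by blast
next
  case (indexed_pmult P i)
  have "{k. indexed_pmult P i k \<noteq> \<zero>} \<subseteq> add_mset i ` {k. P k \<noteq> \<zero>}"
  proof
    fix k assume "k \<in> {k. indexed_pmult P i k \<noteq> \<zero>}"
    then have "i \<in># k" "P (k - {#i#}) \<noteq> \<zero>" by (auto simp: indexed_pmult_def split: if_splits)
    then show "k \<in> add_mset i ` {k. P k \<noteq> \<zero>}" by (intro image_eqI[of _ _ "k - {#i#}"]) auto
  qed
  then show ?case using indexed_pmult finite_subset by blast
qed

lemma ip_support: "P \<in> ip I \<Longrightarrow> P k \<noteq> \<zero> \<Longrightarrow> set_mset k \<subseteq> I"
proof (induction arbitrary: k rule: indexed_pset.induct)
  case (indexed_const a)
  then show ?case by (auto simp: indexed_const_def split: if_splits)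
next
  case (indexed_padd P Q)
  then have "P k \<noteq> \<zero> \<or> Q k \<noteq> \<zero>" by (auto simp: indexed_padd_def)
  then show ?case using indexed_padd by blast
next
  case (indexed_pmult P i)
  then have "i \<in># k" "P (k - {#i#}) \<noteq> \<zero>" by (auto simp: indexed_pmult_def split: if_splits)
  moreover from this have "set_mset k = insert i (set_mset (k - {#i#}))"
    by (metis insert_DiffM set_mset_add_mset_insert)
  ultimately show ?case using indexed_pmult by simp
qed

text \<open>No constructor of \<open>indexed_pset\<close> scales or negates; the negatives in the
  polynomial ring arise from this closure with a = -1.\<close>

lemma ip_scale:
  fixes P :: "'i multiset \<Rightarrow> 'a"
  shows "P \<in> ip I \<Longrightarrow> a \<in> carrier R \<Longrightarrow> (\<lambda>k. a \<otimes> P k) \<in> ip I"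
proof (induction rule: indexed_pset.induct)
  case (indexed_const b)
  have "(\<lambda>k. a \<otimes> (indexed_const b :: 'i multiset \<Rightarrow> 'a) k) = indexed_const (a \<otimes> b)"
    using indexed_const by (auto simp: indexed_const_def fun_eq_iff)
  then show ?case using indexed_const by (simp add: indexed_pset.indexed_const)
next
  case (indexed_padd P Q)
  have "(\<lambda>k. a \<otimes> indexed_padd P Q k) = indexed_padd (\<lambda>k. a \<otimes> P k) (\<lambda>k. a \<otimes> Q k)"
    using ip_carrier[OF \<open>P \<in> ip I\<close>] ip_carrier[OF \<open>Q \<in> ip I\<close>] indexed_padd
    by (auto simp: indexed_padd_def fun_eq_iff r_distr)
  then show ?case using indexed_padd by (simp add: indexed_pset.indexed_padd)
next
  case (indexed_pmult P i)
  have "(\<lambda>k. a \<otimes> indexed_pmult P i k) = indexed_pmult (\<lambda>k. a \<otimes> P k) i"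
    using indexed_pmult by (auto simp: indexed_pmult_def fun_eq_iff)
  then show ?case using indexed_pmult by (simp add: indexed_pset.indexed_pmult)
qed

definition ip_mult :: "('i multiset \<Rightarrow> 'a) \<Rightarrow> ('i multiset \<Rightarrow> 'a) \<Rightarrow> 'i multiset \<Rightarrow> 'a" where
  "ip_mult P Q k = finsum R (\<lambda>i. P i \<otimes> Q (k - i)) {i. i \<subseteq># k}"

lemma indexed_poly_ring_simps [simp]:
  "carrier (indexed_poly_ring R I) = ip I" "monoid.mult (indexed_poly_ring R I) = ip_mult"
  "\<one>\<^bsub>indexed_poly_ring R I\<^esub> = indexed_const \<one>" "\<zero>\<^bsub>indexed_poly_ring R I\<^esub> = indexed_const \<zero>"
  "ring.add (indexed_poly_ring R I) = indexed_padd"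
  by (simp_all add: indexed_poly_ring_def ip_mult_def[abs_def])

text \<open>This and the next two lemmas compute a product whose left factor is one of the three
  constructors of \<open>indexed_pset\<close>. Closure and associativity then follow by induction on
  the left factor, instead of by reindexing iterated sums.\<close>

lemma ip_mult_const:
  assumes "a \<in> carrier R" "Q \<in> ip I"
  shows "ip_mult (indexed_const a) Q = (\<lambda>k. a \<otimes> Q k)"
proof
  fix k
  have "ip_mult (indexed_const a) Q k =
      finsum R (\<lambda>i. if {#} = i then a \<otimes> Q (k - i) else \<zero>) {i. i \<subseteq># k}"
    unfolding ip_mult_def using assms ip_carrier[OF assms(2)]
    by (intro finsum_cong') (auto simp: indexed_const_def)
  also have "\<dots> = a \<otimes> Q (k - {#})"
    using assms ip_carrier[OF assms(2)] by (intro add.finprod_singleton finite_submultisets) auto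
  finally show "ip_mult (indexed_const a) Q k = a \<otimes> Q k" by simp
qed

lemma ip_mult_padd:
  assumes "P \<in> ip I" "P' \<in> ip I" "Q \<in> ip I"
  shows "ip_mult (indexed_padd P P') Q = indexed_padd (ip_mult P Q) (ip_mult P' Q)"
proof
  fix k
  have "ip_mult (indexed_padd P P') Q k =
      finsum R (\<lambda>i. P i \<otimes> Q (k - i) \<oplus> P' i \<otimes> Q (k - i)) {i. i \<subseteq># k}"
    unfolding ip_mult_def using ip_carrier[OF assms(1)] ip_carrier[OF assms(2)] ip_carrier[OF assms(3)]
    by (intro finsum_cong') (auto simp: indexed_padd_def l_distr)
  also have "\<dots> = indexed_padd (ip_mult P Q) (ip_mult P' Q) k"
    using ip_carrier[OF assms(1)] ip_carrier[OF assms(2)] ip_carrier[OF assms(3)]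
    by (subst finsum_addf) (auto simp: indexed_padd_def ip_mult_def)
  finally show "ip_mult (indexed_padd P P') Q k = indexed_padd (ip_mult P Q) (ip_mult P' Q) k" .
qed

text \<open>The submultisets of k that contain m are those of k - m with m added; all others
  contribute zero.\<close>

lemma ip_mult_pmult:
  assumes "P \<in> ip I" "Q \<in> ip I"
  shows "ip_mult (indexed_pmult P m) Q = indexed_pmult (ip_mult P Q) m"
proof
  fix k
  show "ip_mult (indexed_pmult P m) Q k = indexed_pmult (ip_mult P Q) m k"
  proof (cases "m \<in># k")
    case False
    then have "ip_mult (indexed_pmult P m) Q k = finsum R (\<lambda>i. \<zero>) {i. i \<subseteq># k}"
      unfolding ip_mult_def using ip_carrier[OF assms(1)] ip_carrier[OF assms(2)]
      by (intro finsum_cong') (auto simp: indexed_pmult_def dest: mset_subset_eqD)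
    then show ?thesis using False by (simp add: indexed_pmult_def)
  next
    case True
    then obtain k' where k: "k = add_mset m k'" by (meson mset_add)
    have img: "{i. i \<subseteq># k \<and> m \<in># i} = add_mset m ` {i. i \<subseteq># k'}"
    proof (intro equalityI subsetI)
      fix i assume i: "i \<in> {i. i \<subseteq># k \<and> m \<in># i}"
      then obtain j where "i = add_mset m j" by (metis (lifting) mem_Collect_eq mset_add)
      then show "i \<in> add_mset m ` {i. i \<subseteq># k'}" using i k by simp
    qed (auto simp: k)
    have "ip_mult (indexed_pmult P m) Q k =
        finsum R (\<lambda>i. P (i - {#m#}) \<otimes> Q (k - i)) {i. i \<subseteq># k \<and> m \<in># i}"
      unfolding ip_mult_def using ip_carrier[OF assms(1)] ip_carrier[OF assms(2)] finite_submultisets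
      by (intro add.finprod_mono_neutral_cong_right) (auto simp: indexed_pmult_def)
    also have "\<dots> = finsum R (\<lambda>i. P i \<otimes> Q (k' - i)) {i. i \<subseteq># k'}"
      unfolding img using ip_carrier[OF assms(1)] ip_carrier[OF assms(2)]
      by (subst finsum_reindex) (auto simp: inj_on_def k)
    finally show ?thesis by (simp add: indexed_pmult_def ip_mult_def k)
  qed
qed

lemma ip_mult_closed: "P \<in> ip I \<Longrightarrow> Q \<in> ip I \<Longrightarrow> ip_mult P Q \<in> ip I"
  by (induction rule: indexed_pset.induct)
    (simp_all add: ip_mult_const ip_scale ip_mult_padd ip_mult_pmult indexed_pset.intros)

text \<open>Reindexing by i \<mapsto> k - i, an involution of the submultisets of k.\<close>

lemma ip_mult_comm:
  fixes P Q :: "'i multiset \<Rightarrow> 'a"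
  assumes "P \<in> ip I" "Q \<in> ip I"
  shows "ip_mult P Q = ip_mult Q P"
proof
  fix k :: "'i multiset"
  have img: "{i. i \<subseteq># k} = (\<lambda>i. k - i) ` {i. i \<subseteq># k}"
  proof (intro equalityI subsetI)
    fix i assume "i \<in> {i. i \<subseteq># k}"
    then have "i = k - (k - i)" by (simp add: multiset_eq_iff subseteq_mset_def)
    then show "i \<in> (\<lambda>i. k - i) ` {i. i \<subseteq># k}" by (intro image_eqI[of _ _ "k - i"]) auto
  qed auto
  have inj: "inj_on (\<lambda>i. k - i) {i. i \<subseteq># k}"
    by (rule inj_on_inverseI[of _ "\<lambda>i. k - i"]) (simp add: multiset_eq_iff subseteq_mset_def)
  have "ip_mult P Q k = finsum R (\<lambda>i. P i \<otimes> Q (k - i)) ((\<lambda>i. k - i) ` {i. i \<subseteq># k})"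
    using img by (simp add: ip_mult_def)
  also have "\<dots> = finsum R (\<lambda>i. P (k - i) \<otimes> Q (k - (k - i))) {i. i \<subseteq># k}"
    using ip_carrier[OF assms(1)] ip_carrier[OF assms(2)] by (intro finsum_reindex inj) auto
  also have "\<dots> = ip_mult Q P k"
    unfolding ip_mult_def
  proof (intro finsum_cong' refl)
    fix i assume "i \<in> {i. i \<subseteq># k}"
    then have "k - (k - i) = i" by (simp add: multiset_eq_iff subseteq_mset_def)
    then show "P (k - i) \<otimes> Q (k - (k - i)) = Q i \<otimes> P (k - i)"
      using ip_carrier[OF assms(1)] ip_carrier[OF assms(2)] by (simp add: m_comm)
  qed (use ip_carrier[OF assms(1)] ip_carrier[OF assms(2)] in auto)
  finally show "ip_mult P Q k = ip_mult Q P k" .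
qed

lemma ip_mult_assoc:
  "P \<in> ip I \<Longrightarrow> Q \<in> ip I \<Longrightarrow> S \<in> ip I \<Longrightarrow> ip_mult (ip_mult P Q) S = ip_mult P (ip_mult Q S)"
proof (induction rule: indexed_pset.induct)
  case (indexed_const a)
  have "ip_mult (\<lambda>k. a \<otimes> Q k) S k = a \<otimes> ip_mult Q S k" for k
    unfolding ip_mult_def using indexed_const(1) ip_carrier[OF indexed_const(2)] ip_carrier[OF indexed_const(3)]
    by (subst finsum_rdistr) (auto intro!: finsum_cong' simp: finite_submultisets m_assoc)
  then show ?case using indexed_const by (simp add: ip_mult_const[where I = I] ip_mult_closed fun_eq_iff)
next
  case (indexed_padd P P')
  then show ?case by (simp add: ip_mult_padd[where I = I] ip_mult_closed)
next
  case (indexed_pmult P i)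
  then show ?case by (simp add: ip_mult_pmult[where I = I] ip_mult_closed)
qed

lemma indexed_poly_cring: "cring (indexed_poly_ring R I)"
proof (rule cringI)
  show "abelian_group (indexed_poly_ring R I)"
  proof (rule abelian_groupI)
    fix P assume P: "P \<in> carrier (indexed_poly_ring R I)"
    show "\<exists>Q\<in>carrier (indexed_poly_ring R I). Q \<oplus>\<^bsub>indexed_poly_ring R I\<^esub> P = \<zero>\<^bsub>indexed_poly_ring R I\<^esub>"
    proof
      show "(\<lambda>k. (\<ominus> \<one>) \<otimes> P k) \<in> carrier (indexed_poly_ring R I)" using P by (simp add: ip_scale)
      have "(\<ominus> \<one>) \<otimes> P k \<oplus> P k = \<zero>" for k
        using P ip_carrier[of P I k] by (simp add: l_minus l_neg)
      then show "(\<lambda>k. (\<ominus> \<one>) \<otimes> P k) \<oplus>\<^bsub>indexed_poly_ring R I\<^esub> P = \<zero>\<^bsub>indexed_poly_ring R I\<^esub>"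
        by (simp add: indexed_padd_def indexed_const_def fun_eq_iff)
    qed
  qed (auto simp: indexed_pset.intros, auto simp: indexed_padd_def indexed_const_def fun_eq_iff ip_carrier a_ac)
  show "comm_monoid (indexed_poly_ring R I)"
  proof (rule comm_monoidI)
    fix P assume "P \<in> carrier (indexed_poly_ring R I)"
    then show "\<one>\<^bsub>indexed_poly_ring R I\<^esub> \<otimes>\<^bsub>indexed_poly_ring R I\<^esub> P = P"
      using ip_carrier[of P I] by (simp add: ip_mult_const[where I = I])
  next
    fix P Q assume "P \<in> carrier (indexed_poly_ring R I)" "Q \<in> carrier (indexed_poly_ring R I)"
    then show "P \<otimes>\<^bsub>indexed_poly_ring R I\<^esub> Q = Q \<otimes>\<^bsub>indexed_poly_ring R I\<^esub> P"
      by (simp add: ip_mult_comm[of P I Q])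
  qed (simp_all add: ip_mult_closed ip_mult_assoc[where I = I] indexed_pset.indexed_const)
qed (simp add: ip_mult_padd[where I = I])

lemma indexed_var_closed: "i \<in> I \<Longrightarrow> indexed_var i \<in> ip I"
  by (simp add: indexed_var_def indexed_pset.intros)

lemma indexed_pmult_var:
  assumes "P \<in> ip I" "i \<in> I"
  shows "indexed_pmult P i = ip_mult P (indexed_var i)"
proof -
  have "ip_mult P (indexed_var i) = ip_mult (indexed_var i) P"
    using assms by (intro ip_mult_comm indexed_var_closed)
  also have "\<dots> = indexed_pmult (ip_mult (indexed_const \<one>) P) i"
    unfolding indexed_var_def using assms by (intro ip_mult_pmult) (auto intro: indexed_pset.intros)
  also have "ip_mult (indexed_const \<one>) P = P"
    using assms(1) ip_carrier[OF assms(1)] by (simp add: ip_mult_const[where I = I])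
  finally show ?thesis ..
qed

text \<open>The monomial with exponent multiset k and coefficient a.\<close>

definition single :: "'i multiset \<Rightarrow> 'a \<Rightarrow> 'i multiset \<Rightarrow> 'a" where
  "single k a = (\<lambda>l. if l = k then a else \<zero>)"

lemma single_add_mset: "single (add_mset m k) a = indexed_pmult (single k a) m"
  by (auto simp: single_def indexed_pmult_def fun_eq_iff)

lemma single_closed: "a \<in> carrier R \<Longrightarrow> set_mset k \<subseteq> I \<Longrightarrow> single k a \<in> ip I"
proof (induction k)
  case empty
  then show ?case using indexed_pset.indexed_const[of a "carrier R" I]
    by (simp add: single_def indexed_const_def)
next
  case (add m k)
  then show ?case by (simp add: single_add_mset indexed_pset.indexed_pmult)
qed

text \<open>Induction over the constructors of \<open>indexed_pset\<close> would leave the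
  homogeneous polynomials, since the summands of a homogeneous sum need not be homogeneous. Removing
  one monomial at a time preserves the degree and lowers the size of the support.\<close>

lemma homogeneous_induct [consumes 2, case_names zero monomial]:
  assumes "P \<in> ip I" "\<forall>k. P k \<noteq> \<zero> \<longrightarrow> size k = n"
    and zero: "Q (indexed_const \<zero>)"
    and monomial: "\<And>P k a. P \<in> ip I \<Longrightarrow> \<forall>k. P k \<noteq> \<zero> \<longrightarrow> size k = n \<Longrightarrow> Q P \<Longrightarrow> a \<in> carrier R \<Longrightarrow>
      set_mset k \<subseteq> I \<Longrightarrow> size k = n \<Longrightarrow> Q (indexed_padd P (single k a))"
  shows "Q P"
  using assms(1,2)
proof (induction "card {k. P k \<noteq> \<zero>}" arbitrary: P)
  case 0
  then have "{k. P k \<noteq> \<zero>} = {}" using ip_finite_support[of P I] by simp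
  then have "P = indexed_const \<zero>" by (auto simp: indexed_const_def fun_eq_iff)
  then show ?case using zero by simp
next
  case (Suc c)
  then obtain k where k: "P k \<noteq> \<zero>" by (metis (mono_tags, lifting) card_eq_0_iff empty_Collect_eq nat.distinct(1))
  \<comment> \<open>Adding the negated monomial deletes k from the support and leaves all other
    coefficients as they are.\<close>
  let ?P' = "indexed_padd P (single k (\<ominus> P k))"
  have kI: "set_mset k \<subseteq> I" "size k = n" using k Suc ip_support by blast+
  have Pc: "P l \<in> carrier R" for l using Suc ip_carrier by blast
  have P'_eq: "?P' l = (if l = k then \<zero> else P l)" for l
    using Pc by (simp add: indexed_padd_def single_def r_neg)
  have P': "?P' \<in> ip I" using Suc kI Pc by (intro indexed_pset.indexed_padd single_closed) auto
  have hom: "\<forall>l. ?P' l \<noteq> \<zero> \<longrightarrow> size l = n" using Suc by (auto simp: P'_eq)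
  have "{l. ?P' l \<noteq> \<zero>} = {l. P l \<noteq> \<zero>} - {k}" by (auto simp: P'_eq)
  then have "card {l. ?P' l \<noteq> \<zero>} = c"
    using Suc(2) k by simp
  then have "Q ?P'" using Suc(1) P' hom by blast
  then have "Q (indexed_padd ?P' (single k (P k)))" by (rule monomial[OF P' hom _ Pc kI])
  also have "indexed_padd ?P' (single k (P k)) = P"
  proof
    fix l show "indexed_padd ?P' (single k (P k)) l = P l"
      unfolding indexed_padd_def[of ?P'] using Pc by (simp add: P'_eq) (simp add: single_def Pc)
  qed
  finally show ?case .
qed

end


section \<open>Evaluation of indexed polynomials\<close>

text \<open>The formula inside \<open>sym_eval\<close>, with the indeterminates sent to arbitrary
  elements instead of to themselves.\<close>

definition ip_eval ::
    "('a, 'r) ring_scheme \<Rightarrow> ('a, 'b, 's) module_scheme \<Rightarrow> ('i \<Rightarrow> 'b) \<Rightarrow> ('i multiset \<Rightarrow> 'a) \<Rightarrow> 'b" where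
  "ip_eval A B f P = finsum B (\<lambda>k. P k \<odot>\<^bsub>B\<^esub> finprod B (\<lambda>x. f x [^]\<^bsub>B\<^esub> count k x) (set_mset k))
     {k. P k \<noteq> \<zero>\<^bsub>A\<^esub>}"

locale indexed_evaluation = algebra A B
  for A :: "('a, 'r) ring_scheme" (structure) and B :: "('a, 'b, 's) module_scheme" +
  fixes I :: "'i set" and f :: "'i \<Rightarrow> 'b"
  assumes f: "f \<in> I \<rightarrow> carrier B"
begin

definition mon :: "'i multiset \<Rightarrow> 'b" where
  "mon k = finprod B (\<lambda>x. f x [^]\<^bsub>B\<^esub> count k x) (set_mset k)"

lemma mon_closed: "set_mset k \<subseteq> I \<Longrightarrow> mon k \<in> carrier B"
  unfolding mon_def using f by (intro finprod_closed) auto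

lemma mon_superset:
  assumes "finite Y" "set_mset k \<subseteq> Y" "Y \<subseteq> I"
  shows "mon k = finprod B (\<lambda>x. f x [^]\<^bsub>B\<^esub> count k x) Y"
  unfolding mon_def using assms f
  by (intro finprod_mono_neutral_cong_left) (auto simp: not_in_iff)

lemma mon_empty [simp]: "mon {#} = \<one>\<^bsub>B\<^esub>"
  by (simp add: mon_def)

lemma mon_add_mset:
  assumes "set_mset k \<subseteq> I" "m \<in> I"
  shows "mon (add_mset m k) = mon k \<otimes>\<^bsub>B\<^esub> f m"
proof -
  let ?Y = "set_mset k - {m}"
  have fm: "f m \<in> carrier B" using assms f by auto
  have pc: "(\<lambda>x. f x [^]\<^bsub>B\<^esub> count l x) \<in> ?Y \<rightarrow> carrier B" for l using assms f by auto
  \<comment> \<open>The power of m is split off even when m does not occur, its exponent then being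
    0. This treats k and \<open>add_mset m k\<close> over the same remaining index set.\<close>
  have *: "mon l = f m [^]\<^bsub>B\<^esub> count l m \<otimes>\<^bsub>B\<^esub> finprod B (\<lambda>x. f x [^]\<^bsub>B\<^esub> count l x) ?Y"
    if "set_mset l \<subseteq> insert m ?Y" for l
  proof -
    have "mon l = finprod B (\<lambda>x. f x [^]\<^bsub>B\<^esub> count l x) (insert m ?Y)"
      using that assms by (intro mon_superset) auto
    also have "\<dots> = f m [^]\<^bsub>B\<^esub> count l m \<otimes>\<^bsub>B\<^esub> finprod B (\<lambda>x. f x [^]\<^bsub>B\<^esub> count l x) ?Y"
      using pc fm by (intro finprod_insert) auto
    finally show ?thesis .
  qed
  have "finprod B (\<lambda>x. f x [^]\<^bsub>B\<^esub> count (add_mset m k) x) ?Y = finprod B (\<lambda>x. f x [^]\<^bsub>B\<^esub> count k x) ?Y"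
    using pc by (intro finprod_cong') auto
  then have "mon (add_mset m k) = (f m [^]\<^bsub>B\<^esub> count k m \<otimes>\<^bsub>B\<^esub> f m) \<otimes>\<^bsub>B\<^esub> finprod B (\<lambda>x. f x [^]\<^bsub>B\<^esub> count k x) ?Y"
    using *[of "add_mset m k"] by auto
  also have "\<dots> = mon k \<otimes>\<^bsub>B\<^esub> f m"
  proof -
    have mk: "mon k = f m [^]\<^bsub>B\<^esub> count k m \<otimes>\<^bsub>B\<^esub> finprod B (\<lambda>x. f x [^]\<^bsub>B\<^esub> count k x) ?Y"
      by (rule *) auto
    show ?thesis unfolding mk using pc fm by (simp add: m_ac)
  qed
  finally show ?thesis .
qed

lemma ip_eval_eq: "ip_eval A B f P = finsum B (\<lambda>k. P k \<odot>\<^bsub>B\<^esub> mon k) {k. P k \<noteq> \<zero>}"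
  by (simp add: ip_eval_def mon_def)

text \<open>The supports of sums and products are known only up to inclusion; since the extra terms
  vanish, several evaluations can run over one finite set.\<close>

lemma ip_eval_superset:
  assumes P: "P \<in> R.ip I" and S: "finite S" "{k. P k \<noteq> \<zero>} \<subseteq> S" "S \<subseteq> {k. set_mset k \<subseteq> I}"
  shows "ip_eval A B f P = finsum B (\<lambda>k. P k \<odot>\<^bsub>B\<^esub> mon k) S"
proof -
  have "P k \<odot>\<^bsub>B\<^esub> mon k \<in> carrier B" if "k \<in> S" for k
    using that S mon_closed R.ip_carrier[OF P] by auto
  moreover have "P k \<odot>\<^bsub>B\<^esub> mon k = \<zero>\<^bsub>B\<^esub>" if "k \<in> S - {k. P k \<noteq> \<zero>}" for k
    using that S mon_closed by auto
  ultimately show ?thesis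
    unfolding ip_eval_eq using S by (intro add.finprod_mono_neutral_cong_left) auto
qed

lemma ip_eval_superset_closed:
  assumes "P \<in> R.ip I" "S \<subseteq> {k. set_mset k \<subseteq> I}"
  shows "(\<lambda>k. P k \<odot>\<^bsub>B\<^esub> mon k) \<in> S \<rightarrow> carrier B"
  using assms mon_closed R.ip_carrier[OF assms(1)] by auto

lemma ip_eval_closed:
  assumes "P \<in> R.ip I"
  shows "ip_eval A B f P \<in> carrier B"
  unfolding ip_eval_eq using R.ip_support[OF assms]
  by (intro finsum_closed ip_eval_superset_closed[OF assms]) auto

lemma ip_eval_const:
  assumes "a \<in> carrier A"
  shows "ip_eval A B f (R.indexed_const a) = a \<odot>\<^bsub>B\<^esub> \<one>\<^bsub>B\<^esub>"
proof -
  have "ip_eval A B f (R.indexed_const a) = finsum B (\<lambda>k. R.indexed_const a k \<odot>\<^bsub>B\<^esub> mon k) {{#}}"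
    using assms by (intro ip_eval_superset R.indexed_pset.indexed_const) (auto simp: R.indexed_const_def)
  then show ?thesis using assms by (simp add: R.indexed_const_def)
qed

lemma ip_eval_padd:
  assumes P: "P \<in> R.ip I" and Q: "Q \<in> R.ip I"
  shows "ip_eval A B f (R.indexed_padd P Q) = ip_eval A B f P \<oplus>\<^bsub>B\<^esub> ip_eval A B f Q"
proof -
  let ?S = "{k. P k \<noteq> \<zero>} \<union> {k. Q k \<noteq> \<zero>}"
  have S: "finite ?S" "?S \<subseteq> {k. set_mset k \<subseteq> I}"
    using R.ip_finite_support[OF P] R.ip_finite_support[OF Q] R.ip_support[OF P] R.ip_support[OF Q] by auto
  have PQ: "R.indexed_padd P Q \<in> R.ip I" using P Q by (rule R.indexed_pset.indexed_padd)
  have "ip_eval A B f (R.indexed_padd P Q) = finsum B (\<lambda>k. R.indexed_padd P Q k \<odot>\<^bsub>B\<^esub> mon k) ?S"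
    by (intro ip_eval_superset PQ S) (auto simp: R.indexed_padd_def)
  also have "\<dots> = finsum B (\<lambda>k. P k \<odot>\<^bsub>B\<^esub> mon k \<oplus>\<^bsub>B\<^esub> Q k \<odot>\<^bsub>B\<^esub> mon k) ?S"
    using ip_eval_superset_closed[OF P S(2)] ip_eval_superset_closed[OF Q S(2)] S(2) mon_closed
      R.ip_carrier[OF P] R.ip_carrier[OF Q]
    by (intro finsum_cong') (auto simp: R.indexed_padd_def smult_l_distr)
  also have "\<dots> = finsum B (\<lambda>k. P k \<odot>\<^bsub>B\<^esub> mon k) ?S \<oplus>\<^bsub>B\<^esub> finsum B (\<lambda>k. Q k \<odot>\<^bsub>B\<^esub> mon k) ?S"
    by (intro finsum_addf ip_eval_superset_closed P Q S)
  also have "\<dots> = ip_eval A B f P \<oplus>\<^bsub>B\<^esub> ip_eval A B f Q"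
    using ip_eval_superset[OF P S(1) _ S(2)] ip_eval_superset[OF Q S(1) _ S(2)] by simp
  finally show ?thesis .
qed

lemma ip_eval_pmult:
  assumes P: "P \<in> R.ip I" and m: "m \<in> I"
  shows "ip_eval A B f (R.indexed_pmult P m) = ip_eval A B f P \<otimes>\<^bsub>B\<^esub> f m"
proof -
  let ?S = "{k. P k \<noteq> \<zero>}"
  have S: "finite ?S" "?S \<subseteq> {k. set_mset k \<subseteq> I}"
    using R.ip_finite_support[OF P] R.ip_support[OF P] by auto
  have PQ: "R.indexed_pmult P m \<in> R.ip I" using P m by (rule R.indexed_pset.indexed_pmult)
  have fm: "f m \<in> carrier B" using m f by auto
  have supp: "{k. R.indexed_pmult P m k \<noteq> \<zero>} \<subseteq> add_mset m ` ?S"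
  proof
    fix k assume "k \<in> {k. R.indexed_pmult P m k \<noteq> \<zero>}"
    then have "m \<in># k" "P (k - {#m#}) \<noteq> \<zero>" by (auto simp: R.indexed_pmult_def split: if_splits)
    then show "k \<in> add_mset m ` ?S" by (intro image_eqI[of _ _ "k - {#m#}"]) auto
  qed
  have "set_mset k \<subseteq> I" if "P k \<noteq> \<zero>" for k using R.ip_support[OF P that] .
  then have S': "add_mset m ` ?S \<subseteq> {k. set_mset k \<subseteq> I}" using m by (simp add: image_subset_iff)
  have "ip_eval A B f (R.indexed_pmult P m) =
      finsum B (\<lambda>k. R.indexed_pmult P m k \<odot>\<^bsub>B\<^esub> mon k) (add_mset m ` ?S)"
    using S by (intro ip_eval_superset PQ supp S') auto
  also have "\<dots> = finsum B (\<lambda>k. R.indexed_pmult P m (add_mset m k) \<odot>\<^bsub>B\<^esub> mon (add_mset m k)) ?S"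
    by (intro finsum_reindex ip_eval_superset_closed PQ S') (auto simp: inj_on_def)
  also have "\<dots> = finsum B (\<lambda>k. (P k \<odot>\<^bsub>B\<^esub> mon k) \<otimes>\<^bsub>B\<^esub> f m) ?S"
    using S m fm ip_eval_superset_closed[OF P S(2)] mon_closed R.ip_carrier[OF P]
    by (intro finsum_cong') (auto simp: R.indexed_pmult_def mon_add_mset smult_assoc2)
  also have "\<dots> = ip_eval A B f P \<otimes>\<^bsub>B\<^esub> f m"
    unfolding ip_eval_eq by (intro finsum_ldistr[symmetric] S fm ip_eval_superset_closed[OF P S(2)])
  finally show ?thesis .
qed

text \<open>Induction on the left factor along the three product rules takes the place of
  rearranging a double sum.\<close>

lemma ip_eval_mult:
  assumes "P \<in> R.ip I" "Q \<in> R.ip I"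
  shows "ip_eval A B f (R.ip_mult P Q) = ip_eval A B f P \<otimes>\<^bsub>B\<^esub> ip_eval A B f Q"
  using assms
proof (induction rule: R.indexed_pset.induct)
  case (indexed_const a)
  have "ip_eval A B f (\<lambda>k. a \<otimes> Q k) = a \<odot>\<^bsub>B\<^esub> ip_eval A B f Q"
  proof -
    let ?S = "{k. Q k \<noteq> \<zero>}"
    have S: "finite ?S" "?S \<subseteq> {k. set_mset k \<subseteq> I}"
      using R.ip_finite_support[OF indexed_const(2)] R.ip_support[OF indexed_const(2)] by auto
    have "ip_eval A B f (\<lambda>k. a \<otimes> Q k) = finsum B (\<lambda>k. (a \<otimes> Q k) \<odot>\<^bsub>B\<^esub> mon k) ?S"
      using indexed_const by (intro ip_eval_superset R.ip_scale S) auto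
    also have "\<dots> = finsum B (\<lambda>k. a \<odot>\<^bsub>B\<^esub> (Q k \<odot>\<^bsub>B\<^esub> mon k)) ?S"
      using indexed_const S(2) mon_closed R.ip_carrier[of Q I]
      by (intro finsum_cong') (auto simp: smult_assoc1)
    also have "\<dots> = a \<odot>\<^bsub>B\<^esub> ip_eval A B f Q"
      unfolding ip_eval_eq using indexed_const
      by (intro finsum_smult_ldistr[symmetric] S ip_eval_superset_closed)
    finally show ?thesis .
  qed
  then show ?case using indexed_const
    by (simp add: R.ip_mult_const[where I = I] ip_eval_const smult_assoc2 ip_eval_closed)
next
  case (indexed_padd P P')
  then show ?case
    by (simp add: R.ip_mult_padd[where I = I] ip_eval_padd R.ip_mult_closed ip_eval_closed l_distr)
next
  case (indexed_pmult P i)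
  then have "f i \<in> carrier B" using f by auto
  with indexed_pmult show ?case
    by (simp add: R.ip_mult_pmult[where I = I] ip_eval_pmult R.ip_mult_closed ip_eval_closed m_ac)
qed

lemma ip_eval_var:
  assumes "m \<in> I"
  shows "ip_eval A B f (R.indexed_var m) = f m"
proof -
  have "f m \<in> carrier B" using assms f by auto
  then show ?thesis
    unfolding R.indexed_var_def using assms
    by (simp add: ip_eval_pmult R.indexed_pset.indexed_const ip_eval_const)
qed

lemma ip_eval_ring_hom: "ip_eval A B f \<in> ring_hom (indexed_poly_ring A I) B"
  by (rule ring_hom_memI)
    (simp_all add: ip_eval_closed ip_eval_mult ip_eval_padd ip_eval_const)

end

section \<open>The symmetric algebra\<close>

locale symmetric_algebra = module A M
  for A :: "('a, 'r) ring_scheme" (structure) and M :: "('a, 'm, 's) module_scheme"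
begin

abbreviation "PR \<equiv> indexed_poly_ring A (carrier M)"
abbreviation "PC \<equiv> R.ip (carrier M)"
abbreviation "J \<equiv> sym_ideal A M"
abbreviation "S \<equiv> sym_algebra A M"
abbreviation "cls \<equiv> sym_class A M"
abbreviation "svar \<equiv> sym_var A M"
abbreviation "Sg \<equiv> sym_grading A M"

definition relations :: "('m multiset \<Rightarrow> 'a) set" where
  "relations =
    {R.indexed_var (x \<oplus>\<^bsub>M\<^esub> y) \<ominus>\<^bsub>PR\<^esub> (R.indexed_var x \<oplus>\<^bsub>PR\<^esub> R.indexed_var y) | x y.
       x \<in> carrier M \<and> y \<in> carrier M} \<union>
    {R.indexed_var (a \<odot>\<^bsub>M\<^esub> x) \<ominus>\<^bsub>PR\<^esub> (R.indexed_const a \<otimes>\<^bsub>PR\<^esub> R.indexed_var x) | a x.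
       a \<in> carrier A \<and> x \<in> carrier M}"

lemma poly_cring: "cring PR"
  by (rule R.indexed_poly_cring)

lemma var_closed: "x \<in> carrier M \<Longrightarrow> R.indexed_var x \<in> carrier PR"
  by (simp add: R.indexed_var_closed)

lemma const_closed: "a \<in> carrier A \<Longrightarrow> R.indexed_const a \<in> carrier PR"
  by (simp add: R.indexed_pset.indexed_const)

lemma relations_subset: "relations \<subseteq> carrier PR"
proof -
  interpret P: cring PR by (rule poly_cring)
  show ?thesis unfolding relations_def
    by (auto simp del: R.indexed_poly_ring_simps intro!: P.minus_closed P.a_closed P.m_closed var_closed const_closed)
qed

lemma sym_ideal_eq: "J = Idl\<^bsub>PR\<^esub> relations"
  by (simp add: sym_ideal_def Let_def relations_def)

lemma sym_ideal_ideal: "ideal J PR"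
  unfolding sym_ideal_eq
  by (rule ring.genideal_ideal[OF cring.axioms(1)[OF poly_cring] relations_subset])

lemma relations_in_ideal: "relations \<subseteq> J"
  unfolding sym_ideal_eq
  by (rule ring.genideal_self[OF cring.axioms(1)[OF poly_cring] relations_subset])

lemma quotient_cring: "cring (PR Quot J)"
  by (rule ideal.quotient_is_cring[OF sym_ideal_ideal poly_cring])

lemma sym_algebra_simps:
  "carrier S = carrier (PR Quot J)" "ring.add S = ring.add (PR Quot J)"
  "ring.zero S = ring.zero (PR Quot J)" "monoid.mult S = monoid.mult (PR Quot J)"
  "\<one>\<^bsub>S\<^esub> = \<one>\<^bsub>PR Quot J\<^esub>" "a \<odot>\<^bsub>S\<^esub> W = cls (R.indexed_const a) \<otimes>\<^bsub>S\<^esub> W"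
  by (simp_all add: sym_algebra_def Let_def)

lemma sym_cring: "cring S"
proof -
  interpret Q: cring "PR Quot J" by (rule quotient_cring)
  show ?thesis
  proof (rule cringI)
    show "abelian_group S"
      by (rule abelian_group_cong_structure[of "PR Quot J"]) (simp_all add: sym_algebra_simps Q.abelian_group_axioms)
    show "comm_monoid S"
      by (rule comm_monoidI) (simp_all only: sym_algebra_simps Q.m_closed Q.one_closed Q.m_assoc Q.l_one, erule (1) Q.m_comm)
  qed (simp only: sym_algebra_simps Q.l_distr)
qed

lemma class_ring_hom: "cls \<in> ring_hom PR S"
proof -
  have "cls = (+>\<^bsub>PR\<^esub>) J" by (simp add: sym_class_def[abs_def])
  then show ?thesis
    using ideal.rcos_ring_hom[OF sym_ideal_ideal] by (simp add: ring_hom_def sym_algebra_simps)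
qed

lemma class_closed: "P \<in> PC \<Longrightarrow> cls P \<in> carrier S"
  using ring_hom_closed[OF class_ring_hom] by simp

lemma class_add: "P \<in> PC \<Longrightarrow> P' \<in> PC \<Longrightarrow> cls (R.indexed_padd P P') = cls P \<oplus>\<^bsub>S\<^esub> cls P'"
  using ring_hom_add[OF class_ring_hom] by simp

lemma class_mult: "P \<in> PC \<Longrightarrow> P' \<in> PC \<Longrightarrow> cls (R.ip_mult P P') = cls P \<otimes>\<^bsub>S\<^esub> cls P'"
  using ring_hom_mult[OF class_ring_hom] by simp

lemma class_one: "cls (R.indexed_const \<one>) = \<one>\<^bsub>S\<^esub>"
  using ring_hom_one[OF class_ring_hom] by simp

lemma class_surj: "W \<in> carrier S \<Longrightarrow> \<exists>P \<in> PC. W = cls P"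
  by (auto simp: sym_algebra_simps FactRing_def A_RCOSETS_defs sym_class_def a_r_coset_def)

lemma class_eqI:
  assumes "P \<in> PC" "P' \<in> PC" "P \<ominus>\<^bsub>PR\<^esub> P' \<in> J"
  shows "cls P = cls P'"
proof -
  interpret P: cring PR by (rule poly_cring)
  interpret I: ideal J PR by (rule sym_ideal_ideal)
  have "P \<in> carrier PR" "P' \<in> carrier PR" using assms(1,2) by simp_all
  then show ?thesis
    unfolding sym_class_def
    using assms(3) I.a_rcos_module_minus[OF P.ring_axioms] I.a_repr_independence' P.ring_axioms
    by blast
qed

lemma scalar_class: "a \<in> carrier A \<Longrightarrow> a \<odot>\<^bsub>S\<^esub> \<one>\<^bsub>S\<^esub> = cls (R.indexed_const a)"
proof -
  interpret S: cring S by (rule sym_cring)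
  show "a \<in> carrier A \<Longrightarrow> ?thesis"
    using class_closed[of "R.indexed_const a"] by (simp add: sym_algebra_simps(6) R.indexed_pset.indexed_const)
qed

lemma sym_is_algebra: "algebra A S"
proof -
  interpret S: cring S by (rule sym_cring)
  have cc: "cls (R.indexed_const a) \<in> carrier S" if "a \<in> carrier A" for a
    using that by (intro class_closed R.indexed_pset.indexed_const)
  have ca: "cls (R.indexed_const (a \<oplus> b)) = cls (R.indexed_const a) \<oplus>\<^bsub>S\<^esub> cls (R.indexed_const b)"
    if "a \<in> carrier A" "b \<in> carrier A" for a b
    using that class_add[of "R.indexed_const a" "R.indexed_const b"]
    by (simp add: R.indexed_pset.indexed_const R.indexed_padd_const)
  have cm: "cls (R.indexed_const (a \<otimes> b)) = cls (R.indexed_const a) \<otimes>\<^bsub>S\<^esub> cls (R.indexed_const b)"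
    if ab: "a \<in> carrier A" "b \<in> carrier A" for a b
  proof -
    have "R.ip_mult (R.indexed_const a) (R.indexed_const b :: 'm multiset \<Rightarrow> 'a) =
        (\<lambda>k. a \<otimes> (R.indexed_const b :: 'm multiset \<Rightarrow> 'a) k)"
      using R.ip_mult_const[OF ab(1) R.indexed_pset.indexed_const[OF ab(2), of "carrier M"]] .
    also have "\<dots> = R.indexed_const (a \<otimes> b)"
      using ab by (auto simp: R.indexed_const_def fun_eq_iff)
    finally show ?thesis
      using ab class_mult[of "R.indexed_const a" "R.indexed_const b"]
      by (simp add: R.indexed_pset.indexed_const)
  qed
  show ?thesis
    by (rule algebraI)
      (simp_all add: sym_algebra_simps(6) cc ca cm class_one S.l_distr S.r_distr S.m_assoc
        R.is_cring S.is_cring)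
qed

lemma sym_var_closed: "x \<in> carrier M \<Longrightarrow> svar x \<in> carrier S"
  unfolding sym_var_def by (intro class_closed R.indexed_var_closed)

lemma sym_var_linear: "linear_map A M S svar"
proof (intro linear_mapI additive_mapI)
  fix x assume x: "x \<in> carrier M"
  then show "svar x \<in> carrier S" by (rule sym_var_closed)
  show "svar (x \<oplus>\<^bsub>M\<^esub> y) = svar x \<oplus>\<^bsub>S\<^esub> svar y" if y: "y \<in> carrier M" for y
  proof -
    have "R.indexed_var (x \<oplus>\<^bsub>M\<^esub> y) \<ominus>\<^bsub>PR\<^esub> (R.indexed_var x \<oplus>\<^bsub>PR\<^esub> R.indexed_var y) \<in> J"
      using x y relations_in_ideal unfolding relations_def by blast
    then have "cls (R.indexed_var (x \<oplus>\<^bsub>M\<^esub> y)) = cls (R.indexed_padd (R.indexed_var x) (R.indexed_var y))"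
      using x y by (intro class_eqI) (auto intro: R.indexed_var_closed R.indexed_pset.indexed_padd)
    then show ?thesis using x y by (simp add: sym_var_def class_add R.indexed_var_closed)
  qed
  show "svar (a \<odot>\<^bsub>M\<^esub> x) = a \<odot>\<^bsub>S\<^esub> svar x" if a: "a \<in> carrier A" for a
  proof -
    have "R.indexed_var (a \<odot>\<^bsub>M\<^esub> x) \<ominus>\<^bsub>PR\<^esub> (R.indexed_const a \<otimes>\<^bsub>PR\<^esub> R.indexed_var x) \<in> J"
      using x a relations_in_ideal unfolding relations_def by blast
    then have "cls (R.indexed_var (a \<odot>\<^bsub>M\<^esub> x)) = cls (R.ip_mult (R.indexed_const a) (R.indexed_var x))"
      using x a by (intro class_eqI) (auto intro: R.indexed_var_closed R.ip_mult_closed R.indexed_pset.indexed_const)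
    then show ?thesis using x a
      by (simp add: sym_var_def class_mult R.indexed_var_closed R.indexed_pset.indexed_const sym_algebra_simps(6))
  qed
qed

text \<open>The constructors of \<open>indexed_pset\<close> seen modulo the ideal: constants become
  scalars and \<open>indexed_pmult\<close> becomes multiplication by a variable.\<close>

lemma sym_induct [consumes 1, case_names scalar add var]:
  assumes W: "W \<in> carrier S"
    and scalar: "\<And>a. a \<in> carrier A \<Longrightarrow> Q (a \<odot>\<^bsub>S\<^esub> \<one>\<^bsub>S\<^esub>)"
    and add: "\<And>s t. s \<in> carrier S \<Longrightarrow> t \<in> carrier S \<Longrightarrow> Q s \<Longrightarrow> Q t \<Longrightarrow> Q (s \<oplus>\<^bsub>S\<^esub> t)"
    and var: "\<And>x s. x \<in> carrier M \<Longrightarrow> s \<in> carrier S \<Longrightarrow> Q s \<Longrightarrow> Q (svar x \<otimes>\<^bsub>S\<^esub> s)"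
  shows "Q W"
proof -
  interpret S: cring S by (rule sym_cring)
  have "Q (cls P)" if "P \<in> PC" for P
    using that
  proof (induction rule: R.indexed_pset.induct)
    case (indexed_const a)
    then show ?case using scalar by (simp add: scalar_class)
  next
    case (indexed_padd P P')
    then show ?case by (simp add: class_add class_closed add)
  next
    case (indexed_pmult P x)
    then have "cls (R.indexed_pmult P x) = svar x \<otimes>\<^bsub>S\<^esub> cls P"
      using class_mult[of P "R.indexed_var x"] S.m_comm[of "cls P" "svar x"]
      by (simp add: R.indexed_pmult_var[where I = "carrier M"] R.indexed_var_closed class_closed sym_var_closed)
        (simp add: sym_var_def)
    then show ?case using indexed_pmult var class_closed by simp
  qed
  then show ?thesis using class_surj[OF W] by blast
qed

lemma sym_grading_eq: "Sg n = cls ` {P \<in> PC. \<forall>k. P k \<noteq> \<zero> \<longrightarrow> size k = n}"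
  by (simp add: sym_grading_def)

lemma sym_grading_closed: "s \<in> Sg n \<Longrightarrow> s \<in> carrier S"
  unfolding sym_grading_eq using class_closed by auto

lemma sym_grading_submodule: "submodule (Sg n) A S"
proof -
  interpret S: algebra A S by (rule sym_is_algebra)
  have smul: "a \<odot>\<^bsub>S\<^esub> cls P = cls (\<lambda>k. a \<otimes> P k)" if "a \<in> carrier A" "P \<in> PC" for a P
  proof -
    have "a \<odot>\<^bsub>S\<^esub> cls P = cls (R.ip_mult (R.indexed_const a) P)"
      using that by (simp add: sym_algebra_simps(6) class_mult R.indexed_pset.indexed_const)
    then show ?thesis using R.ip_mult_const[OF that] by simp
  qed
  have sm: "a \<odot>\<^bsub>S\<^esub> s \<in> Sg n" if a: "a \<in> carrier A" and s: "s \<in> Sg n" for a s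
  proof -
    obtain P where P: "P \<in> PC" "\<forall>k. P k \<noteq> \<zero> \<longrightarrow> size k = n" "s = cls P"
      using s unfolding sym_grading_eq by blast
    have "(\<lambda>k. a \<otimes> P k) \<in> PC" using P(1) a by (rule R.ip_scale)
    moreover have "\<forall>k. a \<otimes> P k \<noteq> \<zero> \<longrightarrow> size k = n" using P(2) R.r_null[OF a] by metis
    ultimately have "(\<lambda>k. a \<otimes> P k) \<in> PC" "\<forall>k. a \<otimes> P k \<noteq> \<zero> \<longrightarrow> size k = n" by blast+
    then show ?thesis using smul[OF a P(1)] P(3) unfolding sym_grading_eq by blast
  qed
  have neg: "\<ominus>\<^bsub>S\<^esub> s \<in> Sg n" if s: "s \<in> Sg n" for s
    using sm[of "\<ominus> \<one>" s] s sym_grading_closed[OF s] by (simp add: S.smult_l_minus)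
  show ?thesis
  proof (rule S.submoduleI)
    show "Sg n \<subseteq> carrier S" using sym_grading_closed by blast
    have "cls (R.indexed_const \<zero>) = \<zero>\<^bsub>S\<^esub>"
      using scalar_class[of \<zero>] by simp
    moreover have "cls (R.indexed_const \<zero>) \<in> Sg n"
      unfolding sym_grading_eq
      by (intro imageI) (auto simp: R.indexed_zero_def intro: R.indexed_pset.indexed_const[of \<zero>, unfolded R.indexed_zero_def])
    ultimately show "\<zero>\<^bsub>S\<^esub> \<in> Sg n" by simp
    show "s \<oplus>\<^bsub>S\<^esub> t \<in> Sg n" if s: "s \<in> Sg n" and t: "t \<in> Sg n" for s t
    proof -
      obtain P where P: "P \<in> PC" "\<forall>k. P k \<noteq> \<zero> \<longrightarrow> size k = n" "s = cls P"
        using s unfolding sym_grading_eq by blast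
      obtain P' where P': "P' \<in> PC" "\<forall>k. P' k \<noteq> \<zero> \<longrightarrow> size k = n" "t = cls P'"
        using t unfolding sym_grading_eq by blast
      have "R.indexed_padd P P' \<in> PC" using P(1) P'(1) by (rule R.indexed_pset.indexed_padd)
      moreover have "\<forall>k. R.indexed_padd P P' k \<noteq> \<zero> \<longrightarrow> size k = n"
      proof (intro allI impI)
        fix k assume "R.indexed_padd P P' k \<noteq> \<zero>"
        then have "P k \<noteq> \<zero> \<or> P' k \<noteq> \<zero>" by (auto simp: R.indexed_padd_def)
        then show "size k = n" using P(2) P'(2) by blast
      qed
      ultimately show ?thesis using class_add[OF P(1) P'(1)] P(3) P'(3) unfolding sym_grading_eq
        by (intro image_eqI[of _ _ "R.indexed_padd P P'"]) simp_all
    qed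
  qed (use sm neg in auto)
qed

lemma sym_grading_zero: "Sg 0 = {a \<odot>\<^bsub>S\<^esub> \<one>\<^bsub>S\<^esub> | a. a \<in> carrier A}"
proof (intro equalityI subsetI)
  fix s assume "s \<in> Sg 0"
  then obtain P where P: "P \<in> PC" "\<forall>k. P k \<noteq> \<zero> \<longrightarrow> size k = 0" "s = cls P"
    unfolding sym_grading_eq by blast
  then have "P = R.indexed_const (P {#})" by (auto simp: R.indexed_const_def fun_eq_iff)
  moreover have "P {#} \<in> carrier A" using R.ip_carrier[OF P(1)] .
  ultimately have "s = P {#} \<odot>\<^bsub>S\<^esub> \<one>\<^bsub>S\<^esub>" "P {#} \<in> carrier A" using P(3) scalar_class[of "P {#}"] by simp_all
  then show "s \<in> {a \<odot>\<^bsub>S\<^esub> \<one>\<^bsub>S\<^esub> | a. a \<in> carrier A}" by blast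
next
  fix s assume "s \<in> {a \<odot>\<^bsub>S\<^esub> \<one>\<^bsub>S\<^esub> | a. a \<in> carrier A}"
  then obtain a where a: "a \<in> carrier A" "s = cls (R.indexed_const a)" using scalar_class by blast
  have "R.indexed_const a \<in> PC" using a(1) by (rule R.indexed_pset.indexed_const)
  moreover have "\<forall>k. (R.indexed_const a :: 'm multiset \<Rightarrow> 'a) k \<noteq> \<zero> \<longrightarrow> size k = 0"
    by (simp add: R.indexed_const_def)
  ultimately show "s \<in> Sg 0" unfolding sym_grading_eq a(2) by blast
qed

lemma sym_one_grade: "\<one>\<^bsub>S\<^esub> \<in> Sg 0"
proof -
  have "\<one>\<^bsub>S\<^esub> = \<one> \<odot>\<^bsub>S\<^esub> \<one>\<^bsub>S\<^esub>" unfolding scalar_class[OF R.one_closed] class_one ..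
  then show ?thesis unfolding sym_grading_zero using R.one_closed by blast
qed

lemma sym_var_mult_class:
  assumes "x \<in> carrier M" "P \<in> PC"
  shows "svar x \<otimes>\<^bsub>S\<^esub> cls P = cls (R.indexed_pmult P x)"
proof -
  interpret S: cring S by (rule sym_cring)
  show ?thesis
    using assms class_mult[of P "R.indexed_var x"] S.m_comm[of "svar x" "cls P"]
    by (simp add: R.indexed_pmult_var[where I = "carrier M"] R.indexed_var_closed class_closed sym_var_closed)
      (simp add: sym_var_def)
qed

lemma sym_var_mult_grade:
  assumes "x \<in> carrier M" "s \<in> Sg n"
  shows "svar x \<otimes>\<^bsub>S\<^esub> s \<in> Sg (Suc n)"
proof -
  obtain P where P: "P \<in> PC" "\<forall>k. P k \<noteq> \<zero> \<longrightarrow> size k = n" "s = cls P"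
    using assms(2) unfolding sym_grading_eq by blast
  have "size k = Suc n" if k: "R.indexed_pmult P x k \<noteq> \<zero>" for k
  proof -
    have "x \<in># k" "P (k - {#x#}) \<noteq> \<zero>" using k by (auto simp: R.indexed_pmult_def split: if_splits)
    then show ?thesis using P(2) by (metis size_Suc_Diff1)
  qed
  then show ?thesis
    using sym_var_mult_class[OF assms(1) P(1)] P(3) assms(1) P(1)
    unfolding sym_grading_eq by (auto intro!: imageI R.indexed_pset.indexed_pmult)
qed

text \<open>A homogeneous class has a homogeneous representative, and a monomial of size n + 1 is a
  variable times one of size n. Later arguments on degrees peel off variables instead of choosing
  representatives.\<close>

lemma sym_grade_Suc_induct [consumes 1, case_names var add]:
  assumes s: "s \<in> Sg (Suc n)"
    and var: "\<And>x t. x \<in> carrier M \<Longrightarrow> t \<in> Sg n \<Longrightarrow> Q (svar x \<otimes>\<^bsub>S\<^esub> t)"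
    and add: "\<And>s t. s \<in> carrier S \<Longrightarrow> t \<in> carrier S \<Longrightarrow> Q s \<Longrightarrow> Q t \<Longrightarrow> Q (s \<oplus>\<^bsub>S\<^esub> t)"
  shows "Q s"
proof -
  interpret S: algebra A S by (rule sym_is_algebra)
  obtain P where P: "P \<in> PC" "\<forall>k. P k \<noteq> \<zero> \<longrightarrow> size k = Suc n" "s = cls P"
    using s unfolding sym_grading_eq by blast
  have "Q (cls P)" using P(1,2)
  proof (induction rule: R.homogeneous_induct)
    case zero
    \<comment> \<open>The rule has no case for zero, so zero is written as a variable times
      zero.\<close>
    have "\<zero>\<^bsub>S\<^esub> \<in> Sg n" by (rule S.subgroup_zero[OF submodule_subgroup[OF sym_grading_submodule]])
    then have "Q (svar \<zero>\<^bsub>M\<^esub> \<otimes>\<^bsub>S\<^esub> \<zero>\<^bsub>S\<^esub>)" by (intro var) auto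
    moreover have "cls (R.indexed_const \<zero>) = \<zero>\<^bsub>S\<^esub>" using scalar_class[of \<zero>] by simp
    ultimately show ?case using sym_var_closed[of "\<zero>\<^bsub>M\<^esub>"] by simp
  next
    case (monomial P k a)
    then obtain x l where k: "k = add_mset x l" by (metis size_eq_Suc_imp_eq_union)
    have l: "R.single l a \<in> PC" "\<forall>j. R.single l a j \<noteq> \<zero> \<longrightarrow> size j = n" "x \<in> carrier M"
      using monomial k by (auto intro!: R.single_closed) (simp add: R.single_def split: if_splits)
    then have "cls (R.single l a) \<in> Sg n" unfolding sym_grading_eq by blast
    from var[OF l(3) this] have "Q (cls (R.single k a))"
      using sym_var_mult_class[OF l(3,1)] by (simp add: k R.single_add_mset)
    moreover have "R.single k a \<in> PC" using monomial by (intro R.single_closed)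
    ultimately show ?case using monomial class_closed by (simp add: class_add add)
  qed
  then show ?thesis using P(3) by simp
qed

text \<open>Peeling variables off the left factor reduces to degree zero, where that factor is a
  scalar and closure of \<open>Sg q\<close> under scalars suffices.\<close>

lemma sym_mult_grade:
  assumes "s \<in> Sg p" "t \<in> Sg q"
  shows "s \<otimes>\<^bsub>S\<^esub> t \<in> Sg (p + q)"
  using assms(1)
proof (induction p arbitrary: s)
  interpret S: algebra A S by (rule sym_is_algebra)
  case 0
  then obtain a where a: "a \<in> carrier A" "s = a \<odot>\<^bsub>S\<^esub> \<one>\<^bsub>S\<^esub>" unfolding sym_grading_zero by blast
  then have "s \<otimes>\<^bsub>S\<^esub> t = a \<odot>\<^bsub>S\<^esub> t" using sym_grading_closed[OF assms(2)] by (simp add: S.smult_one_mult)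
  then show ?case using submodule.smult_closed[OF sym_grading_submodule a(1) assms(2)] by simp
next
  interpret S: algebra A S by (rule sym_is_algebra)
  case (Suc p)
  note tc = sym_grading_closed[OF assms(2)]
  from Suc.prems show ?case
  proof (induction rule: sym_grade_Suc_induct)
    case (var x r)
    then have "(svar x \<otimes>\<^bsub>S\<^esub> r) \<otimes>\<^bsub>S\<^esub> t = svar x \<otimes>\<^bsub>S\<^esub> (r \<otimes>\<^bsub>S\<^esub> t)"
      using sym_grading_closed tc sym_var_closed by (simp add: S.m_assoc)
    then show ?case using sym_var_mult_grade Suc.IH var by simp
  next
    case (add r r')
    then show ?case using tc
      by (simp add: S.l_distr S.subgroup_add[OF submodule_subgroup[OF sym_grading_submodule]])
  qed
qed

end


section \<open>The universal property of the symmetric algebra\<close>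

text \<open>The recipe of \<open>sym_eval\<close> for an arbitrary linear map f into an A-algebra.
  The inclusion of U_1 into U gives \<alpha>; the maps u \<mapsto> u \<otimes> 1 and v \<mapsto> 1
  \<otimes> v will give the morphisms \<open>iL\<close> and \<open>iR\<close> into the symmetric
  algebra of (U \<otimes> V)_1.\<close>

definition sym_lift ::
    "('a, 'r) ring_scheme \<Rightarrow> ('a, 'b, 's) module_scheme \<Rightarrow> ('m \<Rightarrow> 'b) \<Rightarrow> ('m multiset \<Rightarrow> 'a) set \<Rightarrow> 'b" where
  "sym_lift A B f W = the_elem (ip_eval A B f ` W)"

lemma sym_eval_eq_lift: "sym_eval A U = sym_lift A U (\<lambda>x. x)"
  by (simp add: sym_eval_def[abs_def] sym_lift_def[abs_def] ip_eval_def[abs_def])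

locale symmetric_lift = symmetric_algebra A M + B: algebra A B
  for A :: "('a, 'r) ring_scheme" (structure) and M :: "('a, 'm, 's) module_scheme"
    and B :: "('a, 'b, 't) module_scheme" +
  fixes f :: "'m \<Rightarrow> 'b"
  assumes f: "linear_map A M B f"
begin

sublocale E: indexed_evaluation A B "carrier M" f
  by (intro indexed_evaluation.intro indexed_evaluation_axioms.intro B.algebra_axioms)
    (use linear_map_closed[OF f] in auto)

text \<open>The kernel of a ring morphism is an ideal, so only the generators of \<open>J\<close>
  have to be checked, and for those the claim is the linearity of f.\<close>

lemma relations_eval:
  assumes "r \<in> J"
  shows "ip_eval A B f r = \<zero>\<^bsub>B\<^esub>"
proof -
  interpret P: cring PR by (rule poly_cring)
  interpret h: ring_hom_ring PR B "ip_eval A B f"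
    by (intro ring_hom_ringI2 P.ring_axioms B.ring_axioms E.ip_eval_ring_hom)
  have ev: "ip_eval A B f (P \<ominus>\<^bsub>PR\<^esub> P') = \<zero>\<^bsub>B\<^esub>"
    if "P \<in> carrier PR" "P' \<in> carrier PR" "ip_eval A B f P = ip_eval A B f P'" for P P'
    using that h.hom_closed[of P'] by (simp only: a_minus_def h.hom_add h.hom_a_inv P.a_inv_closed B.r_neg)
  have "relations \<subseteq> a_kernel PR B (ip_eval A B f)"
  proof
    fix r assume r: "r \<in> relations"
    then have rc: "r \<in> carrier PR" using relations_subset by blast
    from r have "ip_eval A B f r = \<zero>\<^bsub>B\<^esub>"
      unfolding relations_def
    proof (elim UnE CollectE exE conjE)
      fix x y assume r: "r = R.indexed_var (x \<oplus>\<^bsub>M\<^esub> y) \<ominus>\<^bsub>PR\<^esub> (R.indexed_var x \<oplus>\<^bsub>PR\<^esub> R.indexed_var y)"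
        and xy: "x \<in> carrier M" "y \<in> carrier M"
      show ?thesis unfolding r
      proof (rule ev)
        show "R.indexed_var x \<oplus>\<^bsub>PR\<^esub> R.indexed_var y \<in> carrier PR"
          by (intro P.a_closed var_closed xy)
        show "ip_eval A B f (R.indexed_var (x \<oplus>\<^bsub>M\<^esub> y)) =
            ip_eval A B f (R.indexed_var x \<oplus>\<^bsub>PR\<^esub> R.indexed_var y)"
          using xy by (simp add: E.ip_eval_var E.ip_eval_padd R.indexed_var_closed linear_map_add[OF f])
      qed (use xy in \<open>auto intro: var_closed simp del: R.indexed_poly_ring_simps\<close>)
    next
      fix a x assume r: "r = R.indexed_var (a \<odot>\<^bsub>M\<^esub> x) \<ominus>\<^bsub>PR\<^esub> (R.indexed_const a \<otimes>\<^bsub>PR\<^esub> R.indexed_var x)"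
        and ax: "a \<in> carrier A" "x \<in> carrier M"
      show ?thesis unfolding r
      proof (rule ev)
        show "R.indexed_const a \<otimes>\<^bsub>PR\<^esub> R.indexed_var x \<in> carrier PR"
          by (intro P.m_closed var_closed const_closed ax)
        show "ip_eval A B f (R.indexed_var (a \<odot>\<^bsub>M\<^esub> x)) =
            ip_eval A B f (R.indexed_const a \<otimes>\<^bsub>PR\<^esub> R.indexed_var x)"
          using ax linear_map_closed[OF f, of x]
          by (simp add: E.ip_eval_var E.ip_eval_mult R.indexed_var_closed R.indexed_pset.indexed_const
              E.ip_eval_const linear_map_smult[OF f] B.smult_one_mult)
      qed (use ax in \<open>auto intro: var_closed simp del: R.indexed_poly_ring_simps\<close>)
    qed
    with rc show "r \<in> a_kernel PR B (ip_eval A B f)" unfolding a_kernel_def' by blast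
  qed
  then have "J \<subseteq> a_kernel PR B (ip_eval A B f)"
    unfolding sym_ideal_eq by (intro P.genideal_minimal h.kernel_is_ideal)
  then show ?thesis using assms unfolding a_kernel_def' by blast
qed

text \<open>Two representatives differ by an element of \<open>J\<close>, which evaluates to zero;
  the set of values on a class is thus a singleton.\<close>

lemma sym_lift_class:
  assumes P: "P \<in> PC"
  shows "sym_lift A B f (cls P) = ip_eval A B f P"
proof -
  interpret PR: cring PR by (rule poly_cring)
  interpret I: ideal J PR by (rule sym_ideal_ideal)
  have "ip_eval A B f W = ip_eval A B f P" if W: "W \<in> cls P" for W
  proof -
    obtain j where j: "j \<in> J" "W = R.indexed_padd j P"
      using W unfolding sym_class_def a_r_coset_def' by auto
    have "j \<in> PC" using I.a_Hcarr[OF j(1)] by simp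
    then show ?thesis using j relations_eval[OF j(1)] P E.ip_eval_closed[OF P]
      by (simp add: E.ip_eval_padd)
  qed
  moreover have "P \<in> cls P"
    unfolding sym_class_def using P by (intro I.a_rcos_self) simp
  ultimately have "ip_eval A B f ` cls P = {ip_eval A B f P}" by blast
  then show ?thesis by (simp add: sym_lift_def)
qed

lemma sym_lift_add:
  "s \<in> carrier S \<Longrightarrow> t \<in> carrier S \<Longrightarrow> sym_lift A B f (s \<oplus>\<^bsub>S\<^esub> t) = sym_lift A B f s \<oplus>\<^bsub>B\<^esub> sym_lift A B f t"
  by (auto dest!: class_surj
      simp: class_add[symmetric] sym_lift_class R.indexed_pset.indexed_padd E.ip_eval_padd)

lemma sym_lift_mult:
  "s \<in> carrier S \<Longrightarrow> t \<in> carrier S \<Longrightarrow> sym_lift A B f (s \<otimes>\<^bsub>S\<^esub> t) = sym_lift A B f s \<otimes>\<^bsub>B\<^esub> sym_lift A B f t"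
  by (auto dest!: class_surj
      simp: class_mult[symmetric] sym_lift_class R.ip_mult_closed E.ip_eval_mult)

lemma sym_lift_closed: "s \<in> carrier S \<Longrightarrow> sym_lift A B f s \<in> carrier B"
  by (auto dest!: class_surj simp: sym_lift_class E.ip_eval_closed)

lemma sym_lift_scalar: "a \<in> carrier A \<Longrightarrow> sym_lift A B f (a \<odot>\<^bsub>S\<^esub> \<one>\<^bsub>S\<^esub>) = a \<odot>\<^bsub>B\<^esub> \<one>\<^bsub>B\<^esub>"
  by (simp add: scalar_class sym_lift_class R.indexed_pset.indexed_const E.ip_eval_const)

lemma sym_lift_var: "x \<in> carrier M \<Longrightarrow> sym_lift A B f (svar x) = f x"
  by (simp add: sym_var_def sym_lift_class R.indexed_var_closed E.ip_eval_var)

text \<open>Multiplicativity of the target grading is asked only for values of f, because the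
  induction peels off one variable at a time. The targets will be U and the symmetric algebra of (U
  \<otimes> V)_1.\<close>

lemma sym_lift_grade:
  assumes sub: "\<And>n. submodule (Bg n) A B" and one: "\<one>\<^bsub>B\<^esub> \<in> Bg 0"
    and var: "\<And>x b n. x \<in> carrier M \<Longrightarrow> b \<in> Bg n \<Longrightarrow> f x \<otimes>\<^bsub>B\<^esub> b \<in> Bg (Suc n)"
  shows "s \<in> Sg n \<Longrightarrow> sym_lift A B f s \<in> Bg n"
proof (induction n arbitrary: s)
  case 0
  then obtain a where a: "a \<in> carrier A" "s = a \<odot>\<^bsub>S\<^esub> \<one>\<^bsub>S\<^esub>" unfolding sym_grading_zero by blast
  show ?case unfolding a(2) sym_lift_scalar[OF a(1)] by (rule submodule.smult_closed[OF sub a(1) one])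
next
  case (Suc n)
  from Suc.prems show ?case
  proof (induction rule: sym_grade_Suc_induct)
    case (var x t)
    show ?case
      unfolding sym_lift_mult[OF sym_var_closed[OF var(1)] sym_grading_closed[OF var(2)]] sym_lift_var[OF var(1)]
      by (rule assms(3)[OF var(1) Suc.IH[OF var(2)]])
  next
    case (add s t)
    show ?case unfolding sym_lift_add[OF add(1,2)]
      by (rule B.subgroup_add[OF submodule_subgroup[OF sub] add(3,4)])
  qed
qed

lemma sym_lift_linear: "linear_map A S B (sym_lift A B f)"
proof -
  interpret S: algebra A S by (rule sym_is_algebra)
  show ?thesis
  proof (intro linear_mapI additive_mapI sym_lift_closed sym_lift_add)
    fix a s assume as: "a \<in> carrier A" "s \<in> carrier S"
    then have "a \<odot>\<^bsub>S\<^esub> s = (a \<odot>\<^bsub>S\<^esub> \<one>\<^bsub>S\<^esub>) \<otimes>\<^bsub>S\<^esub> s" by (simp add: S.smult_one_mult)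
    then show "sym_lift A B f (a \<odot>\<^bsub>S\<^esub> s) = a \<odot>\<^bsub>B\<^esub> sym_lift A B f s"
      using as sym_lift_closed by (simp add: sym_lift_mult sym_lift_scalar B.smult_one_mult)
  qed
qed

end

section \<open>The presentation of a standard module\<close>

text \<open>The degree-one part is written \<open>Ug 1\<close>; it must not be rewritten to \<open>Ug (Suc 0)\<close>.\<close>

declare One_nat_def [simp del]

text \<open>Pushes membership from generators to the subgroup they span. It will carry
  decomposability through \<open>\<Phi>\<close> when the other factor has degree zero.\<close>

lemma additive_map_span:
  assumes "abelian_group M" "abelian_group N" "additive_map M N h" "S \<subseteq> carrier M"
    and "subgroup H (add_monoid N)" "\<And>s. s \<in> S \<Longrightarrow> h s \<in> H" "z \<in> generate (add_monoid M) S"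
  shows "h z \<in> H"
proof -
  interpret M: abelian_group M by fact
  interpret N: abelian_group N by fact
  have "z \<in> carrier M \<and> h z \<in> H" using assms(7)
  proof induction
    case one
    then show ?case using additive_zero[OF assms(1-3)] N.subgroup_zero[OF assms(5)] by simp
  next
    case (incl s)
    then show ?case using assms(4,6) by auto
  next
    case (inv s)
    then have "h (\<ominus>\<^bsub>M\<^esub> s) = \<ominus>\<^bsub>N\<^esub> h s" using additive_minus[OF assms(1-3)] assms(4) by blast
    then show ?case
      using inv assms(4) N.subgroup_neg[OF assms(5) assms(6)[OF inv]] M.a_inv_closed[of s]
      by (auto simp: a_inv_def)
  next
    case (eng s t)
    then show ?case using additive_map_add[OF assms(3)] N.subgroup_add[OF assms(5)] by simp
  qed
  then show ?thesis ..
qed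

lemma grade_module_simps [simp]:
  "carrier (grade_module M Mg n) = Mg n" "ring.add (grade_module M Mg n) = ring.add M"
  "ring.zero (grade_module M Mg n) = ring.zero M" "smult (grade_module M Mg n) = smult M"
  by (simp_all add: grade_module_def)

lemma grade_module_module: "module A M \<Longrightarrow> submodule (Mg n) A M \<Longrightarrow> module A (grade_module M Mg n)"
  unfolding grade_module_def by (rule submodule.submodule_is_module)

lemma grade_module_inclusion:
  assumes "submodule (Mg n) A M"
  shows "linear_map A (grade_module M Mg n) M (\<lambda>x. x)"
  using subgroup.subset[OF submodule_subgroup[OF assms]] by (auto simp: linear_map_def additive_map_def)

text \<open>The record types are narrowed to \<open>module\<close>, those for which
  \<open>relation_type\<close> and its ingredients are declared.\<close>

locale presented_module = standard_module_over_algebra A U Ug F Fg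
  for A :: "('a, 'r) ring_scheme" (structure)
    and U :: "('a, 'u) module" and Ug :: "nat \<Rightarrow> 'u set"
    and F :: "('u, 'f) module" and Fg :: "nat \<Rightarrow> 'f set"
begin

abbreviation "M1 \<equiv> grade_module U Ug 1"
abbreviation "D \<equiv> degree_zero U F Fg"
abbreviation "Dg \<equiv> (\<lambda>q :: nat. if q = 0 then Fg 0 else {\<zero>\<^bsub>F\<^esub>})"

sublocale SA: symmetric_lift A M1 U "\<lambda>x. x"
proof -
  have "module A M1" by (intro grade_module_module UA.module_axioms UA.submodule_grade)
  then show "symmetric_lift A M1 U (\<lambda>x. x)"
    by (intro symmetric_lift.intro symmetric_algebra.intro symmetric_lift_axioms.intro
        UA.algebra_axioms grade_module_inclusion UA.submodule_grade)
qed

abbreviation "ev \<equiv> sym_eval A U"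

lemma sym_degree_one_eq: "sym_degree_one A U Ug = SA.S"
  by (simp add: sym_degree_one_def)

lemma degree_zero_simps [simp]:
  "carrier D = Fg 0" "ring.add D = ring.add F" "ring.zero D = \<zero>\<^bsub>F\<^esub>" "smult D = smult F'"
  by (simp_all add: degree_zero_def)

lemma degree_zero_module: "module A D"
  unfolding degree_zero_def by (intro grade_module_module restricted_module restricted_submodule)

lemma degree_zero_inclusion: "linear_map A D F' (\<lambda>x. x)"
  unfolding degree_zero_def by (rule grade_module_inclusion[OF restricted_submodule])

lemma degree_zero_family: "submodule (Dg q) A D"
proof -
  interpret D: module A D by (rule degree_zero_module)
  show ?thesis
  proof (cases "q = 0")
    case True
    then show ?thesis using D.carrier_is_submodule by simp
  next
    case False
    have "submodule {\<zero>\<^bsub>D\<^esub>} A D" 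
      by (rule D.submoduleI) (use D.M.zero_closed D.M.minus_equality[of "\<zero>\<^bsub>D\<^esub>" "\<zero>\<^bsub>D\<^esub>"] in auto)
    then show ?thesis using False by simp
  qed
qed

sublocale S: algebra A SA.S by (rule SA.sym_is_algebra)

sublocale SD: submodule_family_pair A SA.S D SA.Sg Dg
  by (intro submodule_family_pair.intro module_pair.intro submodule_family_pair_axioms.intro
      degree_zero_module degree_zero_family SA.sym_grading_submodule
      S.module_axioms)

sublocale UDm: module_pair A U D
  by (intro module_pair.intro degree_zero_module UA.module_axioms)

sublocale SU: module_pair_map A SA.S D U D ..

section \<open>The morphism \<alpha> and homogeneous preimages\<close>

lemma ev_linear: "linear_map A SA.S U ev"
  unfolding sym_eval_eq_lift by (rule SA.sym_lift_linear)

lemma ev_mult: "s \<in> carrier SA.S \<Longrightarrow> t \<in> carrier SA.S \<Longrightarrow> ev (s \<otimes>\<^bsub>SA.S\<^esub> t) = ev s \<otimes>\<^bsub>U\<^esub> ev t"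
  unfolding sym_eval_eq_lift by (rule SA.sym_lift_mult)

lemma ev_var: "u \<in> Ug 1 \<Longrightarrow> ev (SA.svar u) = u"
  unfolding sym_eval_eq_lift using SA.sym_lift_var by simp

lemma ev_scalar: "a \<in> carrier A \<Longrightarrow> ev (a \<odot>\<^bsub>SA.S\<^esub> \<one>\<^bsub>SA.S\<^esub>) = a \<odot>\<^bsub>U\<^esub> \<one>\<^bsub>U\<^esub>"
  unfolding sym_eval_eq_lift by (rule SA.sym_lift_scalar)

lemmas ev_closed = linear_map_closed[OF ev_linear]
lemmas ev_add = linear_map_add[OF ev_linear]

lemma ev_grade: "s \<in> SA.Sg n \<Longrightarrow> ev s \<in> Ug n"
  unfolding sym_eval_eq_lift
proof (rule SA.sym_lift_grade[where Bg = Ug, OF UA.submodule_grade UA.one_grade])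
  fix x b n assume "x \<in> carrier M1" and b: "b \<in> Ug n"
  then have "x \<in> Ug 1" by simp
  from UA.mult_grade[OF this b] show "x \<otimes>\<^bsub>U\<^esub> b \<in> Ug (Suc n)" by (simp add: One_nat_def)
qed

text \<open>The algebra U is generated by scalars and by U_1, which are the values of
  \<open>ev\<close> at scalars and at variables.\<close>

lemma ev_surj:
  assumes "u \<in> carrier U"
  shows "\<exists>s \<in> carrier SA.S. ev s = u"
proof -
  have "u \<in> generate_ring U ((\<lambda>a. a \<odot>\<^bsub>U\<^esub> \<one>\<^bsub>U\<^esub>) ` carrier A \<union> Ug 1)"
    using assms UA.generated by blast
  then show ?thesis
  proof induction
    case one
    have "ev (\<one> \<odot>\<^bsub>SA.S\<^esub> \<one>\<^bsub>SA.S\<^esub>) = \<one>\<^bsub>U\<^esub>" using ev_scalar[of \<one>] by simp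
    then show ?case by (intro bexI[of _ "\<one> \<odot>\<^bsub>SA.S\<^esub> \<one>\<^bsub>SA.S\<^esub>"]) simp_all
  next
    case (incl h)
    then show ?case
    proof
      assume "h \<in> (\<lambda>a. a \<odot>\<^bsub>U\<^esub> \<one>\<^bsub>U\<^esub>) ` carrier A"
      then obtain a where a: "a \<in> carrier A" "h = a \<odot>\<^bsub>U\<^esub> \<one>\<^bsub>U\<^esub>" by blast
      show ?thesis unfolding a(2) ev_scalar[OF a(1), symmetric]
        by (intro bexI[of _ "a \<odot>\<^bsub>SA.S\<^esub> \<one>\<^bsub>SA.S\<^esub>"] refl S.smult_closed[OF a(1) S.one_closed])
    next
      assume "h \<in> Ug 1"
      then show ?thesis using ev_var SA.sym_var_closed by (intro bexI[of _ "SA.svar h"]) auto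
    qed
  next
    case (a_inv h)
    then obtain s where s: "s \<in> carrier SA.S" "ev s = h" by blast
    have "ev (\<ominus>\<^bsub>SA.S\<^esub> s) = \<ominus>\<^bsub>U\<^esub> h"
      unfolding s(2)[symmetric]
      by (rule additive_minus[OF S.abelian_group_axioms UA.abelian_group_axioms
            linear_map_additive[OF ev_linear] s(1)])
    then show ?case by (intro bexI[of _ "\<ominus>\<^bsub>SA.S\<^esub> s"] S.a_inv_closed[OF s(1)])
  next
    case (eng_add h k)
    then obtain s t where st: "s \<in> carrier SA.S" "ev s = h" "t \<in> carrier SA.S" "ev t = k" by blast
    show ?case unfolding st(2,4)[symmetric] ev_add[OF st(1,3), symmetric]
      by (intro bexI[of _ "s \<oplus>\<^bsub>SA.S\<^esub> t"] refl S.a_closed[OF st(1,3)])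
  next
    case (eng_mult h k)
    then obtain s t where st: "s \<in> carrier SA.S" "ev s = h" "t \<in> carrier SA.S" "ev t = k" by blast
    show ?case unfolding st(2,4)[symmetric] ev_mult[OF st(1,3), symmetric]
      by (intro bexI[of _ "s \<otimes>\<^bsub>SA.S\<^esub> t"] refl S.m_closed[OF st(1,3)])
  qed
qed

text \<open>Supplies the inductive step of \<open>ev_component\<close>, where a preimage is
  multiplied by a variable.\<close>

lemma component_mult_degree_one:
  assumes "x \<in> Ug 1" "u \<in> carrier U"
  shows "component U Ug (Suc p) (x \<otimes>\<^bsub>U\<^esub> u) = x \<otimes>\<^bsub>U\<^esub> component U Ug p u"
    and "component U Ug 0 (x \<otimes>\<^bsub>U\<^esub> u) = \<zero>\<^bsub>U\<^esub>"
proof -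
  have x: "x \<in> carrier U" using assms UD.grade_carrier by blast
  have "component U Ug (Suc p) (x \<otimes>\<^bsub>U\<^esub> u) = x \<otimes>\<^bsub>U\<^esub> component U Ug p u \<and>
      component U Ug 0 (x \<otimes>\<^bsub>U\<^esub> u) = \<zero>\<^bsub>U\<^esub>"
    using assms(2)
  proof (induction rule: UD.grade_induct)
    case (homogeneous n u)
    have "x \<otimes>\<^bsub>U\<^esub> u \<in> Ug (1 + n)" using assms(1) homogeneous by (rule UA.mult_grade)
    then show ?case using homogeneous x UD.component_homogeneous[of "x \<otimes>\<^bsub>U\<^esub> u" "1 + n"] UD.grade_carrier
      by (simp add: UD.component_homogeneous)
  next
    case (add u v)
    then show ?case using x by (simp add: UA.r_distr additive_map_add[OF UD.component_additive])
  qed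
  then show "component U Ug (Suc p) (x \<otimes>\<^bsub>U\<^esub> u) = x \<otimes>\<^bsub>U\<^esub> component U Ug p u"
    and "component U Ug 0 (x \<otimes>\<^bsub>U\<^esub> u) = \<zero>\<^bsub>U\<^esub>" by simp_all
qed

text \<open>Surjectivity of \<open>ev\<close> yields a preimage of an element of U_p, but not a
  homogeneous one. As \<open>sym_grading\<close> is handled only as a family of submodules, the
  preimage is not projected to degree p; homogeneous preimages of all components are built along
  \<open>sym_induct\<close> instead.\<close>

lemma ev_component:
  assumes "s \<in> carrier SA.S"
  shows "\<exists>t \<in> SA.Sg p. ev t = component U Ug p (ev s)"
proof -
  have zero: "ev \<zero>\<^bsub>SA.S\<^esub> = \<zero>\<^bsub>U\<^esub>"
    by (rule additive_zero[OF S.abelian_group_axioms UA.abelian_group_axioms linear_map_additive[OF ev_linear]])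
  have zg: "\<zero>\<^bsub>SA.S\<^esub> \<in> SA.Sg q" for q
    by (rule S.subgroup_zero[OF submodule_subgroup[OF SA.sym_grading_submodule]])
  \<comment> \<open>All p are treated at once, since multiplication by a variable leads from degree
    q to degree q + 1.\<close>
  have "\<forall>p. \<exists>t \<in> SA.Sg p. ev t = component U Ug p (ev s)"
    using assms
  proof (induction rule: SA.sym_induct)
    case (scalar a)
    show ?case
    proof
      fix p
      have c: "component U Ug p (a \<odot>\<^bsub>U\<^esub> \<one>\<^bsub>U\<^esub>) = (if p = 0 then a \<odot>\<^bsub>U\<^esub> \<one>\<^bsub>U\<^esub> else \<zero>\<^bsub>U\<^esub>)"
        by (rule UD.component_homogeneous[OF UA.smult_one_grade[OF scalar]])
      show "\<exists>t \<in> SA.Sg p. ev t = component U Ug p (ev (a \<odot>\<^bsub>SA.S\<^esub> \<one>\<^bsub>SA.S\<^esub>))"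
      proof (cases "p = 0")
        case True
        then show ?thesis using c scalar ev_scalar[OF scalar] SA.sym_grading_zero
          by (intro bexI[of _ "a \<odot>\<^bsub>SA.S\<^esub> \<one>\<^bsub>SA.S\<^esub>"]) auto
      next
        case False
        then show ?thesis using c ev_scalar[OF scalar] zero zg by (intro bexI[of _ "\<zero>\<^bsub>SA.S\<^esub>"]) auto
      qed
    qed
  next
    case (add s s')
    show ?case
    proof
      fix p
      obtain t t' where t: "t \<in> SA.Sg p" "ev t = component U Ug p (ev s)"
        "t' \<in> SA.Sg p" "ev t' = component U Ug p (ev s')" using add by blast
      then have "ev (t \<oplus>\<^bsub>SA.S\<^esub> t') = component U Ug p (ev (s \<oplus>\<^bsub>SA.S\<^esub> s'))"
        using add SA.sym_grading_closed ev_closed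
        by (simp add: ev_add additive_map_add[OF UD.component_additive])
      moreover have "t \<oplus>\<^bsub>SA.S\<^esub> t' \<in> SA.Sg p"
        using t by (intro S.subgroup_add[OF submodule_subgroup[OF SA.sym_grading_submodule]])
      ultimately show "\<exists>t \<in> SA.Sg p. ev t = component U Ug p (ev (s \<oplus>\<^bsub>SA.S\<^esub> s'))" by blast
    qed
  next
    case (var x s)
    then have x: "x \<in> Ug 1" by simp
    have e: "ev (SA.svar x \<otimes>\<^bsub>SA.S\<^esub> s) = x \<otimes>\<^bsub>U\<^esub> ev s"
      using var SA.sym_var_closed by (simp add: ev_mult ev_var)
    show ?case
    proof
      fix p
      show "\<exists>t \<in> SA.Sg p. ev t = component U Ug p (ev (SA.svar x \<otimes>\<^bsub>SA.S\<^esub> s))"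
      proof (cases p)
        case 0
        then show ?thesis using e component_mult_degree_one(2)[OF x ev_closed[OF var(2)]] zero zg
          by (intro bexI[of _ "\<zero>\<^bsub>SA.S\<^esub>"]) auto
      next
        case (Suc q)
        obtain t where t: "t \<in> SA.Sg q" "ev t = component U Ug q (ev s)" using var by blast
        then have "ev (SA.svar x \<otimes>\<^bsub>SA.S\<^esub> t) = component U Ug p (ev (SA.svar x \<otimes>\<^bsub>SA.S\<^esub> s))"
          using e component_mult_degree_one(1)[OF x ev_closed[OF var(2)]] Suc var(1) SA.sym_var_closed
            SA.sym_grading_closed by (simp add: ev_mult ev_var)
        then show ?thesis using SA.sym_var_mult_grade[OF var(1) t(1)] Suc by blast
      qed
    qed
  qed
  then show ?thesis ..
qed

lemma ev_grade_surj:
  assumes "u \<in> Ug p"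
  shows "\<exists>s \<in> SA.Sg p. ev s = u"
proof -
  obtain s where "s \<in> carrier SA.S" "ev s = u" using ev_surj UD.grade_carrier[OF assms] by blast
  then show ?thesis using ev_component[of s p] UD.component_homogeneous[OF assms, of p] by simp
qed

section \<open>The presentation map and its grading\<close>

abbreviation "\<gamma> \<equiv> presentation_map A U F Fg"

lemma action_degree_zero: "bilinear_map A U D F' (\<odot>\<^bsub>F\<^esub>)"
  using bilinear_map_comp[OF action_bilinear linear_map_id degree_zero_inclusion] .

text \<open>F and \<open>F'\<close> share their additive monoid; with the lift written for
  \<open>F'\<close>, linearity over A becomes available.\<close>

lemma presentation_map_eq:
  "\<gamma> z = tensor_lift (add_monoid F') (\<odot>\<^bsub>F\<^esub>) (tensor_map A U D ev (\<lambda>x. x) z)"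
proof -
  have "tensor_lift (add_monoid F) (\<odot>\<^bsub>F\<^esub>) = tensor_lift (add_monoid F') (\<odot>\<^bsub>F\<^esub>)"
    by (rule tensor_lift_cong_structure) simp_all
  then show ?thesis by (simp add: presentation_map_def)
qed

lemma presentation_map_linear: "linear_map A SD.T F' \<gamma>"
  unfolding presentation_map_eq[abs_def]
  by (rule linear_map_comp[OF SU.tensor_map_linear[OF ev_linear linear_map_id]
        UDm.tensor_lift_linear[OF restricted_module action_degree_zero]])

lemma presentation_map_pure:
  assumes "s \<in> carrier SA.S" "x \<in> Fg 0"
  shows "\<gamma> (SD.pt s x) = ev s \<odot>\<^bsub>F\<^esub> x"
proof -
  have x: "x \<in> carrier D" using assms(2) by simp
  show ?thesis
    unfolding presentation_map_eq SU.tensor_map_pure[OF ev_linear linear_map_id assms(1) x]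
    by (rule UDm.tensor_lift_bilinear_pure[OF restricted_module action_degree_zero ev_closed[OF assms(1)] x])
qed

lemma presentation_map_closed: "z \<in> carrier SD.T \<Longrightarrow> \<gamma> z \<in> carrier F"
  using linear_map_closed[OF presentation_map_linear] by simp

lemma presentation_map_add:
  "z \<in> carrier SD.T \<Longrightarrow> z' \<in> carrier SD.T \<Longrightarrow> \<gamma> (z \<oplus>\<^bsub>SD.T\<^esub> z') = \<gamma> z \<oplus>\<^bsub>F\<^esub> \<gamma> z'"
  using linear_map_add[OF presentation_map_linear] by simp

lemma presentation_grading_eq: "presentation_grading A U Ug F Fg = SD.Tg"
  by (simp add: presentation_grading_def sym_degree_one_eq)

text \<open>The second factor lives in degree zero only.\<close>

lemma presentation_grade_induct [consumes 1, case_names pure add]: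
  assumes z: "z \<in> SD.Tg n" and pure: "\<And>s x. s \<in> SA.Sg n \<Longrightarrow> x \<in> Fg 0 \<Longrightarrow> Q (SD.pt s x)"
    and add: "\<And>z z'. z \<in> carrier SD.T \<Longrightarrow> z' \<in> carrier SD.T \<Longrightarrow> Q z \<Longrightarrow> Q z' \<Longrightarrow> Q (z \<oplus>\<^bsub>SD.T\<^esub> z')"
  shows "Q z"
  using z
proof (induction rule: SD.tensor_grading_induct)
  case (pure s x p q)
  show ?case
  proof (cases "q = 0")
    case True
    then show ?thesis using pure assms(2) by simp
  next
    case False
    \<comment> \<open>For q > 0 the second factor is zero, and the tensor is rewritten as 0
      \<otimes> 0 with its left zero taken in degree n.\<close>
    then have x: "x = \<zero>\<^bsub>D\<^esub>" using pure by simp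
    have "\<zero>\<^bsub>SA.S\<^esub> \<in> SA.Sg n" by (rule S.subgroup_zero[OF submodule_subgroup[OF SA.sym_grading_submodule]])
    moreover have "\<zero>\<^bsub>D\<^esub> \<in> Fg 0" using SD.N.zero_closed by simp
    ultimately have "Q (SD.pt \<zero>\<^bsub>SA.S\<^esub> \<zero>\<^bsub>D\<^esub>)" by (rule assms(2))
    moreover have "SD.pt s x = SD.pt \<zero>\<^bsub>SA.S\<^esub> \<zero>\<^bsub>D\<^esub>"
      unfolding x SD.pure_zero_left[OF SD.N.zero_closed]
      by (rule SD.pure_zero_right[OF SA.sym_grading_closed[OF pure(1)]])
    ultimately show ?thesis by (simp only:)
  qed
qed (rule add)

lemma presentation_map_grade: "z \<in> SD.Tg n \<Longrightarrow> \<gamma> z \<in> Fg n"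
proof (induction rule: presentation_grade_induct)
  case (pure s x)
  then show ?case
    using presentation_map_pure SA.sym_grading_closed FM.smult_grade[OF ev_grade, of s n x 0] by simp
next
  case (add z z')
  then show ?case by (simp add: presentation_map_add FM.M.subgroup_add[OF FD.grade_subgroup])
qed

lemma presentation_map_surj:
  assumes "x \<in> Fg n"
  shows "\<exists>z \<in> SD.Tg n. \<gamma> z = x"
  using assms
proof (induction rule: grade_smult_induct)
  case (smult u x)
  obtain s where s: "s \<in> SA.Sg n" "ev s = u" using ev_grade_surj smult by blast
  have "SD.pt s x \<in> SD.Tg (n + 0)" using s(1) smult(2) by (intro SD.pure_grade) simp_all
  then show ?case using s smult presentation_map_pure[OF SA.sym_grading_closed]
    by (intro bexI[of _ "SD.pt s x"]) auto
next
  case (add x x')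
  then obtain z z' where z: "z \<in> SD.Tg n" "\<gamma> z = x" "z' \<in> SD.Tg n" "\<gamma> z' = x'" by blast
  then have "\<gamma> (z \<oplus>\<^bsub>SD.T\<^esub> z') = x \<oplus>\<^bsub>F\<^esub> x'" by (simp add: presentation_map_add SD.tensor_grading_carrier)
  moreover have "z \<oplus>\<^bsub>SD.T\<^esub> z' \<in> SD.Tg n" using z by (intro SD.T.subgroup_add[OF SD.tensor_grading_subgroup])
  ultimately show ?case by blast
qed

abbreviation "act s \<equiv> tensor_map A SA.S D (\<lambda>t. s \<otimes>\<^bsub>SA.S\<^esub> t) (\<lambda>x. x)"

sublocale SS: module_pair_map A SA.S D SA.S D ..

lemma act_linear:
  assumes "s \<in> carrier SA.S"
  shows "linear_map A SD.T SD.T (act s)"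
  by (rule SS.tensor_map_linear[OF bilinear_map_right[OF algebra_mult_bilinear[OF SA.sym_is_algebra] assms] linear_map_id])

lemma act_pure:
  assumes "s \<in> carrier SA.S" "t \<in> carrier SA.S" "x \<in> Fg 0"
  shows "act s (SD.pt t x) = SD.pt (s \<otimes>\<^bsub>SA.S\<^esub> t) x"
  using assms
  by (intro SS.tensor_map_pure[OF bilinear_map_right[OF algebra_mult_bilinear[OF SA.sym_is_algebra]] linear_map_id]) simp_all

lemmas act_closed = linear_map_closed[OF act_linear]
lemmas act_add = linear_map_add[OF act_linear]

text \<open>\<open>act\<close> is built separately for each scalar, so additivity in the scalar is a
  further fact. It serves to split an element of (U \<otimes> V)_1 into summands.\<close>

lemma act_add_scalar:
  assumes "s \<in> carrier SA.S" "s' \<in> carrier SA.S" "z \<in> carrier SD.T"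
  shows "act (s \<oplus>\<^bsub>SA.S\<^esub> s') z = act s z \<oplus>\<^bsub>SD.T\<^esub> act s' z"
  using assms(3)
proof (induction rule: SD.tensor_induct)
  case (pure t x)
  then show ?case using assms(1,2) by (simp add: act_pure S.l_distr SD.pure_add_left)
next
  case (add z z')
  then show ?case using assms(1,2) by (simp add: act_add act_closed SD.T.a_ac)
qed

lemma act_grade:
  assumes "u \<in> Ug 1" "z \<in> SD.Tg n"
  shows "act (SA.svar u) z \<in> SD.Tg (Suc n)"
proof -
  have u: "u \<in> carrier M1" using assms(1) by simp
  note uS = SA.sym_var_closed[OF u]
  from assms(2) show ?thesis
  proof (induction rule: presentation_grade_induct)
    case (pure s x)
    have "SD.pt (SA.svar u \<otimes>\<^bsub>SA.S\<^esub> s) x \<in> SD.Tg (Suc n + 0)"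
      using SA.sym_var_mult_grade[OF u pure(1)] pure(2) by (intro SD.pure_grade) simp_all
    then show ?case unfolding act_pure[OF uS SA.sym_grading_closed[OF pure(1)] pure(2)] by simp
  next
    case (add z z')
    show ?case unfolding act_add[OF uS add(1,2)]
      by (rule SD.T.subgroup_add[OF SD.tensor_grading_subgroup add(3,4)])
  qed
qed

lemma presentation_grade_Suc_induct [consumes 1, case_names act add]:
  assumes z: "z \<in> SD.Tg (Suc n)"
    and act: "\<And>u z. u \<in> Ug 1 \<Longrightarrow> z \<in> SD.Tg n \<Longrightarrow> Q (act (SA.svar u) z)"
    and add: "\<And>z z'. z \<in> carrier SD.T \<Longrightarrow> z' \<in> carrier SD.T \<Longrightarrow> Q z \<Longrightarrow> Q z' \<Longrightarrow> Q (z \<oplus>\<^bsub>SD.T\<^esub> z')"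
  shows "Q z"
  using z
proof (induction rule: presentation_grade_induct)
  case (pure s x)
  from pure(1) show ?case
  proof (induction rule: SA.sym_grade_Suc_induct)
    case (var u t)
    have "SD.pt t x \<in> SD.Tg (n + 0)" using var pure(2) by (intro SD.pure_grade) simp_all
    then have "Q (act (SA.svar u) (SD.pt t x))" using var by (intro act) simp_all
    then show ?case using var pure(2) SA.sym_var_closed SA.sym_grading_closed by (simp add: act_pure)
  next
    case (add s t)
    then show ?case using pure(2) assms(3) by (simp add: SD.pure_add_left)
  qed
qed (rule add)

section \<open>Relations and decomposable relations\<close>

abbreviation "K \<equiv> presentation_kernel A U Ug F Fg"

text \<open>The subgroup U_1 K(F)_n by which E(F) is divided in degree n + 1. The index is the
  degree of the relations being multiplied, one below that of the products.\<close>

definition decomposable_relations :: "nat \<Rightarrow> ('a, 'u, 'f) presentation set" where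
  "decomposable_relations n =
     generate (add_monoid SD.T) {act (SA.svar u) z | u z. u \<in> Ug 1 \<and> z \<in> K n}"

lemma kernel_eq: "K n = {z \<in> SD.Tg n. \<gamma> z = \<zero>\<^bsub>F\<^esub>}"
  by (simp add: presentation_kernel_def presentation_grading_eq)

lemma kernel_carrier: "z \<in> K n \<Longrightarrow> z \<in> carrier SD.T"
  using SD.tensor_grading_carrier by (auto simp: kernel_eq)

text \<open>Measures the ambiguity of a homogeneous lift. The additive form z' = z + k is the one
  into which \<open>\<Phi>\<close> expands.\<close>

lemma kernel_difference:
  assumes z: "z \<in> SD.Tg n" "z' \<in> SD.Tg n" "\<gamma> z' = \<gamma> z"
  shows "\<exists>k \<in> K n. z' = z \<oplus>\<^bsub>SD.T\<^esub> k"
proof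
  let ?k = "\<ominus>\<^bsub>SD.T\<^esub> z \<oplus>\<^bsub>SD.T\<^esub> z'"
  note zc = SD.tensor_grading_carrier[OF z(1)] and zc' = SD.tensor_grading_carrier[OF z(2)]
  have "?k \<in> SD.Tg n"
    by (intro SD.T.subgroup_add[OF SD.tensor_grading_subgroup]
        SD.T.subgroup_neg[OF SD.tensor_grading_subgroup] z)
  moreover have "\<gamma> (z \<oplus>\<^bsub>SD.T\<^esub> ?k) = \<gamma> z"
    using zc zc' z(3) by (simp add: SD.T.a_assoc[symmetric] SD.T.r_neg)
  then have "\<gamma> z \<oplus>\<^bsub>F\<^esub> \<gamma> ?k = \<gamma> z"
    using presentation_map_add[OF zc, of ?k] zc zc' by simp
  then have "\<gamma> ?k = \<zero>\<^bsub>F\<^esub>"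
    using presentation_map_closed[OF zc] presentation_map_closed[of ?k] zc zc'
    by (simp add: FM.M.add.r_cancel_one)
  ultimately show "?k \<in> K n" unfolding kernel_eq by blast
  show "z' = z \<oplus>\<^bsub>SD.T\<^esub> ?k" using zc zc' by (simp add: SD.T.a_assoc[symmetric] SD.T.r_neg)
qed

lemma decomposable_generators:
  "{act (SA.svar u) z | u z. u \<in> Ug 1 \<and> z \<in> K n} \<subseteq> carrier SD.T"
  using act_closed SA.sym_var_closed kernel_carrier by auto

lemma decomposable_subgroup: "subgroup (decomposable_relations n) (add_monoid SD.T)"
  unfolding decomposable_relations_def by (rule SD.T.span_subgroup[OF decomposable_generators])

lemma decomposable_act: "u \<in> Ug 1 \<Longrightarrow> z \<in> K n \<Longrightarrow> act (SA.svar u) z \<in> decomposable_relations n"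
  unfolding decomposable_relations_def by (rule SD.T.span_incl) blast

text \<open>The quotient is zero when the coset of each relation is the subgroup itself. Degrees n +
  1 suffice, as \<open>top_degree\<close> looks only at degrees from 2 on.\<close>

lemma effective_relations_trivial_iff:
  "carrier (effective_relations A U Ug F Fg (Suc n)) = {\<zero>\<^bsub>effective_relations A U Ug F Fg (Suc n)\<^esub>} \<longleftrightarrow>
     K (Suc n) \<subseteq> decomposable_relations n"
proof -
  let ?N = "decomposable_relations n"
  have N: "smult_span (extend_scalars A SA.S D) (SA.svar ` Ug 1) (K n) = ?N"
  proof -
    have "smult_span (extend_scalars A SA.S D) (SA.svar ` Ug 1) (K n) =
        generate (add_monoid SD.T) {s \<odot>\<^bsub>extend_scalars A SA.S D\<^esub> z | s z. s \<in> SA.svar ` Ug 1 \<and> z \<in> K n}"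
      unfolding smult_span_def by (rule span_cong_structure) (simp_all add: extend_scalars_def Let_def)
    also have "{s \<odot>\<^bsub>extend_scalars A SA.S D\<^esub> z | s z. s \<in> SA.svar ` Ug 1 \<and> z \<in> K n} =
        {act (SA.svar u) z | u z. u \<in> Ug 1 \<and> z \<in> K n}"
      by (auto simp: extend_scalars_def Let_def)
    finally show ?thesis by (simp add: decomposable_relations_def)
  qed
  have E: "effective_relations A U Ug F Fg (Suc n) = quotient_module (SD.T\<lparr>carrier := K (Suc n)\<rparr>) ?N"
    by (simp add: effective_relations_def sym_degree_one_eq N)
  \<comment> \<open>Replacing the carrier of T restricts which cosets are formed, not the cosets
    themselves.\<close>
  have carr: "carrier (effective_relations A U Ug F Fg (Suc n)) = (\<lambda>z. ?N +>\<^bsub>SD.T\<^esub> z) ` K (Suc n)"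
    by (auto simp: E quotient_module_def A_RCOSETS_def RCOSETS_def a_r_coset_def r_coset_def)
  have zero: "\<zero>\<^bsub>effective_relations A U Ug F Fg (Suc n)\<^esub> = ?N"
    by (simp add: E quotient_module_def)
  have sg: "additive_subgroup ?N SD.T" by (rule additive_subgroup.intro[OF decomposable_subgroup])
  interpret Ns: abelian_subgroup ?N SD.T
    by (rule abelian_subgroupI3[OF sg SD.T.abelian_group_axioms])
  have coset: "?N +>\<^bsub>SD.T\<^esub> z = ?N \<longleftrightarrow> z \<in> ?N" if "z \<in> carrier SD.T" for z
    using that Ns.a_rcos_self[OF that] Ns.a_rcos_const by auto
  \<comment> \<open>If there were no relation at all, the set of cosets would be empty instead of
    the zero singleton.\<close>
  have ne: "K (Suc n) \<noteq> {}"
  proof -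
    have "\<zero>\<^bsub>SD.T\<^esub> \<in> SD.Tg (Suc n)" by (rule SD.T.subgroup_zero[OF SD.tensor_grading_subgroup])
    moreover have "\<gamma> \<zero>\<^bsub>SD.T\<^esub> = \<zero>\<^bsub>F\<^esub>"
      using additive_zero[OF SD.T.abelian_group_axioms module.axioms(2)[OF restricted_module]
          linear_map_additive[OF presentation_map_linear]] by simp
    ultimately show ?thesis by (auto simp: kernel_eq)
  qed
  have "(\<lambda>z. ?N +>\<^bsub>SD.T\<^esub> z) ` K (Suc n) = {?N} \<longleftrightarrow> (\<forall>z \<in> K (Suc n). ?N +>\<^bsub>SD.T\<^esub> z = ?N)"
    using ne by blast
  also have "\<dots> \<longleftrightarrow> (\<forall>z \<in> K (Suc n). z \<in> ?N)"
    using coset[OF kernel_carrier] by (intro ball_cong refl)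
  finally show ?thesis unfolding carr zero subset_iff Ball_def .
qed

end

section \<open>Relations of a tensor product\<close>

locale presented_module_pair = standard_module_pair A U Ug F Fg V Vg G Gg
  for A :: "('a, 'r) ring_scheme" (structure)
    and U :: "('a, 'u) module" and Ug :: "nat \<Rightarrow> 'u set"
    and F :: "('u, 'f) module" and Fg :: "nat \<Rightarrow> 'f set"
    and V :: "('a, 'v) module" and Vg :: "nat \<Rightarrow> 'v set"
    and G :: "('v, 'g) module" and Gg :: "nat \<Rightarrow> 'g set"
begin

sublocale FP: presented_module A U Ug F Fg ..
sublocale GP: presented_module A V Vg G Gg ..
sublocale WP: presented_module A W.UV W.Tg FG X.Tg
  by (intro presented_module.intro standard_module_over_algebra.intro
      W.tensor_algebra_standard tensor_module_standard)

abbreviation "eL u \<equiv> W.pt u \<one>\<^bsub>V\<^esub>"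
abbreviation "eR v \<equiv> W.pt \<one>\<^bsub>U\<^esub> v"

lemma eL_grade: "u \<in> Ug 1 \<Longrightarrow> eL u \<in> W.Tg 1"
  using W.pure_grade[OF _ GV.UA.one_grade, of u 1] by simp

lemma eR_grade: "v \<in> Vg 1 \<Longrightarrow> eR v \<in> W.Tg 1"
  using W.pure_grade[OF FU.UA.one_grade, of v 1] by simp

lemma eL_linear: "linear_map A FP.M1 WP.M1 eL"
proof (intro linear_mapI additive_mapI)
  fix u assume u: "u \<in> carrier FP.M1"
  then have uc: "u \<in> carrier U" using FU.UD.grade_carrier[of u 1] by simp
  show "eL u \<in> carrier WP.M1" using u eL_grade by simp
  show "eL (u \<oplus>\<^bsub>FP.M1\<^esub> u') = eL u \<oplus>\<^bsub>WP.M1\<^esub> eL u'" if "u' \<in> carrier FP.M1" for u'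
    using uc that FU.UD.grade_carrier[of u' 1] by (simp add: W.pure_add_left)
  show "eL (a \<odot>\<^bsub>FP.M1\<^esub> u) = a \<odot>\<^bsub>WP.M1\<^esub> eL u" if "a \<in> carrier A" for a
    using uc that by (simp add: W.smult_pure)
qed

lemma eR_linear: "linear_map A GP.M1 WP.M1 eR"
proof (intro linear_mapI additive_mapI)
  fix v assume v: "v \<in> carrier GP.M1"
  then have vc: "v \<in> carrier V" using GV.UD.grade_carrier[of v 1] by simp
  show "eR v \<in> carrier WP.M1" using v eR_grade by simp
  show "eR (v \<oplus>\<^bsub>GP.M1\<^esub> v') = eR v \<oplus>\<^bsub>WP.M1\<^esub> eR v'" if "v' \<in> carrier GP.M1" for v'
    using vc that GV.UD.grade_carrier[of v' 1] by (simp add: W.pure_add_right)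
  show "eR (a \<odot>\<^bsub>GP.M1\<^esub> v) = a \<odot>\<^bsub>WP.M1\<^esub> eR v" if "a \<in> carrier A" for a
    using vc that by (simp add: W.smult_pure_right)
qed

sublocale IL: symmetric_lift A FP.M1 WP.SA.S "\<lambda>u. WP.SA.svar (eL u)"
  by (intro symmetric_lift.intro symmetric_lift_axioms.intro FP.SA.symmetric_algebra_axioms
      WP.SA.sym_is_algebra linear_map_comp[OF eL_linear WP.SA.sym_var_linear])

sublocale IR: symmetric_lift A GP.M1 WP.SA.S "\<lambda>v. WP.SA.svar (eR v)"
  by (intro symmetric_lift.intro symmetric_lift_axioms.intro GP.SA.symmetric_algebra_axioms
      WP.SA.sym_is_algebra linear_map_comp[OF eR_linear WP.SA.sym_var_linear])

abbreviation "iL \<equiv> sym_lift A WP.SA.S (\<lambda>u. WP.SA.svar (eL u))"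
abbreviation "iR \<equiv> sym_lift A WP.SA.S (\<lambda>v. WP.SA.svar (eR v))"

lemma iL_grade: "s \<in> FP.SA.Sg n \<Longrightarrow> iL s \<in> WP.SA.Sg n"
  by (rule IL.sym_lift_grade[where Bg = WP.SA.Sg, OF WP.SA.sym_grading_submodule WP.SA.sym_one_grade
        WP.SA.sym_var_mult_grade[OF linear_map_closed[OF eL_linear]]])

lemma iR_grade: "s \<in> GP.SA.Sg n \<Longrightarrow> iR s \<in> WP.SA.Sg n"
  by (rule IR.sym_lift_grade[where Bg = WP.SA.Sg, OF WP.SA.sym_grading_submodule WP.SA.sym_one_grade
        WP.SA.sym_var_mult_grade[OF linear_map_closed[OF eR_linear]]])

lemma svar_eL_closed: "u \<in> Ug 1 \<Longrightarrow> WP.SA.svar (eL u) \<in> carrier WP.SA.S"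
  using WP.SA.sym_var_closed eL_grade by simp

lemma svar_eR_closed: "v \<in> Vg 1 \<Longrightarrow> WP.SA.svar (eR v) \<in> carrier WP.SA.S"
  using WP.SA.sym_var_closed eR_grade by simp

lemma eL_mult:
  "u \<in> carrier U \<Longrightarrow> u' \<in> carrier U \<Longrightarrow> eL u \<otimes>\<^bsub>W.UV\<^esub> eL u' = eL (u \<otimes>\<^bsub>U\<^esub> u')"
  using W.mult_pure[of u "\<one>\<^bsub>V\<^esub>" u' "\<one>\<^bsub>V\<^esub>"] by simp

lemma eR_mult:
  "v \<in> carrier V \<Longrightarrow> v' \<in> carrier V \<Longrightarrow> eR v \<otimes>\<^bsub>W.UV\<^esub> eR v' = eR (v \<otimes>\<^bsub>V\<^esub> v')"
  using W.mult_pure[of "\<one>\<^bsub>U\<^esub>" v "\<one>\<^bsub>U\<^esub>" v'] by simp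

text \<open>Both sides respect sums and products in s, and they agree on scalars and on variables;
  the variable of u goes to u \<otimes> 1 either way.\<close>

lemma ev_iL: "s \<in> carrier FP.SA.S \<Longrightarrow> WP.ev (iL s) = eL (FP.ev s)"
proof (induction rule: FP.SA.sym_induct)
  case (scalar a)
  show ?case
    unfolding IL.sym_lift_scalar[OF scalar] WP.ev_scalar[OF scalar] FP.ev_scalar[OF scalar]
    using scalar by (simp add: W.smult_pure)
next
  case (add s t)
  show ?case
    unfolding IL.sym_lift_add[OF add(1,2)] FP.ev_add[OF add(1,2)]
      WP.ev_add[OF IL.sym_lift_closed[OF add(1)] IL.sym_lift_closed[OF add(2)]] add(3,4)
    using FP.ev_closed[OF add(1)] FP.ev_closed[OF add(2)] by (simp add: W.pure_add_left)
next
  case (var u s)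
  have u: "u \<in> Ug 1" using var(1) by simp
  show ?case
    unfolding IL.sym_lift_mult[OF FP.SA.sym_var_closed[OF var(1)] var(2)] IL.sym_lift_var[OF var(1)]
      FP.ev_mult[OF FP.SA.sym_var_closed[OF var(1)] var(2)] FP.ev_var[OF u]
      WP.ev_mult[OF svar_eL_closed[OF u] IL.sym_lift_closed[OF var(2)]] WP.ev_var[OF eL_grade[OF u]] var(3)
    by (rule eL_mult[OF FU.UD.grade_carrier[OF u] FP.ev_closed[OF var(2)]])
qed

lemma ev_iR: "s \<in> carrier GP.SA.S \<Longrightarrow> WP.ev (iR s) = eR (GP.ev s)"
proof (induction rule: GP.SA.sym_induct)
  case (scalar a)
  show ?case
    unfolding IR.sym_lift_scalar[OF scalar] WP.ev_scalar[OF scalar] GP.ev_scalar[OF scalar]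
    using scalar by (simp add: W.smult_pure_right)
next
  case (add s t)
  show ?case
    unfolding IR.sym_lift_add[OF add(1,2)] GP.ev_add[OF add(1,2)]
      WP.ev_add[OF IR.sym_lift_closed[OF add(1)] IR.sym_lift_closed[OF add(2)]] add(3,4)
    using GP.ev_closed[OF add(1)] GP.ev_closed[OF add(2)] by (simp add: W.pure_add_right)
next
  case (var v s)
  have v: "v \<in> Vg 1" using var(1) by simp
  show ?case
    unfolding IR.sym_lift_mult[OF GP.SA.sym_var_closed[OF var(1)] var(2)] IR.sym_lift_var[OF var(1)]
      GP.ev_mult[OF GP.SA.sym_var_closed[OF var(1)] var(2)] GP.ev_var[OF v]
      WP.ev_mult[OF svar_eR_closed[OF v] IR.sym_lift_closed[OF var(2)]] WP.ev_var[OF eR_grade[OF v]] var(3)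
    by (rule eR_mult[OF GV.UD.grade_carrier[OF v] GP.ev_closed[OF var(2)]])
qed

section \<open>The product of the two presentations\<close>

abbreviation "\<mu> \<equiv> \<lambda>s t. iL s \<otimes>\<^bsub>WP.SA.S\<^esub> iR t"

lemma \<mu>_bilinear: "bilinear_map A FP.SA.S GP.SA.S WP.SA.S \<mu>"
  by (rule bilinear_map_comp[OF algebra_mult_bilinear[OF WP.SA.sym_is_algebra]
        IL.sym_lift_linear IR.sym_lift_linear])

text \<open>A acts on F \<otimes> G in two ways: by the module structure of the tensor product over
  A, and by restriction along A \<rightarrow> U \<otimes> V. The presentation of F \<otimes> G uses
  the second, the tensor lemmas the first.\<close>

lemma scalar_act:
  assumes "a \<in> carrier A" "z \<in> carrier X.T"
  shows "(a \<odot>\<^bsub>W.UV\<^esub> \<one>\<^bsub>W.UV\<^esub>) \<odot>\<^bsub>FG\<^esub> z = a \<odot>\<^bsub>X.T\<^esub> z"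
  using bilinear_map_smult_left[OF C.bimap_bilinear assms(2,1), of "W.pt \<one>\<^bsub>U\<^esub> \<one>\<^bsub>V\<^esub>"] act_one[OF assms(2)]
  by simp

lemma pure_degree_zero: "x \<in> Fg 0 \<Longrightarrow> y \<in> Gg 0 \<Longrightarrow> X.pt x y \<in> X.Tg 0"
  using X.pure_grade[of x 0 y 0] by simp

lemma degree_zero_bilinear: "bilinear_map A FP.D GP.D WP.D X.pt"
proof (rule bilinear_mapI)
  fix x y assume "x \<in> carrier FP.D" "y \<in> carrier GP.D"
  then have x: "x \<in> Fg 0" and y: "y \<in> Gg 0" by simp_all
  then have xc: "x \<in> carrier F'" and yc: "y \<in> carrier G'"
    using FU.FD.grade_carrier GV.FD.grade_carrier by simp_all
  have pc: "X.pt x y \<in> carrier X.T" using xc yc by (rule X.pure_closed)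
  show "X.pt x y \<in> carrier WP.D" using pure_degree_zero[OF x y] by simp
  show "X.pt (x \<oplus>\<^bsub>FP.D\<^esub> x') y = X.pt x y \<oplus>\<^bsub>WP.D\<^esub> X.pt x' y" if "x' \<in> carrier FP.D" for x'
    using that X.pure_add_left[OF xc _ yc, of x'] FU.FD.grade_carrier[of x' 0] by simp
  show "X.pt x (y \<oplus>\<^bsub>GP.D\<^esub> y') = X.pt x y \<oplus>\<^bsub>WP.D\<^esub> X.pt x y'" if "y' \<in> carrier GP.D" for y'
    using that X.pure_add_right[OF xc yc, of y'] GV.FD.grade_carrier[of y' 0] by simp
  fix a assume a: "a \<in> carrier A"
  have D: "a \<odot>\<^bsub>WP.D\<^esub> X.pt x y = a \<odot>\<^bsub>X.T\<^esub> X.pt x y"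
    using scalar_act[OF a pc] by simp
  show "X.pt (a \<odot>\<^bsub>FP.D\<^esub> x) y = a \<odot>\<^bsub>WP.D\<^esub> X.pt x y"
    unfolding D X.smult_pure[OF a xc yc] by simp
  show "X.pt x (a \<odot>\<^bsub>GP.D\<^esub> y) = a \<odot>\<^bsub>WP.D\<^esub> X.pt x y"
    unfolding D X.smult_pure_right[OF a xc yc] by simp
qed

sublocale PH: module_pair_bimap A FP.SA.S FP.D GP.SA.S GP.D WP.SA.S WP.D \<mu> X.pt
  by (intro module_pair_bimap.intro module_pair_bimap_axioms.intro FP.SD.module_pair_axioms
      GP.SD.module_pair_axioms WP.SD.module_pair_axioms \<mu>_bilinear degree_zero_bilinear)

abbreviation "\<Phi> \<equiv> PH.bm"

lemmas \<Phi>_add_left = bilinear_map_add_left[OF PH.bimap_bilinear]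
lemmas \<Phi>_add_right = bilinear_map_add_right[OF PH.bimap_bilinear]
lemmas \<Phi>_closed = bilinear_map_closed[OF PH.bimap_bilinear]
lemmas \<Phi>_smult_left = bilinear_map_smult_left[OF PH.bimap_bilinear]
lemmas \<Phi>_smult_right = bilinear_map_smult_right[OF PH.bimap_bilinear]

lemma \<Phi>_pure:
  assumes "s \<in> carrier FP.SA.S" "x \<in> Fg 0" "t \<in> carrier GP.SA.S" "y \<in> Gg 0"
  shows "\<Phi> (FP.SD.pt s x) (GP.SD.pt t y) = WP.SD.pt (iL s \<otimes>\<^bsub>WP.SA.S\<^esub> iR t) (X.pt x y)"
  using assms by (intro PH.bimap_pure) simp_all

lemma \<Phi>_grade:
  assumes "z \<in> FP.SD.Tg p" "z' \<in> GP.SD.Tg q"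
  shows "\<Phi> z z' \<in> WP.SD.Tg (p + q)"
proof (rule PH.bimap_grade[OF FP.SD.submodule_family_pair_axioms GP.SD.submodule_family_pair_axioms
      WP.SD.submodule_family_pair_axioms _ _ assms])
  show "\<mu> s t \<in> WP.SA.Sg (i + j)" if "s \<in> FP.SA.Sg i" "t \<in> GP.SA.Sg j" for i j s t
    by (rule WP.SA.sym_mult_grade[OF iL_grade[OF that(1)] iR_grade[OF that(2)]])
  show "X.pt x y \<in> WP.Dg (i + j)" if x: "x \<in> FP.Dg i" and y: "y \<in> GP.Dg j" for i j x y
  proof (cases "i = 0 \<and> j = 0")
    case True
    then show ?thesis using x y pure_degree_zero by simp
  next
    \<comment> \<open>\<open>Dg\<close> is concentrated in degree zero, so one of the two factors is
      zero here.\<close>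
    case False
    have xc: "x \<in> carrier F'" and yc: "y \<in> carrier G'"
      using FP.SD.grade_carrier_N[OF x] GP.SD.grade_carrier_N[OF y]
        FU.FD.grade_carrier GV.FD.grade_carrier by simp_all
    have "x = \<zero>\<^bsub>F'\<^esub> \<or> y = \<zero>\<^bsub>G'\<^esub>" using False x y by (auto split: if_splits)
    then have "X.pt x y = \<zero>\<^bsub>X.T\<^esub>"
      using X.pure_zero_left[OF yc] X.pure_zero_right[OF xc] by blast
    then show ?thesis using False by auto
  qed
qed

text \<open>On pure tensors, the product of \<open>iL s\<close> and \<open>iR t\<close> evaluates to
  the tensor of the values of s and t, which acts on x \<otimes> y factor by factor. So
  \<open>\<Phi>\<close> covers the tensor product of the two presentation maps.\<close>

lemma presentation_map_\<Phi>:
  assumes "z \<in> carrier FP.SD.T" "z' \<in> carrier GP.SD.T"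
  shows "WP.\<gamma> (\<Phi> z z') = X.pt (FP.\<gamma> z) (GP.\<gamma> z')"
  using assms(1)
proof (induction rule: FP.SD.tensor_induct)
  case p1: (pure s x)
  then have x: "x \<in> Fg 0" by simp
  from assms(2) show ?case
  proof (induction rule: GP.SD.tensor_induct)
    case (pure t y)
    then have y: "y \<in> Gg 0" by simp
    have ic: "iL s \<in> carrier WP.SA.S" "iR t \<in> carrier WP.SA.S"
      using IL.sym_lift_closed[OF p1(1)] IR.sym_lift_closed[OF pure(1)] by simp_all
    have ec: "FP.ev s \<in> carrier U" "GP.ev t \<in> carrier V"
      using FP.ev_closed[OF p1(1)] GP.ev_closed[OF pure(1)] by simp_all
    have xc: "x \<in> carrier F" and yc: "y \<in> carrier G"
      using x y FU.FD.grade_carrier GV.FD.grade_carrier by blast+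
    have e: "WP.ev (iL s \<otimes>\<^bsub>WP.SA.S\<^esub> iR t) = W.pt (FP.ev s) (GP.ev t)"
      unfolding WP.ev_mult[OF ic] ev_iL[OF p1(1)] ev_iR[OF pure(1)]
      using W.mult_pure[OF ec(1) GV.UA.one_closed FU.UA.one_closed ec(2)] ec by simp
    show ?case
      unfolding \<Phi>_pure[OF p1(1) x pure(1) y]
        WP.presentation_map_pure[OF WP.S.m_closed[OF ic] pure_degree_zero[OF x y]]
        FP.presentation_map_pure[OF p1(1) x] GP.presentation_map_pure[OF pure(1) y] e
      by (rule act_pure[OF ec xc yc])
  next
    case (add z z')
    have pc: "FP.SD.pt s x \<in> carrier FP.SD.T" using p1 by (rule FP.SD.pure_closed)
    have "WP.\<gamma> (\<Phi> (FP.SD.pt s x) (z \<oplus>\<^bsub>GP.SD.T\<^esub> z')) =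
        WP.\<gamma> (\<Phi> (FP.SD.pt s x) z) \<oplus>\<^bsub>FG\<^esub> WP.\<gamma> (\<Phi> (FP.SD.pt s x) z')"
      unfolding \<Phi>_add_right[OF pc add(1,2)]
      by (rule WP.presentation_map_add[OF \<Phi>_closed[OF pc add(1)] \<Phi>_closed[OF pc add(2)]])
    also have "\<dots> = X.pt (FP.\<gamma> (FP.SD.pt s x)) (GP.\<gamma> (z \<oplus>\<^bsub>GP.SD.T\<^esub> z'))"
      unfolding add(3,4) GP.presentation_map_add[OF add(1,2)]
      using X.pure_add_right[of "FP.\<gamma> (FP.SD.pt s x)" "GP.\<gamma> z" "GP.\<gamma> z'"]
        FP.presentation_map_closed[OF pc] GP.presentation_map_closed[OF add(1)]
        GP.presentation_map_closed[OF add(2)] by simp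
    finally show ?case .
  qed
next
  case (add z w)
  have "WP.\<gamma> (\<Phi> (z \<oplus>\<^bsub>FP.SD.T\<^esub> w) z') = WP.\<gamma> (\<Phi> z z') \<oplus>\<^bsub>FG\<^esub> WP.\<gamma> (\<Phi> w z')"
    unfolding \<Phi>_add_left[OF assms(2) add(1,2)]
    by (rule WP.presentation_map_add[OF \<Phi>_closed[OF add(1) assms(2)] \<Phi>_closed[OF add(2) assms(2)]])
  also have "\<dots> = X.pt (FP.\<gamma> (z \<oplus>\<^bsub>FP.SD.T\<^esub> w)) (GP.\<gamma> z')"
    unfolding add(3,4) FP.presentation_map_add[OF add(1,2)]
    using X.pure_add_left[of "FP.\<gamma> z" "FP.\<gamma> w" "GP.\<gamma> z'"]
      FP.presentation_map_closed[OF add(1)] FP.presentation_map_closed[OF add(2)]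
      GP.presentation_map_closed[OF assms(2)] by simp
  finally show ?case .
qed

text \<open>\<open>iL\<close> sends the variable of u to the variable of u \<otimes> 1, and
  associativity does the rest. Together with its mirror image this turns decomposability in a factor
  into decomposability in the product.\<close>

lemma \<Phi>_act_left:
  assumes u: "u \<in> Ug 1" and z: "z \<in> carrier FP.SD.T" and z': "z' \<in> carrier GP.SD.T"
  shows "\<Phi> (FP.act (FP.SA.svar u) z) z' = WP.act (WP.SA.svar (eL u)) (\<Phi> z z')"
proof -
  have u': "u \<in> carrier FP.M1" using u by simp
  note uS = FP.SA.sym_var_closed[OF u'] and uW = svar_eL_closed[OF u]
  show ?thesis using z
  proof (induction rule: FP.SD.tensor_induct)
    case p1: (pure s x)
    then have x: "x \<in> Fg 0" by simp
    have pc: "FP.SD.pt s x \<in> carrier FP.SD.T" using p1 by (rule FP.SD.pure_closed)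
    from z' show ?case
    proof (induction rule: GP.SD.tensor_induct)
      case (pure t y)
      then have y: "y \<in> Gg 0" by simp
      have ic: "iL s \<in> carrier WP.SA.S" "iR t \<in> carrier WP.SA.S"
        using IL.sym_lift_closed[OF p1(1)] IR.sym_lift_closed[OF pure(1)] by simp_all
      show ?case
        unfolding FP.act_pure[OF uS p1(1) x] \<Phi>_pure[OF FP.S.m_closed[OF uS p1(1)] x pure(1) y]
          \<Phi>_pure[OF p1(1) x pure(1) y] IL.sym_lift_mult[OF uS p1(1)] IL.sym_lift_var[OF u']
          WP.act_pure[OF uW WP.S.m_closed[OF ic] pure_degree_zero[OF x y]] WP.S.m_assoc[OF uW ic] ..
    next
      case (add w w')
      note ac = FP.act_closed[OF uS pc]
      show ?case
        unfolding \<Phi>_add_right[OF ac add(1,2)] \<Phi>_add_right[OF pc add(1,2)] add(3,4)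
          WP.act_add[OF uW \<Phi>_closed[OF pc add(1)] \<Phi>_closed[OF pc add(2)]] ..
    qed
  next
    case (add w w')
    show ?case
      unfolding FP.act_add[OF uS add(1,2)]
        \<Phi>_add_left[OF z' FP.act_closed[OF uS add(1)] FP.act_closed[OF uS add(2)]]
        \<Phi>_add_left[OF z' add(1,2)] add(3,4)
        WP.act_add[OF uW \<Phi>_closed[OF add(1) z'] \<Phi>_closed[OF add(2) z']] ..
  qed
qed

lemma \<Phi>_act_right:
  assumes v: "v \<in> Vg 1" and z: "z \<in> carrier FP.SD.T" and z': "z' \<in> carrier GP.SD.T"
  shows "\<Phi> z (GP.act (GP.SA.svar v) z') = WP.act (WP.SA.svar (eR v)) (\<Phi> z z')"
proof -
  have v': "v \<in> carrier GP.M1" using v by simp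
  note vS = GP.SA.sym_var_closed[OF v'] and vW = svar_eR_closed[OF v]
  show ?thesis using z
  proof (induction rule: FP.SD.tensor_induct)
    case p1: (pure s x)
    then have x: "x \<in> Fg 0" by simp
    have pc: "FP.SD.pt s x \<in> carrier FP.SD.T" using p1 by (rule FP.SD.pure_closed)
    from z' show ?case
    proof (induction rule: GP.SD.tensor_induct)
      case (pure t y)
      then have y: "y \<in> Gg 0" by simp
      have ic: "iL s \<in> carrier WP.SA.S" "iR t \<in> carrier WP.SA.S"
        using IL.sym_lift_closed[OF p1(1)] IR.sym_lift_closed[OF pure(1)] by simp_all
      \<comment> \<open>The new variable stands behind \<open>iL s\<close> and has to be commuted to
        the front.\<close>
      show ?case
        unfolding GP.act_pure[OF vS pure(1) y] \<Phi>_pure[OF p1(1) x GP.S.m_closed[OF vS pure(1)] y]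
          \<Phi>_pure[OF p1(1) x pure(1) y] IR.sym_lift_mult[OF vS pure(1)] IR.sym_lift_var[OF v']
          WP.act_pure[OF vW WP.S.m_closed[OF ic] pure_degree_zero[OF x y]]
          WP.S.m_lcomm[OF ic(1) vW ic(2)] ..
    next
      case (add w w')
      show ?case
        unfolding GP.act_add[OF vS add(1,2)]
          \<Phi>_add_right[OF pc GP.act_closed[OF vS add(1)] GP.act_closed[OF vS add(2)]]
          \<Phi>_add_right[OF pc add(1,2)] add(3,4)
          WP.act_add[OF vW \<Phi>_closed[OF pc add(1)] \<Phi>_closed[OF pc add(2)]] ..
    qed
  next
    case (add w w')
    note ac = GP.act_closed[OF vS z']
    show ?case
      unfolding \<Phi>_add_left[OF ac add(1,2)] \<Phi>_add_left[OF z' add(1,2)] add(3,4)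
        WP.act_add[OF vW \<Phi>_closed[OF add(1) z'] \<Phi>_closed[OF add(2) z']] ..
  qed
qed

end

text \<open>The group laws come from \<open>A_Mod\<close>, whose operations agree with those of
  \<open>quotient_module\<close>. This makes the quotient a legitimate target for
  \<open>tensor_lift_additive\<close>.\<close>

lemma quotient_module_abelian_group:
  assumes "abelian_group T" "subgroup N (add_monoid T)"
  shows "abelian_group (quotient_module T N)"
    and "additive_map T (quotient_module T N) (\<lambda>z. N +>\<^bsub>T\<^esub> z)"
proof -
  interpret T: abelian_group T by fact
  interpret N: abelian_subgroup N T
    by (rule abelian_subgroupI3[OF additive_subgroup.intro[OF assms(2)] assms(1)])
  show "abelian_group (quotient_module T N)"
  proof -
    interpret Q: comm_group "T A_Mod N" by (rule N.a_factorgroup_is_comm_group)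
    have eq: "carrier (quotient_module T N) = carrier (T A_Mod N)"
      "ring.add (quotient_module T N) = monoid.mult (T A_Mod N)"
      "ring.zero (quotient_module T N) = \<one>\<^bsub>T A_Mod N\<^esub>"
      by (simp_all add: quotient_module_def A_FactGroup_def')
    show ?thesis
    proof (rule abelian_groupI)
      fix x y assume "x \<in> carrier (quotient_module T N)" "y \<in> carrier (quotient_module T N)"
      then show "x \<oplus>\<^bsub>quotient_module T N\<^esub> y = y \<oplus>\<^bsub>quotient_module T N\<^esub> x"
        unfolding eq by (rule Q.m_comm)
    next
      fix x assume "x \<in> carrier (quotient_module T N)"
      then show "\<exists>y \<in> carrier (quotient_module T N). y \<oplus>\<^bsub>quotient_module T N\<^esub> x = \<zero>\<^bsub>quotient_module T N\<^esub>"
        unfolding eq by (rule Q.l_inv_ex)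
    qed (simp_all only: eq Q.m_closed Q.one_closed Q.m_assoc Q.l_one)
  qed
  show "additive_map T (quotient_module T N) (\<lambda>z. N +>\<^bsub>T\<^esub> z)"
    by (rule additive_mapI)
      (simp_all add: quotient_module_def T.a_rcosetsI[OF N.a_subset] N.a_rcos_sum)
qed

section \<open>Products generate the presentation of F \<otimes> G\<close>

context presented_module_pair
begin

text \<open>In degree one either p = 1 and v is a scalar multiple of 1, or q = 1 and u is; the
  scalar then moves across the tensor sign.\<close>

lemma degree_one_induct [consumes 1, case_names left right add]:
  assumes m: "m \<in> W.Tg 1"
    and left: "\<And>u. u \<in> Ug 1 \<Longrightarrow> Q (eL u)" and right: "\<And>v. v \<in> Vg 1 \<Longrightarrow> Q (eR v)"
    and add: "\<And>m m'. m \<in> W.Tg 1 \<Longrightarrow> m' \<in> W.Tg 1 \<Longrightarrow> Q m \<Longrightarrow> Q m' \<Longrightarrow> Q (m \<oplus>\<^bsub>W.T\<^esub> m')"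
  shows "Q m"
proof -
  \<comment> \<open>The \<open>add\<close> case of \<open>tensor_grading_induct\<close> forgets the
    degree of the summands, so membership is carried along.\<close>
  have "m \<in> W.Tg 1 \<and> Q m" using m
  proof (induction rule: W.tensor_grading_induct)
    case (pure u v p q)
    then consider "p = 1" "q = 0" | "p = 0" "q = 1" by (auto simp: One_nat_def add_is_1)
    then show ?case
    proof cases
      case 1
      then have u: "u \<in> Ug 1" and "v \<in> Vg 0" using pure by simp_all
      from this(2) have "v \<in> (\<lambda>a. a \<odot>\<^bsub>V\<^esub> \<one>\<^bsub>V\<^esub>) ` carrier A"
        using bij_betw_imp_surj_on[OF GV.UA.grade_zero] by simp
      then obtain a where a: "a \<in> carrier A" "v = a \<odot>\<^bsub>V\<^esub> \<one>\<^bsub>V\<^esub>" by blast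
      have au: "a \<odot>\<^bsub>U\<^esub> u \<in> Ug 1" by (rule submodule.smult_closed[OF FU.UA.submodule_grade a(1) u])
      have "W.pt u v = eL (a \<odot>\<^bsub>U\<^esub> u)"
        unfolding a(2) by (rule W.pure_smult[OF a(1) FU.UD.grade_carrier[OF u] GV.UA.one_closed, symmetric])
      then show ?thesis using left[OF au] eL_grade[OF au] by (simp only: simp_thms)
    next
      case 2
      then have v: "v \<in> Vg 1" and "u \<in> Ug 0" using pure by simp_all
      from this(2) have "u \<in> (\<lambda>a. a \<odot>\<^bsub>U\<^esub> \<one>\<^bsub>U\<^esub>) ` carrier A"
        using bij_betw_imp_surj_on[OF FU.UA.grade_zero] by simp
      then obtain a where a: "a \<in> carrier A" "u = a \<odot>\<^bsub>U\<^esub> \<one>\<^bsub>U\<^esub>" by blast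
      have av: "a \<odot>\<^bsub>V\<^esub> v \<in> Vg 1" by (rule submodule.smult_closed[OF GV.UA.submodule_grade a(1) v])
      have "W.pt u v = eR (a \<odot>\<^bsub>V\<^esub> v)"
        unfolding a(2) by (rule W.pure_smult[OF a(1) FU.UA.one_closed GV.UD.grade_carrier[OF v]])
      then show ?thesis using right[OF av] eR_grade[OF av] by (simp only: simp_thms)
    qed
  next
    case (add z z')
    then show ?case using assms(4) W.T.subgroup_add[OF W.tensor_grading_subgroup] by blast
  qed
  then show ?thesis ..
qed

text \<open>Since \<open>(U \<otimes> V)\<^sub>1 = U\<^sub>1 \<otimes> 1 + 1 \<otimes> V\<^sub>1\<close>, the presentation of \<open>F \<otimes> G\<close> is the product of those of
  \<open>F\<close> and \<open>G\<close>.\<close>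

lemma presentation_product_induct [consumes 1, case_names product add]:
  assumes w: "w \<in> WP.SD.Tg n"
    and product: "\<And>p q z z'. p + q = n \<Longrightarrow> z \<in> FP.SD.Tg p \<Longrightarrow> z' \<in> GP.SD.Tg q \<Longrightarrow> Q (\<Phi> z z')"
    and add: "\<And>w w'. w \<in> carrier WP.SD.T \<Longrightarrow> w' \<in> carrier WP.SD.T \<Longrightarrow> Q w \<Longrightarrow> Q w' \<Longrightarrow> Q (w \<oplus>\<^bsub>WP.SD.T\<^esub> w')"
  shows "Q w"
  using assms
\<comment> \<open>\<open>Q\<close> is generalised because the hypothesis is applied to the predicate
  \<open>Q (WP.act (WP.SA.svar (eL u)) w)\<close> of w, and likewise with
  \<open>eR v\<close>.\<close>
proof (induction n arbitrary: w Q)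
  case 0
  note product = "0.prems"(2) and add = "0.prems"(3)
  from "0.prems"(1) show ?case
  proof (induction rule: WP.presentation_grade_induct)
    case (pure s h)
    then obtain a where a: "a \<in> carrier A" "s = a \<odot>\<^bsub>WP.SA.S\<^esub> \<one>\<^bsub>WP.SA.S\<^esub>"
      unfolding WP.SA.sym_grading_zero by blast
    have sc: "s \<in> carrier WP.SA.S" by (rule WP.SA.sym_grading_closed[OF pure(1)])
    have "h \<in> X.Tg 0 \<and> Q (WP.SD.pt s h)" using pure(2)
    proof (induction rule: X.tensor_grading_induct)
      case (pure x y p q)
      then have x: "x \<in> Fg 0" and y: "y \<in> Gg 0" by simp_all
      \<comment> \<open>In degree zero the symmetric algebra consists of scalars; the scalar goes
        into the left factor, and 1 into the right one.\<close>
      let ?s = "a \<odot>\<^bsub>FP.SA.S\<^esub> \<one>\<^bsub>FP.SA.S\<^esub>" and ?t = "\<one> \<odot>\<^bsub>GP.SA.S\<^esub> \<one>\<^bsub>GP.SA.S\<^esub>"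
      have s: "?s \<in> FP.SA.Sg 0" unfolding FP.SA.sym_grading_zero using a(1) by blast
      have t: "?t \<in> GP.SA.Sg 0" unfolding GP.SA.sym_grading_zero using FU.UA.R.one_closed by blast
      have it: "iR ?t = \<one>\<^bsub>WP.SA.S\<^esub>"
        unfolding IR.sym_lift_scalar[OF FU.UA.R.one_closed] by (rule WP.S.smult_one[OF WP.S.one_closed])
      have "\<Phi> (FP.SD.pt ?s x) (GP.SD.pt ?t y) = WP.SD.pt s (X.pt x y)"
        unfolding \<Phi>_pure[OF FP.SA.sym_grading_closed[OF s] x GP.SA.sym_grading_closed[OF t] y]
          IL.sym_lift_scalar[OF a(1)] it a(2)[symmetric] WP.S.r_one[OF sc] ..
      moreover have "FP.SD.pt ?s x \<in> FP.SD.Tg (0 + 0)" using s x by (intro FP.SD.pure_grade) simp_all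
      moreover have "GP.SD.pt ?t y \<in> GP.SD.Tg (0 + 0)" using t y by (intro GP.SD.pure_grade) simp_all
      ultimately have "Q (WP.SD.pt s (X.pt x y))"
        using product[of 0 0 "FP.SD.pt ?s x" "GP.SD.pt ?t y"] by (simp only: add_0)
      then show ?case using pure_degree_zero[OF x y] by blast
    next
      case (add h h')
      then have h: "h \<in> carrier WP.D" "h' \<in> carrier WP.D" by simp_all
      have "WP.SD.pt s (h \<oplus>\<^bsub>X.T\<^esub> h') = WP.SD.pt s h \<oplus>\<^bsub>WP.SD.T\<^esub> WP.SD.pt s h'"
        using WP.SD.pure_add_right[OF sc h] by simp
      moreover have "Q (WP.SD.pt s h \<oplus>\<^bsub>WP.SD.T\<^esub> WP.SD.pt s h')"
        using add(3,4) WP.SD.pure_closed[OF sc h(1)] WP.SD.pure_closed[OF sc h(2)]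
        by (intro "0.prems"(3)) blast+
      moreover have "h \<oplus>\<^bsub>X.T\<^esub> h' \<in> X.Tg 0"
        using add(3,4) by (intro X.T.subgroup_add[OF X.tensor_grading_subgroup]) blast+
      ultimately show ?case by (simp only: simp_thms)
    qed
    then show ?case ..
  qed (rule add)
next
  case (Suc n)
  note product = Suc.prems(2) and add = Suc.prems(3)
  from Suc.prems(1) show ?case
  proof (induction rule: WP.presentation_grade_Suc_induct)
    case (act m w)
    have wc: "w \<in> carrier WP.SD.T" by (rule WP.SD.tensor_grading_carrier[OF act(2)])
    have Vc: "WP.SA.svar k \<in> carrier WP.SA.S" if "k \<in> W.Tg 1" for k
      using that WP.SA.sym_var_closed by simp
    from act(1) show ?case
    proof (induction rule: degree_one_induct)
      case (left u)
      note uc = Vc[OF eL_grade[OF left]]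
      show ?case
      \<comment> \<open>A product multiplied by the variable of u \<otimes> 1 is again a product,
        with first factor one degree higher.\<close>
      proof (rule Suc.IH[OF act(2)])
        fix p q z z' assume pq: "p + q = n" and z: "z \<in> FP.SD.Tg p" "z' \<in> GP.SD.Tg q"
        have e: "WP.act (WP.SA.svar (eL u)) (\<Phi> z z') = \<Phi> (FP.act (FP.SA.svar u) z) z'"
          by (rule \<Phi>_act_left[OF left FP.SD.tensor_grading_carrier[OF z(1)]
                GP.SD.tensor_grading_carrier[OF z(2)], symmetric])
        show "Q (WP.act (WP.SA.svar (eL u)) (\<Phi> z z'))"
          unfolding e
          by (rule product[OF _ FP.act_grade[OF left z(1)] z(2)]) (use pq in simp)
      next
        fix w w' assume w: "w \<in> carrier WP.SD.T" "w' \<in> carrier WP.SD.T"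
          "Q (WP.act (WP.SA.svar (eL u)) w)" "Q (WP.act (WP.SA.svar (eL u)) w')"
        show "Q (WP.act (WP.SA.svar (eL u)) (w \<oplus>\<^bsub>WP.SD.T\<^esub> w'))"
          unfolding WP.act_add[OF uc w(1,2)]
          by (rule add[OF WP.act_closed[OF uc w(1)] WP.act_closed[OF uc w(2)] w(3,4)])
      qed
    next
      case (right v)
      note vc = Vc[OF eR_grade[OF right]]
      show ?case
      proof (rule Suc.IH[OF act(2)])
        fix p q z z' assume pq: "p + q = n" and z: "z \<in> FP.SD.Tg p" "z' \<in> GP.SD.Tg q"
        have e: "WP.act (WP.SA.svar (eR v)) (\<Phi> z z') = \<Phi> z (GP.act (GP.SA.svar v) z')"
          by (rule \<Phi>_act_right[OF right FP.SD.tensor_grading_carrier[OF z(1)]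
                GP.SD.tensor_grading_carrier[OF z(2)], symmetric])
        show "Q (WP.act (WP.SA.svar (eR v)) (\<Phi> z z'))"
          unfolding e
          by (rule product[OF _ z(1) GP.act_grade[OF right z(2)]]) (use pq in simp)
      next
        fix w w' assume w: "w \<in> carrier WP.SD.T" "w' \<in> carrier WP.SD.T"
          "Q (WP.act (WP.SA.svar (eR v)) w)" "Q (WP.act (WP.SA.svar (eR v)) w')"
        show "Q (WP.act (WP.SA.svar (eR v)) (w \<oplus>\<^bsub>WP.SD.T\<^esub> w'))"
          unfolding WP.act_add[OF vc w(1,2)]
          by (rule add[OF WP.act_closed[OF vc w(1)] WP.act_closed[OF vc w(2)] w(3,4)])
      qed
    next
      case (add m m')
      note mc = Vc[OF add(1)] and mc' = Vc[OF add(2)]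
      have "m \<in> carrier WP.M1" "m' \<in> carrier WP.M1" using add(1,2) by simp_all
      from linear_map_add[OF WP.SA.sym_var_linear this]
      have "WP.SA.svar (m \<oplus>\<^bsub>W.T\<^esub> m') = WP.SA.svar m \<oplus>\<^bsub>WP.SA.S\<^esub> WP.SA.svar m'" by simp
      then have e: "WP.act (WP.SA.svar (m \<oplus>\<^bsub>W.T\<^esub> m')) w =
          WP.act (WP.SA.svar m) w \<oplus>\<^bsub>WP.SD.T\<^esub> WP.act (WP.SA.svar m') w"
        using WP.act_add_scalar[OF mc mc' wc] by (simp only:)
      show ?case unfolding e
        by (rule Suc.prems(3)[OF WP.act_closed[OF mc wc] WP.act_closed[OF mc' wc] add(3,4)])
    qed
  qed (rule add)
qed

text \<open>By \<open>presentation_map_\<Phi>\<close> the presentation map takes the product to a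
  tensor with a zero factor.\<close>

lemma \<Phi>_kernel:
  assumes "z \<in> FP.SD.Tg p" "z' \<in> GP.SD.Tg q" "FP.\<gamma> z = \<zero>\<^bsub>F\<^esub> \<or> GP.\<gamma> z' = \<zero>\<^bsub>G\<^esub>"
  shows "\<Phi> z z' \<in> WP.K (p + q)"
proof -
  note zc = FP.SD.tensor_grading_carrier[OF assms(1)] and zc' = GP.SD.tensor_grading_carrier[OF assms(2)]
  have "X.pt (FP.\<gamma> z) (GP.\<gamma> z') = \<zero>\<^bsub>X.T\<^esub>"
    using assms(3) X.pure_zero_left[of "GP.\<gamma> z'"] X.pure_zero_right[of "FP.\<gamma> z"]
      FP.presentation_map_closed[OF zc] GP.presentation_map_closed[OF zc'] by auto
  then have "WP.\<gamma> (\<Phi> z z') = \<zero>\<^bsub>FG\<^esub>" unfolding presentation_map_\<Phi>[OF zc zc'] by simp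
  then show ?thesis using \<Phi>_grade[OF assms(1,2)] unfolding WP.kernel_eq by blast
qed

text \<open>If the other factor has positive degree, a variable can be split off from it; otherwise the
  relation itself is decomposable by hypothesis.\<close>

lemma \<Phi>_kernel_left:
  assumes dec: "FP.K (Suc n) \<subseteq> FP.decomposable_relations n"
    and z: "z \<in> FP.K p" and z': "z' \<in> GP.SD.Tg q" and pq: "p + q = Suc n"
  shows "\<Phi> z z' \<in> WP.decomposable_relations n"
proof -
  have zg: "z \<in> FP.SD.Tg p" and \<gamma>z: "FP.\<gamma> z = \<zero>\<^bsub>F\<^esub>" using z unfolding FP.kernel_eq by simp_all
  note zc = FP.SD.tensor_grading_carrier[OF zg]
  note sub = WP.decomposable_subgroup[of n]
  show ?thesis
  proof (cases q)
    case 0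
    have z'c: "z' \<in> carrier GP.SD.T" by (rule GP.SD.tensor_grading_carrier[OF z'])
    \<comment> \<open>With q = 0 the degree p is n + 1, the one to which the hypothesis
      applies.\<close>
    have "z \<in> FP.decomposable_relations n" using dec z pq 0 by auto
    then have zd: "z \<in> generate (add_monoid FP.SD.T) {FP.act (FP.SA.svar u) k | u k. u \<in> Ug 1 \<and> k \<in> FP.K n}"
      unfolding FP.decomposable_relations_def .
    show ?thesis
    proof (rule additive_map_span[OF FP.SD.T.abelian_group_axioms WP.SD.T.abelian_group_axioms
          linear_map_additive[OF bilinear_map_left[OF PH.bimap_bilinear z'c]]
          FP.decomposable_generators sub _ zd])
      fix s assume "s \<in> {FP.act (FP.SA.svar u) k | u k. u \<in> Ug 1 \<and> k \<in> FP.K n}"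
      then obtain u k where s: "s = FP.act (FP.SA.svar u) k" "u \<in> Ug 1" "k \<in> FP.K n" by blast
      have kg: "k \<in> FP.SD.Tg n" "FP.\<gamma> k = \<zero>\<^bsub>F\<^esub>" using s(3) unfolding FP.kernel_eq by simp_all
      \<comment> \<open>A generator u k goes to u \<otimes> 1 times \<open>\<Phi> k z'\<close>, and
        the latter is a relation of degree n.\<close>
      have "\<Phi> k z' \<in> WP.K (n + q)" by (rule \<Phi>_kernel[OF kg(1) z' disjI1[OF kg(2)]])
      then have "\<Phi> k z' \<in> WP.K n" using 0 by simp
      then show "\<Phi> s z' \<in> WP.decomposable_relations n"
        unfolding s(1) \<Phi>_act_left[OF s(2) FP.SD.tensor_grading_carrier[OF kg(1)] z'c]
        by (rule WP.decomposable_act[OF eL_grade[OF s(2)]])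
    qed
  next
    case (Suc q')
    from z'[unfolded Suc] show ?thesis
    proof (induction rule: GP.presentation_grade_Suc_induct)
      case (act v y)
      have "\<Phi> z y \<in> WP.K (p + q')" by (rule \<Phi>_kernel[OF zg act(2) disjI1[OF \<gamma>z]])
      then have "\<Phi> z y \<in> WP.K n" using pq Suc by simp
      then show ?case
        unfolding \<Phi>_act_right[OF act(1) zc GP.SD.tensor_grading_carrier[OF act(2)]]
        by (rule WP.decomposable_act[OF eR_grade[OF act(1)]])
    next
      case (add y y')
      show ?case unfolding \<Phi>_add_right[OF zc add(1,2)]
        by (rule WP.SD.T.subgroup_add[OF sub add(3,4)])
    qed
  qed
qed

text \<open>Mirror image of \<open>\<Phi>_kernel_left\<close>: the case p = 0 calls on the
  hypothesis, and p > 0 provides a variable of the first factor.\<close>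

lemma \<Phi>_kernel_right:
  assumes dec: "GP.K (Suc n) \<subseteq> GP.decomposable_relations n"
    and z: "z \<in> FP.SD.Tg p" and z': "z' \<in> GP.K q" and pq: "p + q = Suc n"
  shows "\<Phi> z z' \<in> WP.decomposable_relations n"
proof -
  have zg': "z' \<in> GP.SD.Tg q" and \<gamma>z': "GP.\<gamma> z' = \<zero>\<^bsub>G\<^esub>" using z' unfolding GP.kernel_eq by simp_all
  note zc' = GP.SD.tensor_grading_carrier[OF zg']
  note sub = WP.decomposable_subgroup[of n]
  show ?thesis
  proof (cases p)
    case 0
    have zc: "z \<in> carrier FP.SD.T" by (rule FP.SD.tensor_grading_carrier[OF z])
    have "z' \<in> GP.decomposable_relations n" using dec z' pq 0 by auto
    then have zd: "z' \<in> generate (add_monoid GP.SD.T) {GP.act (GP.SA.svar v) k | v k. v \<in> Vg 1 \<and> k \<in> GP.K n}"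
      unfolding GP.decomposable_relations_def .
    show ?thesis
    proof (rule additive_map_span[OF GP.SD.T.abelian_group_axioms WP.SD.T.abelian_group_axioms
          linear_map_additive[OF bilinear_map_right[OF PH.bimap_bilinear zc]]
          GP.decomposable_generators sub _ zd])
      fix s assume "s \<in> {GP.act (GP.SA.svar v) k | v k. v \<in> Vg 1 \<and> k \<in> GP.K n}"
      then obtain v k where s: "s = GP.act (GP.SA.svar v) k" "v \<in> Vg 1" "k \<in> GP.K n" by blast
      have kg: "k \<in> GP.SD.Tg n" "GP.\<gamma> k = \<zero>\<^bsub>G\<^esub>" using s(3) unfolding GP.kernel_eq by simp_all
      have "\<Phi> z k \<in> WP.K (p + n)" by (rule \<Phi>_kernel[OF z kg(1) disjI2[OF kg(2)]])
      then have "\<Phi> z k \<in> WP.K n" using 0 by simp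
      then show "\<Phi> z s \<in> WP.decomposable_relations n"
        unfolding s(1) \<Phi>_act_right[OF s(2) zc GP.SD.tensor_grading_carrier[OF kg(1)]]
        by (rule WP.decomposable_act[OF eR_grade[OF s(2)]])
    qed
  next
    case (Suc p')
    from z[unfolded Suc] show ?thesis
    proof (induction rule: FP.presentation_grade_Suc_induct)
      case (act u y)
      have "\<Phi> y z' \<in> WP.K (p' + q)" by (rule \<Phi>_kernel[OF act(2) zg' disjI2[OF \<gamma>z']])
      then have "\<Phi> y z' \<in> WP.K n" using pq Suc by simp
      then show ?case
        unfolding \<Phi>_act_left[OF act(1) FP.SD.tensor_grading_carrier[OF act(2)] zc']
        by (rule WP.decomposable_act[OF eL_grade[OF act(1)]])
    next
      case (add y y')
      show ?case unfolding \<Phi>_add_left[OF zc' add(1,2)]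
        by (rule WP.SD.T.subgroup_add[OF sub add(3,4)])
    qed
  qed
qed

end

section \<open>The inverse modulo decomposable relations\<close>

context presented_module_pair
begin

text \<open>Lifting homogeneous elements through the presentations of \<open>F\<close> and \<open>G\<close> gives an inverse of
  \<open>WP.\<gamma>\<close> modulo decomposable relations.\<close>

lemma kernel_decomposable:
  assumes decF: "FP.K (Suc n) \<subseteq> FP.decomposable_relations n"
    and decG: "GP.K (Suc n) \<subseteq> GP.decomposable_relations n"
  shows "WP.K (Suc n) \<subseteq> WP.decomposable_relations n"
proof -
  define N where "N = WP.decomposable_relations n"
  \<comment> \<open>The whole presentation is divided, not just its part of degree n + 1. The coset
    map \<open>c\<close> vanishes exactly on \<open>N\<close>, and this is what the conclusion is
    read off from.\<close>
  define B where "B = quotient_module WP.SD.T N"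
  define c where "c = (\<lambda>z. N +>\<^bsub>WP.SD.T\<^esub> z)"
  have N: "subgroup N (add_monoid WP.SD.T)" unfolding N_def by (rule WP.decomposable_subgroup)
  have abB: "abelian_group B" and cB: "additive_map WP.SD.T B c"
    unfolding B_def c_def by (rule quotient_module_abelian_group[OF WP.SD.T.abelian_group_axioms N])+
  interpret B: abelian_group B by (rule abB)
  interpret Ns: abelian_subgroup N WP.SD.T
    by (rule abelian_subgroupI3[OF additive_subgroup.intro[OF N] WP.SD.T.abelian_group_axioms])
  have c_null: "c w = \<zero>\<^bsub>B\<^esub>" if "w \<in> N" for w
    unfolding c_def B_def using Ns.a_rcos_const[OF that] by (simp add: quotient_module_def)
  have null_c: "w \<in> N" if "w \<in> carrier WP.SD.T" "c w = \<zero>\<^bsub>B\<^esub>" for w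
    using Ns.a_rcos_self[OF that(1)] that(2) by (simp add: c_def B_def quotient_module_def)
  note c_closed = additive_map_closed[OF cB] and c_add = additive_map_add[OF cB]
  have shift: "c (w \<oplus>\<^bsub>WP.SD.T\<^esub> k) = c w" if "w \<in> carrier WP.SD.T" "k \<in> N" for w k
    using c_add[OF that(1) Ns.a_Hcarr[OF that(2)]] c_null[OF that(2)] c_closed[OF that(1)] by simp

  \<comment> \<open>Arbitrary homogeneous lifts; they need not be additive, and become harmless
    through \<open>key\<close>.\<close>
  define lF where "lF = (\<lambda>p x. SOME z. z \<in> FP.SD.Tg p \<and> FP.\<gamma> z = x)"
  define lG where "lG = (\<lambda>q y. SOME z. z \<in> GP.SD.Tg q \<and> GP.\<gamma> z = y)"
  have lF: "lF p x \<in> FP.SD.Tg p \<and> FP.\<gamma> (lF p x) = x" if "x \<in> Fg p" for p x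
    unfolding lF_def by (rule someI_ex) (use FP.presentation_map_surj[OF that] in blast)
  have lG: "lG q y \<in> GP.SD.Tg q \<and> GP.\<gamma> (lG q y) = y" if "y \<in> Gg q" for q y
    unfolding lG_def by (rule someI_ex) (use GP.presentation_map_surj[OF that] in blast)

  define d where "d = (\<lambda>p x y. c (\<Phi> (lF p x) (lG (Suc n - p) y)))"
  \<comment> \<open>Lifts are exchanged one factor at a time. For lifts z + k and z' + k' the
    product changes by \<open>\<Phi>\<close> of k with z' + k' and by \<open>\<Phi>\<close> of z
    with k'; both are decomposable.\<close>
  have key: "d p (FP.\<gamma> z) (GP.\<gamma> z') = c (\<Phi> z z')"
    if z: "z \<in> FP.SD.Tg p" and z': "z' \<in> GP.SD.Tg (Suc n - p)" and p: "p \<le> Suc n" for p z z'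
  proof -
    let ?q = "Suc n - p" and ?z1 = "lF p (FP.\<gamma> z)" and ?z1' = "lG (Suc n - p) (GP.\<gamma> z')"
    have pq: "p + ?q = Suc n" using p by simp
    have z1: "?z1 \<in> FP.SD.Tg p" "FP.\<gamma> ?z1 = FP.\<gamma> z"
      using lF[OF FP.presentation_map_grade[OF z]] by simp_all
    have z1': "?z1' \<in> GP.SD.Tg ?q" "GP.\<gamma> ?z1' = GP.\<gamma> z'"
      using lG[OF GP.presentation_map_grade[OF z']] by simp_all
    obtain k where k: "k \<in> FP.K p" "?z1 = z \<oplus>\<^bsub>FP.SD.T\<^esub> k" using FP.kernel_difference[OF z z1] by blast
    obtain k' where k': "k' \<in> GP.K ?q" "?z1' = z' \<oplus>\<^bsub>GP.SD.T\<^esub> k'" using GP.kernel_difference[OF z' z1'] by blast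
    note zc = FP.SD.tensor_grading_carrier[OF z] and zc' = GP.SD.tensor_grading_carrier[OF z']
    note z1c' = GP.SD.tensor_grading_carrier[OF z1'(1)]
    have 1: "\<Phi> k ?z1' \<in> N" unfolding N_def by (rule \<Phi>_kernel_left[OF decF k(1) z1'(1) pq])
    have 2: "\<Phi> z k' \<in> N" unfolding N_def by (rule \<Phi>_kernel_right[OF decG z k'(1) pq])
    have "c (\<Phi> ?z1 ?z1') = c (\<Phi> z ?z1' \<oplus>\<^bsub>WP.SD.T\<^esub> \<Phi> k ?z1')"
      unfolding k(2) \<Phi>_add_left[OF z1c' zc FP.kernel_carrier[OF k(1)]] ..
    also have "\<dots> = c (\<Phi> z ?z1')" by (rule shift[OF \<Phi>_closed[OF zc z1c'] 1])
    also have "\<dots> = c (\<Phi> z z' \<oplus>\<^bsub>WP.SD.T\<^esub> \<Phi> z k')"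
      unfolding k'(2) \<Phi>_add_right[OF zc zc' GP.kernel_carrier[OF k'(1)]] ..
    also have "\<dots> = c (\<Phi> z z')" by (rule shift[OF \<Phi>_closed[OF zc zc'] 2])
    finally show ?thesis unfolding d_def .
  qed

  \<comment> \<open>By \<open>key\<close>, \<open>d\<close> may be computed with any lifts, in
    particular with sums and scalar multiples of lifts; so it inherits additivity and balance from
    the bilinearity of \<open>\<Phi>\<close>.\<close>
  have d_props: "d p x y \<in> carrier B"
      "\<And>x'. x' \<in> Fg p \<Longrightarrow> d p (x \<oplus>\<^bsub>F\<^esub> x') y = d p x y \<oplus>\<^bsub>B\<^esub> d p x' y"
      "\<And>y'. y' \<in> Gg (Suc n - p) \<Longrightarrow> d p x (y \<oplus>\<^bsub>G\<^esub> y') = d p x y \<oplus>\<^bsub>B\<^esub> d p x y'"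
      "\<And>a. a \<in> carrier A \<Longrightarrow> d p (a \<odot>\<^bsub>F'\<^esub> x) y = d p x (a \<odot>\<^bsub>G'\<^esub> y)"
    if p: "p \<le> Suc n" and x: "x \<in> Fg p" and y: "y \<in> Gg (Suc n - p)" for p x y
  proof -
    obtain z where z: "z \<in> FP.SD.Tg p" "FP.\<gamma> z = x" using FP.presentation_map_surj[OF x] by blast
    obtain w where w: "w \<in> GP.SD.Tg (Suc n - p)" "GP.\<gamma> w = y"
      using GP.presentation_map_surj[OF y] by blast
    note zc = FP.SD.tensor_grading_carrier[OF z(1)] and wc = GP.SD.tensor_grading_carrier[OF w(1)]
    have dxy: "d p x y = c (\<Phi> z w)" using key[OF z(1) w(1) p] unfolding z(2) w(2) .
    show "d p x y \<in> carrier B" unfolding dxy by (rule c_closed[OF \<Phi>_closed[OF zc wc]])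
    show "d p (x \<oplus>\<^bsub>F\<^esub> x') y = d p x y \<oplus>\<^bsub>B\<^esub> d p x' y" if x': "x' \<in> Fg p" for x'
    proof -
      obtain z' where z': "z' \<in> FP.SD.Tg p" "FP.\<gamma> z' = x'" using FP.presentation_map_surj[OF x'] by blast
      note zc' = FP.SD.tensor_grading_carrier[OF z'(1)]
      have "d p (FP.\<gamma> (z \<oplus>\<^bsub>FP.SD.T\<^esub> z')) (GP.\<gamma> w) = c (\<Phi> (z \<oplus>\<^bsub>FP.SD.T\<^esub> z') w)"
        by (rule key[OF FP.SD.T.subgroup_add[OF FP.SD.tensor_grading_subgroup z(1) z'(1)] w(1) p])
      also have "\<dots> = c (\<Phi> z w) \<oplus>\<^bsub>B\<^esub> c (\<Phi> z' w)"
        unfolding \<Phi>_add_left[OF wc zc zc'] by (rule c_add[OF \<Phi>_closed[OF zc wc] \<Phi>_closed[OF zc' wc]])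
      finally show ?thesis
        unfolding FP.presentation_map_add[OF zc zc'] key[OF z(1) w(1) p, symmetric]
          key[OF z'(1) w(1) p, symmetric] z(2) z'(2) w(2) .
    qed
    show "d p x (y \<oplus>\<^bsub>G\<^esub> y') = d p x y \<oplus>\<^bsub>B\<^esub> d p x y'" if y': "y' \<in> Gg (Suc n - p)" for y'
    proof -
      obtain w' where w': "w' \<in> GP.SD.Tg (Suc n - p)" "GP.\<gamma> w' = y'"
        using GP.presentation_map_surj[OF y'] by blast
      note wc' = GP.SD.tensor_grading_carrier[OF w'(1)]
      have "d p (FP.\<gamma> z) (GP.\<gamma> (w \<oplus>\<^bsub>GP.SD.T\<^esub> w')) = c (\<Phi> z (w \<oplus>\<^bsub>GP.SD.T\<^esub> w'))"
        by (rule key[OF z(1) GP.SD.T.subgroup_add[OF GP.SD.tensor_grading_subgroup w(1) w'(1)] p])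
      also have "\<dots> = c (\<Phi> z w) \<oplus>\<^bsub>B\<^esub> c (\<Phi> z w')"
        unfolding \<Phi>_add_right[OF zc wc wc'] by (rule c_add[OF \<Phi>_closed[OF zc wc] \<Phi>_closed[OF zc wc']])
      finally show ?thesis
        unfolding GP.presentation_map_add[OF wc wc'] key[OF z(1) w(1) p, symmetric]
          key[OF z(1) w'(1) p, symmetric] z(2) w(2) w'(2) .
    qed
    show "d p (a \<odot>\<^bsub>F'\<^esub> x) y = d p x (a \<odot>\<^bsub>G'\<^esub> y)" if a: "a \<in> carrier A" for a
    proof -
      have "d p (FP.\<gamma> (a \<odot>\<^bsub>FP.SD.T\<^esub> z)) (GP.\<gamma> w) = c (\<Phi> (a \<odot>\<^bsub>FP.SD.T\<^esub> z) w)"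
        by (rule key[OF submodule.smult_closed[OF FP.SD.tensor_grading_submodule a z(1)] w(1) p])
      also have "\<Phi> (a \<odot>\<^bsub>FP.SD.T\<^esub> z) w = \<Phi> z (a \<odot>\<^bsub>GP.SD.T\<^esub> w)"
        unfolding \<Phi>_smult_left[OF wc a zc] \<Phi>_smult_right[OF zc a wc] ..
      also have "c (\<Phi> z (a \<odot>\<^bsub>GP.SD.T\<^esub> w)) = d p (FP.\<gamma> z) (GP.\<gamma> (a \<odot>\<^bsub>GP.SD.T\<^esub> w))"
        by (rule key[OF z(1) submodule.smult_closed[OF GP.SD.tensor_grading_submodule a w(1)] p, symmetric])
      finally show ?thesis
        unfolding linear_map_smult[OF FP.presentation_map_linear a zc]
          linear_map_smult[OF GP.presentation_map_linear a wc] z(2) w(2) .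
    qed
  qed
  have d_zero: "d p \<zero>\<^bsub>F\<^esub> y = \<zero>\<^bsub>B\<^esub>" if p: "p \<le> Suc n" and y: "y \<in> Gg (Suc n - p)" for p y
  proof -
    have z: "\<zero>\<^bsub>F\<^esub> \<in> Fg p" by (rule FU.FM.M.subgroup_zero[OF FU.FD.grade_subgroup])
    have "d p (\<zero>\<^bsub>F\<^esub> \<oplus>\<^bsub>F\<^esub> \<zero>\<^bsub>F\<^esub>) y = d p \<zero>\<^bsub>F\<^esub> y \<oplus>\<^bsub>B\<^esub> d p \<zero>\<^bsub>F\<^esub> y" by (rule d_props(2)[OF p z y z])
    then show ?thesis using d_props(1)[OF p z y] by simp
  qed

  \<comment> \<open>\<open>tensor_lift\<close> asks for a map on all of F x G, so \<open>d\<close>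
    is summed over the components of bidegree (p, n + 1 - p). As p stops at n + 1, the difference is
    exact.\<close>
  define \<phi> where "\<phi> = (\<lambda>x y. finsum B (\<lambda>p. d p (X.MD.cmp p x) (X.ND.cmp (Suc n - p) y)) {..Suc n})"
  have gF: "X.MD.cmp p x \<in> Fg p" if "x \<in> carrier F'" for p x by (rule X.MD.component_grade[OF that])
  have gG: "X.ND.cmp q y \<in> Gg q" if "y \<in> carrier G'" for q y by (rule X.ND.component_grade[OF that])
  have right: "additive_map G' B (\<phi> x)" if x: "x \<in> carrier F'" for x
    unfolding \<phi>_def
  proof (rule additive_finsum_maps[OF abB])
    fix p assume "p \<in> {..Suc n}"
    then have p: "p \<le> Suc n" by simp
    show "additive_map G' B (\<lambda>y. d p (X.MD.cmp p x) (X.ND.cmp (Suc n - p) y))"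
    proof (rule additive_mapI)
      fix y assume y: "y \<in> carrier G'"
      show "d p (X.MD.cmp p x) (X.ND.cmp (Suc n - p) y) \<in> carrier B"
        by (rule d_props(1)[OF p gF[OF x] gG[OF y]])
      fix y' assume y': "y' \<in> carrier G'"
      show "d p (X.MD.cmp p x) (X.ND.cmp (Suc n - p) (y \<oplus>\<^bsub>G'\<^esub> y')) =
          d p (X.MD.cmp p x) (X.ND.cmp (Suc n - p) y) \<oplus>\<^bsub>B\<^esub> d p (X.MD.cmp p x) (X.ND.cmp (Suc n - p) y')"
        using d_props(3)[OF p gF[OF x] gG[OF y] gG[OF y']]
        unfolding additive_map_add[OF X.ND.component_additive y y'] by simp
    qed
  qed simp
  have left: "additive_map F' B (\<lambda>x. \<phi> x y)" if y: "y \<in> carrier G'" for y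
    unfolding \<phi>_def
  proof (rule additive_finsum_maps[OF abB])
    fix p assume "p \<in> {..Suc n}"
    then have p: "p \<le> Suc n" by simp
    show "additive_map F' B (\<lambda>x. d p (X.MD.cmp p x) (X.ND.cmp (Suc n - p) y))"
    proof (rule additive_mapI)
      fix x assume x: "x \<in> carrier F'"
      show "d p (X.MD.cmp p x) (X.ND.cmp (Suc n - p) y) \<in> carrier B"
        by (rule d_props(1)[OF p gF[OF x] gG[OF y]])
      fix x' assume x': "x' \<in> carrier F'"
      show "d p (X.MD.cmp p (x \<oplus>\<^bsub>F'\<^esub> x')) (X.ND.cmp (Suc n - p) y) =
          d p (X.MD.cmp p x) (X.ND.cmp (Suc n - p) y) \<oplus>\<^bsub>B\<^esub> d p (X.MD.cmp p x') (X.ND.cmp (Suc n - p) y)"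
        using d_props(2)[OF p gF[OF x] gG[OF y] gF[OF x']]
        unfolding additive_map_add[OF X.MD.component_additive x x'] by simp
    qed
  qed simp
  have bal: "\<phi> (a \<odot>\<^bsub>F'\<^esub> x) y = \<phi> x (a \<odot>\<^bsub>G'\<^esub> y)"
    if a: "a \<in> carrier A" and x: "x \<in> carrier F'" and y: "y \<in> carrier G'" for a x y
    unfolding \<phi>_def
  proof (rule B.finsum_cong'[OF refl])
    have ay: "a \<odot>\<^bsub>G'\<^esub> y \<in> carrier G'" by (rule X.N.smult_closed[OF a y])
    show "(\<lambda>p. d p (X.MD.cmp p x) (X.ND.cmp (Suc n - p) (a \<odot>\<^bsub>G'\<^esub> y))) \<in> {..Suc n} \<rightarrow> carrier B"
      using d_props(1)[OF _ gF[OF x] gG[OF ay]] by simp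
    fix p assume "p \<in> {..Suc n}"
    then have p: "p \<le> Suc n" by simp
    show "d p (X.MD.cmp p (a \<odot>\<^bsub>F'\<^esub> x)) (X.ND.cmp (Suc n - p) y) =
        d p (X.MD.cmp p x) (X.ND.cmp (Suc n - p) (a \<odot>\<^bsub>G'\<^esub> y))"
      unfolding linear_map_smult[OF X.component_linear_M a x] linear_map_smult[OF X.component_linear_N a y]
      by (rule d_props(4)[OF p gF[OF x] gG[OF y] a])
  qed
  have b\<phi>: "balanced A F' G' (add_monoid B) \<phi>"
    unfolding balanced_def monoid.simps partial_object.simps
  proof (intro conjI ballI)
    fix x y assume x: "x \<in> carrier F'" and y: "y \<in> carrier G'"
    show "\<phi> x y \<in> carrier B" by (rule additive_map_closed[OF right[OF x] y])
    show "\<phi> (x \<oplus>\<^bsub>F'\<^esub> x') y = \<phi> x y \<oplus>\<^bsub>B\<^esub> \<phi> x' y" if "x' \<in> carrier F'" for x'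
      by (rule additive_map_add[OF left[OF y] x that])
    show "\<phi> x (y \<oplus>\<^bsub>G'\<^esub> y') = \<phi> x y \<oplus>\<^bsub>B\<^esub> \<phi> x y'" if "y' \<in> carrier G'" for y'
      by (rule additive_map_add[OF right[OF x] y that])
    show "\<phi> (a \<odot>\<^bsub>F'\<^esub> x) y = \<phi> x (a \<odot>\<^bsub>G'\<^esub> y)" if "a \<in> carrier A" for a
      by (rule bal[OF that x y])
  qed

  define \<Delta> where "\<Delta> = tensor_lift (add_monoid B) \<phi>"
  have \<Delta>B: "additive_map X.T B \<Delta>" unfolding \<Delta>_def by (rule X.tensor_lift_additive[OF abB b\<phi>])
  \<comment> \<open>Only products have to be checked, and for a product of z and z' these two may
    serve as lifts, by \<open>key\<close>.\<close>
  have inverse: "\<Delta> (WP.\<gamma> w) = c w" if "w \<in> WP.SD.Tg (Suc n)" for w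
    using that
  proof (induction rule: presentation_product_induct)
    case (product p q z z')
    note zc = FP.SD.tensor_grading_carrier[OF product(2)] and zc' = GP.SD.tensor_grading_carrier[OF product(3)]
    have q: "q = Suc n - p" and p: "p \<le> Suc n" using product(1) by simp_all
    note x = FP.presentation_map_grade[OF product(2)] and y = GP.presentation_map_grade[OF product(3)]
    have xc: "FP.\<gamma> z \<in> carrier F'" and yc: "GP.\<gamma> z' \<in> carrier G'"
      using FP.presentation_map_closed[OF zc] GP.presentation_map_closed[OF zc'] by simp_all
    have "\<Delta> (WP.\<gamma> (\<Phi> z z')) = \<phi> (FP.\<gamma> z) (GP.\<gamma> z')"
      unfolding presentation_map_\<Phi>[OF zc zc'] \<Delta>_def by (rule X.tensor_lift_pure_add[OF abB b\<phi> xc yc])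
    \<comment> \<open>The image of z is homogeneous of degree p, so its other components are zero
      and \<open>d_zero\<close> removes their summands.\<close>
    also have "\<dots> = finsum B (\<lambda>i. if p = i then d p (FP.\<gamma> z) (X.ND.cmp (Suc n - p) (GP.\<gamma> z')) else \<zero>\<^bsub>B\<^esub>) {..Suc n}"
      unfolding \<phi>_def
    proof (rule B.finsum_cong'[OF refl])
      show "(\<lambda>i. if p = i then d p (FP.\<gamma> z) (X.ND.cmp (Suc n - p) (GP.\<gamma> z')) else \<zero>\<^bsub>B\<^esub>) \<in> {..Suc n} \<rightarrow> carrier B"
        using d_props(1)[OF p x gG[OF yc]] by auto
      fix i assume "i \<in> {..Suc n}"
      then have i: "i \<le> Suc n" by simp
      show "d i (X.MD.cmp i (FP.\<gamma> z)) (X.ND.cmp (Suc n - i) (GP.\<gamma> z')) =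
          (if p = i then d p (FP.\<gamma> z) (X.ND.cmp (Suc n - p) (GP.\<gamma> z')) else \<zero>\<^bsub>B\<^esub>)"
        unfolding X.MD.component_homogeneous[OF x] using d_zero[OF i gG[OF yc]] by simp
    qed
    also have "\<dots> = d p (FP.\<gamma> z) (X.ND.cmp (Suc n - p) (GP.\<gamma> z'))"
      using d_props(1)[OF p x gG[OF yc]] p by (intro B.add.finprod_singleton) auto
    also have "X.ND.cmp (Suc n - p) (GP.\<gamma> z') = GP.\<gamma> z'"
      unfolding X.ND.component_homogeneous[OF y] using q by simp
    also have "d p (FP.\<gamma> z) (GP.\<gamma> z') = c (\<Phi> z z')"
      by (rule key[OF product(2) _ p]) (use product(3) q in simp)
    finally show ?case .
  next
    case (add w w')
    have "WP.\<gamma> w \<in> carrier X.T" "WP.\<gamma> w' \<in> carrier X.T"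
      using WP.presentation_map_closed[OF add(1)] WP.presentation_map_closed[OF add(2)] by simp_all
    from additive_map_add[OF \<Delta>B this] show ?case
      unfolding WP.presentation_map_add[OF add(1,2)] c_add[OF add(1,2)] add(3,4)[symmetric] by simp
  qed
  have \<Delta>0: "\<Delta> \<zero>\<^bsub>X.T\<^esub> = \<zero>\<^bsub>B\<^esub>" by (rule additive_zero[OF X.T.abelian_group_axioms abB \<Delta>B])
  show ?thesis
  proof
    fix w assume "w \<in> WP.K (Suc n)"
    then have w: "w \<in> WP.SD.Tg (Suc n)" "WP.\<gamma> w = \<zero>\<^bsub>X.T\<^esub>" unfolding WP.kernel_eq by simp_all
    have "c w = \<zero>\<^bsub>B\<^esub>" using inverse[OF w(1)] \<Delta>0 unfolding w(2) by simp
    then show "w \<in> WP.decomposable_relations n"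
      using null_c[OF WP.SD.tensor_grading_carrier[OF w(1)]] unfolding N_def by blast
  qed
qed

end


section \<open>The relation type\<close>

text \<open>The set in \<open>top_degree\<close> is upward closed among finite values, and a
  nonempty set of \<open>enat\<close> contains its infimum. The first fact carries vanishing from
  the infimum up to r.\<close>

lemma top_degree_le_iff:
  assumes "r \<ge> 1"
  shows "top_degree E \<le> enat r \<longleftrightarrow> (\<forall>n \<ge> r + 1. carrier (E n) = {\<zero>\<^bsub>E n\<^esub>})"
proof
  let ?S = "{enat r | r. r \<ge> 1 \<and> (\<forall>n \<ge> r + 1. carrier (E n) = {\<zero>\<^bsub>E n\<^esub>})}"
  assume le: "top_degree E \<le> enat r"
  have "?S \<noteq> {}"
  proof
    assume "?S = {}"
    then have "top_degree E = \<infinity>" by (simp only: top_degree_def Inf_empty top_enat_def)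
    then show False using le by simp
  qed
  then obtain x where "x \<in> ?S" by blast
  then have "Inf ?S \<in> ?S" unfolding Inf_enat_def by (metis (mono_tags, lifting) LeastI empty_iff)
  then obtain k where "top_degree E = enat k" "\<forall>n \<ge> k + 1. carrier (E n) = {\<zero>\<^bsub>E n\<^esub>}"
    unfolding top_degree_def by blast
  then show "\<forall>n \<ge> r + 1. carrier (E n) = {\<zero>\<^bsub>E n\<^esub>}" using le by auto
next
  assume "\<forall>n \<ge> r + 1. carrier (E n) = {\<zero>\<^bsub>E n\<^esub>}"
  then show "top_degree E \<le> enat r" unfolding top_degree_def using assms by (intro Inf_lower) blast
qed

lemma top_degree_ge_one: "top_degree E \<ge> enat 1"
  unfolding top_degree_def by (rule Inf_greatest) auto

text \<open>Beyond a finite maximum r both sequences vanish, hence so does the third, degree by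
  degree; an infinite maximum leaves nothing to show. That r \<ge> 1 comes from the lower bound
  built into \<open>top_degree\<close>.\<close>

lemma top_degree_le_max:
  assumes "\<And>n. n \<ge> 1 \<Longrightarrow> carrier (E1 n) = {\<zero>\<^bsub>E1 n\<^esub>} \<Longrightarrow> carrier (E2 n) = {\<zero>\<^bsub>E2 n\<^esub>} \<Longrightarrow>
    carrier (E n) = {\<zero>\<^bsub>E n\<^esub>}"
  shows "top_degree E \<le> max (top_degree E1) (top_degree E2)"
proof (cases "max (top_degree E1) (top_degree E2)")
  case (enat r)
  then have "enat 1 \<le> enat r" using top_degree_ge_one[of E1] by (metis max.coboundedI1)
  then have r: "r \<ge> 1" by simp
  have "top_degree E1 \<le> enat r" "top_degree E2 \<le> enat r" using enat by (metis max.cobounded1 max.cobounded2)+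
  then have "\<forall>n \<ge> r + 1. carrier (E n) = {\<zero>\<^bsub>E n\<^esub>}"
    using assms by (simp add: top_degree_le_iff[OF r])
  then show ?thesis using enat by (simp add: top_degree_le_iff[OF r])
qed simp

theorem theorem2:
  fixes A :: "'a ring"
    and U :: "('a, 'u) module" and Ug :: "nat \<Rightarrow> 'u set"
    and V :: "('a, 'v) module" and Vg :: "nat \<Rightarrow> 'v set"
    and F :: "('u, 'f) module" and Fg :: "nat \<Rightarrow> 'f set"
    and G :: "('v, 'g) module" and Gg :: "nat \<Rightarrow> 'g set"
  defines "UV \<equiv> tensor_algebra A U V"
    and "UVg \<equiv> tensor_grading A U V Ug Vg"
    and "FG \<equiv> tensor_module_over A U V F G"
    and "FGg \<equiv> tensor_grading A (restrict_scalars U F) (restrict_scalars V G) Fg Gg"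
  assumes "cring A"
    and "standard_algebra A U Ug"
    and "standard_algebra A V Vg"
    and "standard_module U Ug F Fg"
    and "standard_module V Vg G Gg"
  shows "standard_algebra A UV UVg
       \<and> standard_module UV UVg FG FGg
       \<and> relation_type A UV UVg FG FGg \<le> max (relation_type A U Ug F Fg) (relation_type A V Vg G Gg)"
proof -
  interpret T: presented_module_pair A U Ug F Fg V Vg G Gg
    by (intro presented_module_pair.intro standard_module_pair.intro
        standard_module_over_algebra.intro assms(6-9))
  have "relation_type A UV UVg FG FGg \<le> max (relation_type A U Ug F Fg) (relation_type A V Vg G Gg)"
    unfolding relation_type_def
  proof (rule top_degree_le_max)
    fix n :: nat
    assume "n \<ge> 1"
    \<comment> \<open>The form \<open>Suc m\<close> matches
      \<open>effective_relations_trivial_iff\<close>, which turns all three vanishing statements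
      into inclusions.\<close>
    then obtain m where n: "n = Suc m" by (cases n) auto
    assume "carrier (effective_relations A U Ug F Fg n) = {\<zero>\<^bsub>effective_relations A U Ug F Fg n\<^esub>}"
      and "carrier (effective_relations A V Vg G Gg n) = {\<zero>\<^bsub>effective_relations A V Vg G Gg n\<^esub>}"
    then show "carrier (effective_relations A UV UVg FG FGg n) = {\<zero>\<^bsub>effective_relations A UV UVg FG FGg n\<^esub>}"
      unfolding n UV_def UVg_def FG_def FGg_def T.FP.effective_relations_trivial_iff
        T.GP.effective_relations_trivial_iff T.WP.effective_relations_trivial_iff
      by (rule T.kernel_decomposable)
  qed
  then show ?thesis
    using T.W.tensor_algebra_standard T.tensor_module_standard
    unfolding UV_def UVg_def FG_def FGg_def by blast
qed

end
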